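(* Let $G$ be a $w\times h$ rectangular grid graph with turn costs $1$ for $90$-degree turns and $0$ for straight traversals, and let $m$ be its number of edges. In $O(m)$ time one can compute a threading of $G$ with $2\lceil w/2\rceil\cdot 2\lceil h/2\rceil$ turns if at least one of $w$ and $h$ is even (and this is optimal, i.e., no threading of $G$ has fewer turns), or with $2\lceil w/2\rceil\cdot 2\lceil h/2\rceil-4$ turns if both $w$ and $h$ are odd.
   Context: A $w\times h$ rectangular grid graph is the lattice graph with $w$ rows and $h$ columns of vertices, adjacent vertices being horizontal or vertical neighbours. A turn at a vertex $v$ is an unordered pair of distinct edges incident to $v$; its cost is $1$ if the two edges are perpendicular (a $90$-degree turn) and $0$ if they are collinear. The turn cost (number of turns) of a closed walk is the sum of the costs of its consecutive pairs of edges, cyclically. The junction graph $J(v)$ induced by a closed walk at vertex $v$ has one vertex for each edge incident to $v$, and an edge between two of these vertices every time the walk visits $v$ immediately in between traversing the corresponding two edges. A threading is a closed walk that traverses every edge at least once, has no U-turns (never traverses the same edge twice in immediate succession, cyclically), and induces a connected junction graph at every vertex.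
   Formalization: The formal statement assumes w and h are both at least 2: a 1×n grid with n ≥ 2 is a path whose leaves force U-turns, so it has no threading and the claim fails there; the edgeless 1×1 grid is also excluded. *)

theory Defs
  imports "HOL-Library.Multiset" "HOL-Library.Landau_Symbols"
begin

section \<open>Closed walks and threadings of simple graphs\<close>

text \<open>
  A finite simple graph is given by its vertex set \<open>V\<close> and its set \<open>E\<close> of two-element edges.
  A closed walk is the cyclic sequence \<open>vs\<close> of the vertices it visits; the first vertex is not
  repeated at the end.
\<close>

definition walk_edge :: "'v list \<Rightarrow> nat \<Rightarrow> 'v set" where
  "walk_edge vs k = {vs ! (k mod length vs), vs ! (Suc k mod length vs)}"

definition closed_walk :: "'v set \<Rightarrow> 'v set set \<Rightarrow> 'v list \<Rightarrow> bool" where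
  "closed_walk V E vs \<longleftrightarrow>
     vs \<noteq> [] \<and> set vs \<subseteq> V \<and> (\<forall>k < length vs. walk_edge vs k \<in> E)"

text \<open>
  Between \<^term>\<open>walk_edge vs k\<close> and \<^term>\<open>walk_edge vs (Suc k)\<close> the walk visits
  \<^term>\<open>vs ! (Suc k mod length vs)\<close>.
\<close>

definition walk_turn :: "'v list \<Rightarrow> nat \<Rightarrow> 'v set set" where
  "walk_turn vs k = {walk_edge vs k, walk_edge vs (Suc k)}"

definition no_U_turns :: "'v list \<Rightarrow> bool" where
  "no_U_turns vs \<longleftrightarrow> (\<forall>k < length vs. walk_edge vs k \<noteq> walk_edge vs (Suc k))"

definition junction_graph ::
    "'v set set \<Rightarrow> 'v list \<Rightarrow> 'v \<Rightarrow> 'v set set \<times> 'v set set multiset" where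
  "junction_graph E vs v =
     ({e \<in> E. v \<in> e},
      {# walk_turn vs k. k \<in># mset_set {k. k < length vs \<and> vs ! (Suc k mod length vs) = v} #})"

fun multigraph_connected :: "'n set \<times> 'n set multiset \<Rightarrow> bool" where
  "multigraph_connected (N, M) \<longleftrightarrow>
     (\<forall>a \<in> N. \<forall>b \<in> N. (a, b) \<in> {(x, y). {x, y} \<in># M}\<^sup>*)"

definition threading :: "'v set \<Rightarrow> 'v set set \<Rightarrow> 'v list \<Rightarrow> bool" where
  "threading V E vs \<longleftrightarrow>
     closed_walk V E vs \<and>
     (\<forall>e \<in> E. \<exists>k < length vs. walk_edge vs k = e) \<and>
     no_U_turns vs \<and>
     (\<forall>v \<in> V. multigraph_connected (junction_graph E vs v))"


section \<open>Rectangular grid graphs and turn costs\<close>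

text \<open>The vertex \<open>(i, j)\<close> lies in row \<open>i\<close> and column \<open>j\<close>.\<close>

type_synonym point = "nat \<times> nat"

definition grid_verts :: "nat \<Rightarrow> nat \<Rightarrow> point set" where
  "grid_verts w h = {..<w} \<times> {..<h}"

definition horizontal_edge :: "point set \<Rightarrow> bool" where
  "horizontal_edge e \<longleftrightarrow> (\<exists>i j. e = {(i, j), (i, Suc j)})"

definition vertical_edge :: "point set \<Rightarrow> bool" where
  "vertical_edge e \<longleftrightarrow> (\<exists>i j. e = {(i, j), (Suc i, j)})"

definition grid_edges :: "nat \<Rightarrow> nat \<Rightarrow> point set set" where
  "grid_edges w h = {e. e \<subseteq> grid_verts w h \<and> (horizontal_edge e \<or> vertical_edge e)}"

text \<open>
  Two distinct grid edges with a common end point are perpendicular if one is horizontal and the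
  other one vertical, and collinear otherwise.
\<close>

definition turn_cost :: "point set set \<Rightarrow> nat" where
  "turn_cost t =
     (if (\<exists>e \<in> t. horizontal_edge e) \<and> (\<exists>f \<in> t. vertical_edge f) then 1 else 0)"

definition num_turns :: "point list \<Rightarrow> nat" where
  "num_turns vs = (\<Sum>k < length vs. turn_cost (walk_turn vs k))"


section \<open>Random access machines with uniform cost\<close>

text \<open>
  The random access machine of Cook and Reckhow (Time bounded random access machines, 1973), over
  the natural numbers with truncated subtraction, at unit cost per instruction. There is no
  multiplication. Initially all registers are \<open>0\<close>; the machine halts when the program counter
  leaves the program; reading past the end of the input yields \<open>0\<close>.
\<close>

datatype instr =
    SET nat nat          \<comment> \<open>\<open>X\<^sub>i := c\<close>\<close>
  | ADD nat nat nat      \<comment> \<open>\<open>X\<^sub>i := X\<^sub>j + X\<^sub>k\<close>\<close>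
  | SUB nat nat nat      \<comment> \<open>\<open>X\<^sub>i := X\<^sub>j - X\<^sub>k\<close>\<close>
  | LOAD nat nat         \<comment> \<open>\<open>X\<^sub>i := X\<^sub>r\<close> where \<open>r = X\<^sub>j\<close>\<close>
  | STORE nat nat        \<comment> \<open>\<open>X\<^sub>r := X\<^sub>j\<close> where \<open>r = X\<^sub>i\<close>\<close>
  | JPOS nat nat         \<comment> \<open>go to instruction \<open>l\<close> if \<open>X\<^sub>j > 0\<close>\<close>
  | READ nat
  | PRINT nat

record config =
  pc :: nat
  regs :: "nat \<Rightarrow> nat"
  in_tape :: "nat list"
  out_tape :: "nat list"

fun exec :: "instr \<Rightarrow> config \<Rightarrow> config" where
  "exec (SET i c) s = s\<lparr>pc := Suc (pc s), regs := (regs s)(i := c)\<rparr>"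
| "exec (ADD i j k) s =
     s\<lparr>pc := Suc (pc s), regs := (regs s)(i := regs s j + regs s k)\<rparr>"
| "exec (SUB i j k) s =
     s\<lparr>pc := Suc (pc s), regs := (regs s)(i := regs s j - regs s k)\<rparr>"
| "exec (LOAD i j) s =
     s\<lparr>pc := Suc (pc s), regs := (regs s)(i := regs s (regs s j))\<rparr>"
| "exec (STORE i j) s =
     s\<lparr>pc := Suc (pc s), regs := (regs s)(regs s i := regs s j)\<rparr>"
| "exec (JPOS l j) s = s\<lparr>pc := (if regs s j > 0 then l else Suc (pc s))\<rparr>"
| "exec (READ i) s =
     s\<lparr>pc := Suc (pc s),
       regs := (regs s)(i := (case in_tape s of [] \<Rightarrow> 0 | x # _ \<Rightarrow> x)),
       in_tape := tl (in_tape s)\<rparr>"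
| "exec (PRINT i) s = s\<lparr>pc := Suc (pc s), out_tape := out_tape s @ [regs s i]\<rparr>"

definition halted :: "instr list \<Rightarrow> config \<Rightarrow> bool" where
  "halted P s \<longleftrightarrow> length P \<le> pc s"

definition ram_step :: "instr list \<Rightarrow> config \<Rightarrow> config" where
  "ram_step P s = (if halted P s then s else exec (P ! pc s) s)"

definition initial :: "nat list \<Rightarrow> config" where
  "initial xs = \<lparr>pc = 0, regs = (\<lambda>_. 0), in_tape = xs, out_tape = []\<rparr>"

definition computes_within :: "instr list \<Rightarrow> nat list \<Rightarrow> nat list \<Rightarrow> nat \<Rightarrow> bool" where
  "computes_within P xs ys t \<longleftrightarrow>
     (let s = (ram_step P ^^ t) (initial xs) in halted P s \<and> out_tape s = ys)"

definition encode_walk :: "point list \<Rightarrow> nat list" where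
  "encode_walk vs = concat (map (\<lambda>(i, j). [i, j]) vs)"

end

theory Submission
  imports Defs "HOL-Library.Sublist"
begin

text \<open>
  Lower bound: every vertex needs a turn, because its junction graph has to connect a horizontal
  to a vertical edge, and the turns on a line of the grid are the ends of the maximal straight
  pieces that the walk runs on that line, so there is an even number of them. Rounding the number
  of vertices of each line up to an even number gives the bound.

  Construction for \<open>w\<close> and \<open>h\<close> even: turn exactly once at every vertex. Every column but the first
  is cut into straight pieces between the rows \<open>0-(w-1), 1-2, 3-4, \<dots>\<close>. Of two rows matched in this
  way one is cut into pieces between the columns \<open>0-(h-1), 1-2, 3-4, \<dots>\<close> and the other one between
  \<open>0-2, 1-4, 3-6, \<dots>\<close>; the union of these two matchings is a Hamiltonian cycle on the columns, so one
  strand visits all vertices of the two rows. The first column uses the pattern \<open>0-2, 1-4, 3-6, \<dots>\<close>,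
  which links the strands to a single closed walk. The junction graphs are connected because every
  inner vertex of a line lies strictly inside some straight piece on it.
  If \<open>h\<close> is odd, two adjacent columns of the solution for \<open>h + 1\<close> are identified. If both
  dimensions are odd, three of the rows form a strand with exactly four turns in each column, which
  saves four turns compared to identifying two rows as well.

  The random access machine generates the turning points in order, with a constant overhead for
  each of the \<open>O(m)\<close> vertices printed.
\<close>

section \<open>The lower bound\<close>

text \<open>The walk is cyclic, while its turns, straight passes and junctions show in short
  contiguous windows. So the primary object is a cyclic list of corners in which horizontal and
  vertical moves alternate; the walk is derived from it, and all windows are found in two or three
  unrolled copies. Such a walk has one turn per listed corner. It is a threading if every vertex is
  listed, which joins some horizontal to some vertical edge there, and if any two opposite edges at
  a vertex are joined. A straight pass does the latter; where there is none, as in the top row and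
  the first column when both dimensions are odd, two turns sharing the perpendicular edge do it. If
  both dimensions are odd, the three special rows contribute \<open>4 * h\<close> turns and the
  other strands \<open>(w - 3) * (h + 1)\<close>, together \<open>(w + 1) * (h + 1) - 4\<close>. The
  parity bound is then \<open>max (w * (h + 1)) (h * (w + 1))\<close>, which is smaller by
  \<open>min w h - 3\<close>, so this case comes without optimality.\<close>

lemma horizontal_edge_iff:
  "horizontal_edge {a, b} \<longleftrightarrow> fst a = fst b \<and> (snd b = Suc (snd a) \<or> snd a = Suc (snd b))"
  unfolding horizontal_edge_def by (cases a; cases b) (auto simp: doubleton_eq_iff)

lemma vertical_edge_iff:
  "vertical_edge {a, b} \<longleftrightarrow> snd a = snd b \<and> (fst b = Suc (fst a) \<or> fst a = Suc (fst b))"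
  unfolding vertical_edge_def by (cases a; cases b) (auto simp: doubleton_eq_iff)

lemma horizontal_not_vertical: "horizontal_edge e \<Longrightarrow> \<not> vertical_edge e"
  by (auto simp: horizontal_edge_def vertical_edge_iff)

lemma walk_edge_mod: "walk_edge vs (k mod length vs) = walk_edge vs k"
  by (simp add: walk_edge_def mod_Suc_eq)

lemma walk_edge_in:
  assumes "closed_walk V E vs"
  shows "walk_edge vs k \<in> E"
proof -
  have "walk_edge vs (k mod length vs) \<in> E"
    using assms by (simp add: closed_walk_def)
  then show ?thesis
    by (simp add: walk_edge_mod)
qed

lemma junction_edge_iff:
  "t \<in># snd (junction_graph E vs v) \<longleftrightarrow>
     (\<exists>k < length vs. vs ! (Suc k mod length vs) = v \<and> walk_turn vs k = t)"
  by (auto simp: junction_graph_def)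

lemma turn_cost_doubleton:
  assumes "e \<in> grid_edges w h" "f \<in> grid_edges w h"
  shows "turn_cost {e, f} = (if vertical_edge e \<noteq> vertical_edge f then 1 else 0)"
  using assms horizontal_not_vertical by (auto simp: turn_cost_def grid_edges_def)

lemma horizontal_edge_at:
  assumes "v \<in> grid_verts w h" "h \<ge> 2"
  obtains e where "e \<in> grid_edges w h" "v \<in> e" "horizontal_edge e"
proof -
  obtain i j where v: "v = (i, j)" "i < w" "j < h"
    using assms(1) by (auto simp: grid_verts_def)
  show thesis
  proof (cases "Suc j < h")
    case True
    then show ?thesis
      using v by (intro that[of "{(i, j), (i, Suc j)}"])
        (auto simp: grid_edges_def grid_verts_def horizontal_edge_iff)
  next
    case False
    then show ?thesis
      using v assms(2) by (intro that[of "{(i, j), (i, j - 1)}"])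
        (auto simp: grid_edges_def grid_verts_def horizontal_edge_iff)
  qed
qed

lemma vertical_edge_at:
  assumes "v \<in> grid_verts w h" "w \<ge> 2"
  obtains e where "e \<in> grid_edges w h" "v \<in> e" "vertical_edge e"
proof -
  obtain i j where v: "v = (i, j)" "i < w" "j < h"
    using assms(1) by (auto simp: grid_verts_def)
  show thesis
  proof (cases "Suc i < w")
    case True
    then show ?thesis
      using v by (intro that[of "{(i, j), (Suc i, j)}"])
        (auto simp: grid_edges_def grid_verts_def vertical_edge_iff)
  next
    case False
    then show ?thesis
      using v assms(2) by (intro that[of "{(i, j), (i - 1, j)}"])
        (auto simp: grid_edges_def grid_verts_def vertical_edge_iff)
  qed
qed

lemma rtrancl_crossing:
  assumes "(a, b) \<in> r\<^sup>*" "P a" "\<not> P b"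
  shows "\<exists>x y. (x, y) \<in> r \<and> P x \<and> \<not> P y"
  using assms by (induction rule: rtrancl_induct) blast+

text \<open>Some path in the junction graph leads from a vertical to a horizontal edge at
  \<open>v\<close>. Where the direction changes on this path, the walk visits \<open>v\<close>
  between two perpendicular edges. Both directions occur at \<open>v\<close> because each side of
  the grid has at least two vertices.\<close>

lemma threading_turns_everywhere:
  assumes thr: "threading (grid_verts w h) (grid_edges w h) vs"
    and v: "v \<in> grid_verts w h" and "w \<ge> 2" "h \<ge> 2"
  shows "\<exists>k < length vs. vs ! (Suc k mod length vs) = v \<and> turn_cost (walk_turn vs k) = 1"
proof -
  obtain a where a: "a \<in> grid_edges w h" "v \<in> a" "vertical_edge a"
    using vertical_edge_at[OF v \<open>w \<ge> 2\<close>] .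
  obtain b where b: "b \<in> grid_edges w h" "v \<in> b" "horizontal_edge b"
    using horizontal_edge_at[OF v \<open>h \<ge> 2\<close>] .
  let ?r = "{(x, y). {x, y} \<in># snd (junction_graph (grid_edges w h) vs v)}"
  have "multigraph_connected (junction_graph (grid_edges w h) vs v)"
    using thr v by (simp add: threading_def)
  then have "(a, b) \<in> ?r\<^sup>*"
    using a b by (simp add: junction_graph_def)
  from rtrancl_crossing[OF this, of vertical_edge] a(3) b(3) horizontal_not_vertical
  obtain x y where xy: "(x, y) \<in> ?r" "vertical_edge x" "\<not> vertical_edge y"
    by blast
  then obtain k where k: "k < length vs" "vs ! (Suc k mod length vs) = v"
    "walk_turn vs k = {x, y}"
    by (auto simp: junction_edge_iff)
  have E: "walk_edge vs l \<in> grid_edges w h" for l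
    using thr walk_edge_in by (auto simp: threading_def)
  \<comment> \<open>The junction relation is not restricted to grid edges; \<open>x\<close> and
    \<open>y\<close> become grid edges by being identified with two consecutive edges of the
    walk.\<close>
  have "x \<in> grid_edges w h" "y \<in> grid_edges w h"
    using k(3) E by (auto simp: walk_turn_def doubleton_eq_iff)
  then show ?thesis
    using k xy turn_cost_doubleton by (intro exI[of _ k]) simp
qed

text \<open>Each change flips the truth value, so the parity of the number of changes before
  \<open>m\<close> records whether \<open>b m\<close> differs from \<open>b 0\<close>.\<close>

lemma cyclic_changes_even:
  fixes b :: "nat \<Rightarrow> bool"
  assumes "b n = b 0"
  shows "even (\<Sum>k<n. if b k \<noteq> b (Suc k) then 1 else 0 :: nat)"
proof -
  have "even (\<Sum>k<m. if b k \<noteq> b (Suc k) then 1 else 0 :: nat) \<longleftrightarrow> (b m = b 0)" for m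
    by (induction m) auto
  then show ?thesis
    using assms by simp
qed

text \<open>The turns on a line are the ends of the maximal segments the walk runs on that line, so
  their number is even.\<close>

lemma turns_on_line_even:
  fixes D :: "point set \<Rightarrow> bool" and co :: "point \<Rightarrow> nat"
  assumes cw: "closed_walk V E vs"
    and co: "\<And>a b. {a, b} \<in> E \<Longrightarrow> D {a, b} \<Longrightarrow> co a = co b"
    and cost: "\<And>e f. e \<in> E \<Longrightarrow> f \<in> E \<Longrightarrow> turn_cost {e, f} = (if D e \<noteq> D f then 1 else 0)"
  shows "even (\<Sum>k | k < length vs \<and> co (vs ! (Suc k mod length vs)) = l.
                 turn_cost (walk_turn vs k))"
proof -
  let ?n = "length vs"
  define b where "b k \<longleftrightarrow> D (walk_edge vs k) \<and> co (vs ! (k mod ?n)) = l" for k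
  have co_edge: "co (vs ! (k mod ?n)) = co (vs ! (Suc k mod ?n))" if "D (walk_edge vs k)" for k
    using that walk_edge_in[OF cw, of k] unfolding walk_edge_def by (rule co[rotated])
  have "(\<Sum>k | k < ?n \<and> co (vs ! (Suc k mod ?n)) = l. turn_cost (walk_turn vs k)) =
        (\<Sum>k<?n. if co (vs ! (Suc k mod ?n)) = l then turn_cost (walk_turn vs k) else 0)"
    by (simp add: sum.inter_filter [symmetric] lessThan_def conj_commute)
  \<comment> \<open>At a vertex off the line both indicators are false, since an edge in direction
    \<open>D\<close> has both ends on the same line. At a vertex on the line \<open>b\<close> agrees
    with \<open>D\<close>, so it changes exactly at the turns.\<close>
  also have "\<dots> = (\<Sum>k<?n. if b k \<noteq> b (Suc k) then 1 else 0)"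
  proof (rule sum.cong[OF refl])
    fix k
    show "(if co (vs ! (Suc k mod ?n)) = l then turn_cost (walk_turn vs k) else 0) =
          (if b k \<noteq> b (Suc k) then 1 else 0)"
      using co_edge[of k] co_edge[of "Suc k"]
      by (auto simp: b_def walk_turn_def cost[OF walk_edge_in[OF cw] walk_edge_in[OF cw]])
  qed
  finally show ?thesis
    using cyclic_changes_even[of b ?n] by (simp add: b_def walk_edge_def mod_Suc)
qed

text \<open>Direction \<open>D\<close> and line number \<open>co\<close> are abstract so that rows
  and columns are treated at once. Every turn is charged to the line of its vertex; the
  \<open>N\<close> vertices of a line account for at least \<open>N\<close> turns, and evenness
  rounds this up.\<close>

lemma num_turns_lower_bound:
  fixes D :: "point set \<Rightarrow> bool" and co :: "point \<Rightarrow> nat"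
  assumes thr: "threading (grid_verts w h) (grid_edges w h) vs" and "w \<ge> 2" "h \<ge> 2"
    and co: "\<And>a b. {a, b} \<in> grid_edges w h \<Longrightarrow> D {a, b} \<Longrightarrow> co a = co b"
    and cost: "\<And>e f. e \<in> grid_edges w h \<Longrightarrow> f \<in> grid_edges w h \<Longrightarrow>
      turn_cost {e, f} = (if D e \<noteq> D f then 1 else 0)"
    and line: "\<And>l. l < M \<Longrightarrow> N \<le> card {v \<in> grid_verts w h. co v = l}"
  shows "M * (2 * ((N + 1) div 2)) \<le> num_turns vs"
proof -
  let ?n = "length vs"
  define A where "A l = {k. k < ?n \<and> co (vs ! (Suc k mod ?n)) = l}" for l
  have cw: "closed_walk (grid_verts w h) (grid_edges w h) vs"
    using thr by (simp add: threading_def)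
  have fin[simp]: "finite (A l)" for l
    by (simp add: A_def)
  have ge: "2 * ((N + 1) div 2) \<le> (\<Sum>k\<in>A l. turn_cost (walk_turn vs k))" if "l < M" for l
  proof -
    let ?L = "{v \<in> grid_verts w h. co v = l}"
    let ?K = "{k \<in> A l. turn_cost (walk_turn vs k) = 1}"
    have "?L \<subseteq> (\<lambda>k. vs ! (Suc k mod ?n)) ` ?K"
    proof
      fix v assume v: "v \<in> ?L"
      then obtain k where "k < ?n" "vs ! (Suc k mod ?n) = v" "turn_cost (walk_turn vs k) = 1"
        using threading_turns_everywhere[OF thr _ \<open>w \<ge> 2\<close> \<open>h \<ge> 2\<close>] by blast
      with v show "v \<in> (\<lambda>k. vs ! (Suc k mod ?n)) ` ?K"
        by (intro image_eqI[of _ _ k]) (auto simp: A_def)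
    qed
    \<comment> \<open>Several visits may turn at the same vertex, so the turning times only map onto
      the line.\<close>
    then have "card ?L \<le> card ?K"
      by (rule surj_card_le[rotated]) simp
    also have "\<dots> = (\<Sum>k\<in>?K. turn_cost (walk_turn vs k))"
      by simp
    also have "\<dots> \<le> (\<Sum>k\<in>A l. turn_cost (walk_turn vs k))"
      by (rule sum_mono2) auto
    finally have "N \<le> (\<Sum>k\<in>A l. turn_cost (walk_turn vs k))"
      using line[OF that] by linarith
    moreover have "even (\<Sum>k\<in>A l. turn_cost (walk_turn vs k))"
      using turns_on_line_even[OF cw co cost] by (simp add: A_def)
    ultimately show ?thesis
      by presburger
  qed
  have "M * (2 * ((N + 1) div 2)) = (\<Sum>l<M. 2 * ((N + 1) div 2))"
    by simp
  also have "\<dots> \<le> (\<Sum>l<M. \<Sum>k\<in>A l. turn_cost (walk_turn vs k))"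
    using ge by (intro sum_mono) simp
  also have "\<dots> = (\<Sum>k\<in>(\<Union>l<M. A l). turn_cost (walk_turn vs k))"
    by (subst sum.UNION_disjoint) (auto simp: A_def)
  also have "\<dots> \<le> num_turns vs"
    unfolding num_turns_def by (rule sum_mono2) (auto simp: A_def)
  finally show ?thesis .
qed

text \<open>The first bound counts by columns and meets the construction when \<open>h\<close> is
  even; the second counts by rows and meets it when \<open>w\<close> is even.\<close>

lemma num_turns_ge:
  assumes thr: "threading (grid_verts w h) (grid_edges w h) vs" and "w \<ge> 2" "h \<ge> 2"
  shows "h * (2 * ((w + 1) div 2)) \<le> num_turns vs" "w * (2 * ((h + 1) div 2)) \<le> num_turns vs"
proof -
  show "h * (2 * ((w + 1) div 2)) \<le> num_turns vs"
  proof (rule num_turns_lower_bound[OF assms, where D = vertical_edge and co = snd])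
    fix l assume "l < h"
    then have "{v \<in> grid_verts w h. snd v = l} = (\<lambda>i. (i, l)) ` {..<w}"
      by (auto simp: grid_verts_def)
    then show "w \<le> card {v \<in> grid_verts w h. snd v = l}"
      by (simp add: card_image inj_on_def)
  qed (auto simp: vertical_edge_iff turn_cost_doubleton)
  show "w * (2 * ((h + 1) div 2)) \<le> num_turns vs"
  proof (rule num_turns_lower_bound[OF assms, where D = horizontal_edge and co = fst])
    fix l assume "l < w"
    then have "{v \<in> grid_verts w h. fst v = l} = (\<lambda>i. (l, i)) ` {..<h}"
      by (auto simp: grid_verts_def)
    then show "h \<le> card {v \<in> grid_verts w h. fst v = l}"
      by (simp add: card_image inj_on_def)
  next
    fix e f assume "e \<in> grid_edges w h" "f \<in> grid_edges w h"
    moreover from this have "vertical_edge e \<longleftrightarrow> \<not> horizontal_edge e"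
      "vertical_edge f \<longleftrightarrow> \<not> horizontal_edge f"
      using horizontal_not_vertical by (auto simp: grid_edges_def)
    ultimately show "turn_cost {e, f} = (if horizontal_edge e \<noteq> horizontal_edge f then 1 else 0)"
      by (simp add: turn_cost_doubleton)
  qed (auto simp: horizontal_edge_iff)
qed

section \<open>Walks given by their turning points\<close>

text \<open>Columns are adjusted before rows, so this commutes with transposition only when the two
  points are aligned. Walks use it for aligned points only.\<close>

fun toward :: "point \<Rightarrow> point \<Rightarrow> point" where
  "toward (i, j) (i', j') =
     (if j < j' then (i, Suc j) else if j' < j then (i, j - 1)
      else if i < i' then (Suc i, j) else (i - 1, j))"

text \<open>The target is left out, so that consecutive segments concatenate without repeating the
  corner between them.\<close>

function seg :: "point \<Rightarrow> point \<Rightarrow> point list" where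
  "seg p q = (if p = q then [] else p # seg (toward p q) q)"
  by auto
termination
  by (relation "measure (\<lambda>((i, j), (i', j')). (i - i') + (i' - i) + (j - j') + (j' - j))")
    (auto split: if_splits)

declare seg.simps [simp del]

lemma seg_same [simp]: "seg q q = []"
  by (subst seg.simps) simp

lemma seg_unfold: "p \<noteq> q \<Longrightarrow> seg p q = p # seg (toward p q) q"
  by (subst seg.simps) simp

fun trail :: "point \<Rightarrow> point list \<Rightarrow> point list" where
  "trail p [] = []"
| "trail p (q # qs) = seg p q @ trail q qs"

definition tour :: "point \<Rightarrow> point list \<Rightarrow> point list" where
  "tour p qs = trail p qs @ [last (p # qs)]"

fun move :: "bool \<Rightarrow> point \<Rightarrow> point \<Rightarrow> bool" where
  "move True p q \<longleftrightarrow> fst p = fst q \<and> snd p \<noteq> snd q"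
| "move False p q \<longleftrightarrow> snd p = snd q \<and> fst p \<noteq> fst q"

fun alternating :: "bool \<Rightarrow> point \<Rightarrow> point list \<Rightarrow> bool" where
  "alternating b p [] \<longleftrightarrow> True"
| "alternating b p (q # qs) \<longleftrightarrow> move b p q \<and> alternating (\<not> b) q qs"

definition grid_adj :: "point \<Rightarrow> point \<Rightarrow> bool" where
  "grid_adj a b \<longleftrightarrow> horizontal_edge {a, b} \<or> vertical_edge {a, b}"

definition perp :: "point \<Rightarrow> point \<Rightarrow> point \<Rightarrow> bool" where
  "perp a b c \<longleftrightarrow> vertical_edge {a, b} \<noteq> vertical_edge {b, c}"

fun proper_path :: "point list \<Rightarrow> bool" where
  "proper_path (a # b # c # xs) \<longleftrightarrow> grid_adj a b \<and> a \<noteq> c \<and> proper_path (b # c # xs)"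
| "proper_path [a, b] \<longleftrightarrow> grid_adj a b"
| "proper_path _ \<longleftrightarrow> True"

fun path_turns :: "point list \<Rightarrow> nat" where
  "path_turns (a # b # c # xs) = (if perp a b c then 1 else 0) + path_turns (b # c # xs)"
| "path_turns _ = 0"

lemma move_neq: "move b p q \<Longrightarrow> p \<noteq> q"
  by (cases b) auto

lemma move_swap: "move (\<not> b) (prod.swap p) (prod.swap q) \<longleftrightarrow> move b p q"
  by (cases b) auto

lemma move_sym: "move b p q \<longleftrightarrow> move b q p"
  by (cases b) auto

lemma toward_cases:
  assumes "move b p q"
  shows "toward p q = q \<or> move b (toward p q) q"
    and "move b p (toward p q)"
    and "grid_adj p (toward p q)"
    and "vertical_edge {p, toward p q} \<longleftrightarrow> \<not> b"
    and "toward (toward p q) p = p"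
  using assms
  by (cases p; cases q; cases b; auto simp: grid_adj_def horizontal_edge_iff vertical_edge_iff)+

text \<open>Along an aligned segment \<open>move\<close> persists up to the target. The last step is
  a case of its own because only there a turn can follow.\<close>

lemma seg_induct [consumes 1, case_names last step]:
  assumes "move b p q"
    and "\<And>p. move b p q \<Longrightarrow> toward p q = q \<Longrightarrow> seg p q = [p] \<Longrightarrow> P p"
    and "\<And>p. move b p q \<Longrightarrow> move b (toward p q) q \<Longrightarrow> seg p q = p # seg (toward p q) q \<Longrightarrow>
      P (toward p q) \<Longrightarrow> P p"
  shows "P p"
  using assms
proof (induction p q rule: seg.induct)
  case (1 p q)
  have q: "seg q q = []"
    by (simp add: seg.simps[of q q])
  have unfold: "seg p q = p # seg (toward p q) q"
    using move_neq[OF 1(2)] by (subst seg.simps) simp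
  show ?case
  proof (cases "toward p q = q")
    case True
    with unfold q show ?thesis
      by (intro 1(3)[OF 1(2)]) simp_all
  next
    case False
    then have mv: "move b (toward p q) q"
      using toward_cases(1)[OF 1(2)] by simp
    show ?thesis
      by (rule 1(4)[OF 1(2) mv unfold], rule 1(1)[OF move_neq[OF 1(2)] mv]) (rule 1(3,4); assumption)+
  qed
qed

lemma trail_append: "trail p (xs @ ys) = trail p xs @ trail (last (p # xs)) ys"
  by (induction xs arbitrary: p) auto

lemma tour_append: "tour p (xs @ ys) = trail p xs @ tour (last (p # xs)) ys"
  by (simp add: tour_def trail_append)

lemma tour_Cons: "tour p (q # qs) = seg p q @ tour q qs"
  by (simp add: tour_def)

lemma tour_hd: "\<exists>ys. tour p qs = p # ys"
proof (induction qs arbitrary: p)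
  case (Cons q qs)
  then show ?case
    by (simp add: tour_Cons seg.simps[of p q]) 
qed (simp add: tour_def)

lemma tour_step: "move b p q \<Longrightarrow> tour p (q # qs) = p # tour (toward p q) (q # qs)"
  using move_neq by (simp add: tour_Cons seg.simps[of p q])

lemma alternating_append:
  "alternating b p (xs @ ys) \<longleftrightarrow>
     alternating b p xs \<and> alternating (if even (length xs) then b else \<not> b) (last (p # xs)) ys"
  by (induction xs arbitrary: b p) auto

text \<open>Inside a segment the direction is kept, and at an inner corner alternation makes the
  adjacent edges perpendicular; neither allows a U-turn. The final corner has no continuation and
  hence no turn, whence the \<open>- 1\<close>.\<close>

lemma tour_proper:
  assumes "alternating b p qs"
  shows "proper_path (tour p qs) \<and> path_turns (tour p qs) = length qs - 1"
  using assms
proof (induction qs arbitrary: b p)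
  case Nil
  then show ?case by (simp add: tour_def)
next
  case (Cons q qs)
  have mv: "move b p q" and alt: "alternating (\<not> b) q qs"
    using Cons.prems by auto
  note IH = Cons.IH[OF alt]
  show ?case
    using mv
  proof (induction p rule: seg_induct)
    case (last p)
    show ?case
    proof (cases qs)
      case Nil
      with last toward_cases(3)[of b p q] show ?thesis
        by (simp add: tour_def)
    next
      case (Cons r rs)
      then have r: "move (\<not> b) q r"
        using alt by simp
      from tour_hd[of "toward q r" qs] obtain ys where ys: "tour (toward q r) qs = toward q r # ys"
        by blast
      have q: "tour q qs = q # toward q r # ys"
        using tour_step[OF r, of rs] ys Cons by simp
      have p: "tour p (q # qs) = p # q # toward q r # ys"
        using last q by (simp add: tour_Cons)
      have "perp p q (toward q r)" "grid_adj p q" "p \<noteq> toward q r"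
        using toward_cases(3,4)[OF last(1)] toward_cases(4)[OF r] last(2)
        by (auto simp: perp_def insert_commute)
      then show ?thesis
        using IH unfolding p q using Cons by simp
    qed
  next
    case (step p)
    let ?p = "toward p q"
    from tour_hd[of "toward ?p q" "q # qs"] obtain ys
      where ys: "tour (toward ?p q) (q # qs) = toward ?p q # ys"
      by blast
    have p': "tour ?p (q # qs) = ?p # toward ?p q # ys"
      using tour_step[OF step(2), of qs] ys by simp
    have p: "tour p (q # qs) = p # ?p # toward ?p q # ys"
      using tour_step[OF step(1), of qs] p' by simp
    have "\<not> perp p ?p (toward ?p q)" "grid_adj p ?p"
      using toward_cases(3,4)[OF step(1)] toward_cases(4)[OF step(2)]
      by (auto simp: perp_def)
    moreover have "p \<noteq> toward ?p q"
      using step(1,2) by (cases p; cases q; cases b; auto split: if_splits)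
    ultimately show ?case
      using step(4) unfolding p p' by simp
  qed
qed

lemma toward_in_grid:
  assumes "p \<in> grid_verts w h" "q \<in> grid_verts w h" "p \<noteq> q"
  shows "toward p q \<in> grid_verts w h"
  using assms by (cases p; cases q) (auto simp: grid_verts_def)

lemma set_tour_subset:
  assumes "p \<in> grid_verts w h" "set qs \<subseteq> grid_verts w h"
  shows "set (tour p qs) \<subseteq> grid_verts w h"
proof -
  have seg: "set (seg p q) \<subseteq> grid_verts w h" if "p \<in> grid_verts w h" "q \<in> grid_verts w h" for p q
    using that
  proof (induction p q rule: seg.induct)
    case (1 p q)
    then show ?case
      using toward_in_grid by (simp add: seg.simps[of p q])
  qed
  show ?thesis
    using assms seg by (induction qs arbitrary: p) (auto simp: tour_Cons, auto simp: tour_def)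
qed

text \<open>Transfers a window of the corner list to a window of the walk. The first corner of the
  window serves as the starting point of the partial tour.\<close>

lemma tour_infix:
  assumes "sublist (p # qs) (p0 # rs)"
  shows "sublist (tour p qs) (tour p0 rs)"
proof -
  have suf: "sublist (tour p qs) (tour p (qs @ ys))" for ys
  proof -
    from tour_hd[of "last (p # qs)" ys] obtain zs where "tour (last (p # qs)) ys = last (p # qs) # zs"
      by blast
    then have "tour p (qs @ ys) = tour p qs @ zs"
      by (simp only: tour_append) (simp add: tour_def)
    then show ?thesis
      by simp
  qed
  from assms obtain xs ys where e: "p0 # rs = xs @ p # qs @ ys"
    by (auto simp: sublist_def)
  show ?thesis
  proof (cases xs)
    case Nil
    then show ?thesis
      using e suf by simp
  next
    case (Cons x xs')
    then have "tour p0 rs = trail p0 (xs' @ [p]) @ tour p (qs @ ys)"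
      using e tour_append[of p0 "xs' @ [p]" "qs @ ys"] by simp
    then show ?thesis
      using suf sublist_append_leftI sublist_order.order.trans by metis
  qed
qed

section \<open>Straight passes and turns inside a tour\<close>

fun between :: "point \<Rightarrow> point \<Rightarrow> point \<Rightarrow> bool" where
  "between (i, j) (i', j') (i'', j'') \<longleftrightarrow>
     i = i' \<and> i' = i'' \<and> (j < j' \<and> j' < j'' \<or> j'' < j' \<and> j' < j) \<or>
     j = j' \<and> j' = j'' \<and> (i < i' \<and> i' < i'' \<or> i'' < i' \<and> i' < i)"

lemma between_move: "between p v q \<Longrightarrow> \<exists>b. move b p q \<and> move b p v \<and> move b v q"
  by (cases p; cases v; cases q) (auto intro: exI[of _ True] exI[of _ False])

lemma tour_pass:
  assumes "between p v q"
  shows "sublist [toward v p, v, toward v q] (tour p [q])"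
proof -
  obtain b where b: "move b p q"
    using between_move[OF assms] by blast
  show ?thesis
    using b assms
  proof (induction p rule: seg_induct)
    case (last p)
    then show ?case
      by (cases p; cases v; cases q; cases b) (auto split: if_splits)
  next
    case (step p)
    let ?p = "toward p q"
    have tp: "tour p [q] = p # tour ?p [q]"
      using tour_step[OF step(1), of "[]"] .
    show ?case
    proof (cases "v = ?p")
      case True
      have "tour ?p [q] = ?p # tour (toward ?p q) [q]"
        using tour_step[OF step(2), of "[]"] .
      with tour_hd[of "toward ?p q" "[q]"] tp True toward_cases(5)[OF step(1)] show ?thesis
        by auto
    next
      case False
      then have "between ?p v q" "toward v ?p = toward v p"
        using step(1,2,5) by (cases p; cases v; cases q; cases b; auto split: if_splits)+
      then show ?thesis
        using step(4) by (simp add: tp sublist_Cons_right)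
    qed
  qed
qed

lemma seg_last: "move b p v \<Longrightarrow> \<exists>us. seg p v = us @ [toward v p]"
proof (induction p rule: seg_induct)
  case (last p)
  then show ?case
    using toward_cases(5)[of b p v] by simp
next
  case (step p)
  moreover have "toward v (toward p v) = toward v p"
    using step(1,2) by (cases p; cases v; cases b) (auto split: if_splits)
  ultimately show ?case
    by auto
qed

lemma tour_turn:
  assumes "move b p v" "move c v q"
  shows "sublist [toward v p, v, toward v q] (tour p [v, q])"
proof -
  obtain us where "seg p v = us @ [toward v p]"
    using seg_last[OF assms(1)] by blast
  moreover obtain ys where "tour (toward v q) [q] = toward v q # ys"
    using tour_hd by blast
  ultimately have "tour p [v, q] = us @ [toward v p, v, toward v q] @ ys"
    using tour_step[OF assms(2), of "[]"] by (simp add: tour_Cons[of p v])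
  then show ?thesis
    by (metis sublist_appendI)
qed

text \<open>Read cyclically, the list \<open>ds\<close> of corners describes a closed walk that starts at the last
  corner. Unrolling it twice exhibits every cyclic window of corners as an infix.\<close>

definition cyc :: "point list \<Rightarrow> point list" where
  "cyc ds = last ds # ds @ ds"

text \<open>A pair \<open>(a, b)\<close> stands for the window \<open>a, v, b\<close> of the walk,
  arising from a straight pass or from a turn. Neighbours of \<open>v\<close> represent the edges to
  them, so this expresses junction edges in terms of corners alone.\<close>

definition corner_link :: "point list \<Rightarrow> point \<Rightarrow> (point \<times> point) set" where
  "corner_link ds v =
     {(toward v p, toward v q) | p q.
        between p v q \<and> sublist [p, q] (cyc ds) \<or> sublist [p, v, q] (cyc ds)}"

definition linked :: "point list \<Rightarrow> point \<Rightarrow> point \<Rightarrow> point \<Rightarrow> bool" where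
  "linked ds v a b \<longleftrightarrow> (a, b) \<in> (corner_link ds v \<union> (corner_link ds v)\<inverse>)\<^sup>*"

text \<open>Even length makes the alternation close up cyclically. Corners may be listed repeatedly.
  The two linking conditions concern vertices that have both neighbours in the respective
  direction.\<close>

definition good_corners :: "nat \<Rightarrow> nat \<Rightarrow> point list \<Rightarrow> bool" where
  "good_corners w h ds \<longleftrightarrow>
     even (length ds) \<and> (\<exists>b. alternating b (last ds) ds) \<and> set ds = grid_verts w h \<and>
     (\<forall>i j. i < w \<longrightarrow> 0 < j \<longrightarrow> Suc j < h \<longrightarrow> linked ds (i, j) (i, j - 1) (i, Suc j)) \<and>
     (\<forall>i j. j < h \<longrightarrow> 0 < i \<longrightarrow> Suc i < w \<longrightarrow> linked ds (i, j) (i - 1, j) (Suc i, j))"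

definition corner_walk :: "point list \<Rightarrow> point list" where
  "corner_walk ds = trail (last ds) ds"

lemma sum_cyclic_window:
  fixes f :: "nat \<Rightarrow> nat"
  assumes "\<And>k. f (k + n) = f k"
  shows "(\<Sum>k<N + n. f k) = (\<Sum>k<N. f k) + (\<Sum>k<n. f k)"
  by (induction N) (simp_all add: assms)

lemma path_turns_sum:
  "path_turns L = (\<Sum>k<length L - 2. if perp (L ! k) (L ! Suc k) (L ! Suc (Suc k)) then 1 else 0)"
proof (induction L rule: path_turns.induct)
  case (1 a b c xs)
  then show ?case
    by (simp add: sum.lessThan_Suc_shift del: sum.lessThan_Suc)
qed auto

lemma proper_path_nth:
  assumes "proper_path L"
  shows "Suc k < length L \<Longrightarrow> grid_adj (L ! k) (L ! Suc k)"
    and "Suc (Suc k) < length L \<Longrightarrow> L ! k \<noteq> L ! Suc (Suc k)"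
proof -
  have "(Suc k < length L \<longrightarrow> grid_adj (L ! k) (L ! Suc k)) \<and>
    (Suc (Suc k) < length L \<longrightarrow> L ! k \<noteq> L ! Suc (Suc k))"
    using assms
    by (induction L arbitrary: k rule: proper_path.induct) (auto simp: nth_Cons split: nat.split)
  then show "Suc k < length L \<Longrightarrow> grid_adj (L ! k) (L ! Suc k)"
    and "Suc (Suc k) < length L \<Longrightarrow> L ! k \<noteq> L ! Suc (Suc k)"
    by auto
qed

lemma alternating_window:
  assumes "alternating c r rs" "r # rs = xs @ [p, v, q] @ ys"
  shows "\<exists>c. move c p v \<and> move (\<not> c) v q"
  using assms
proof (induction xs arbitrary: c r rs)
  case (Cons x xs)
  then show ?case
    by (cases rs) auto
qed auto

lemma corner_link_infix:
  assumes "(a, b) \<in> corner_link ds v" "alternating c (last ds) (ds @ ds)"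
  shows "sublist [a, v, b] (tour (last ds) (ds @ ds))"
proof -
  obtain p q where pq: "a = toward v p" "b = toward v q"
    "between p v q \<and> sublist [p, q] (cyc ds) \<or> sublist [p, v, q] (cyc ds)"
    using assms(1) by (auto simp: corner_link_def)
  from pq(3) show ?thesis
  proof
    assume "between p v q \<and> sublist [p, q] (cyc ds)"
    then show ?thesis
      using tour_pass[of p v q] tour_infix[of p "[q]" "last ds" "ds @ ds"] pq(1,2)
      unfolding cyc_def by (meson sublist_order.order.trans)
  next
    assume sub: "sublist [p, v, q] (cyc ds)"
    then obtain xs ys where "last ds # ds @ ds = xs @ [p, v, q] @ ys"
      by (auto simp: sublist_def cyc_def)
    then obtain c where "move c p v" "move (\<not> c) v q"
      using alternating_window[OF assms(2)] by blast
    from tour_turn[OF this] sub show ?thesis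
      using tour_infix[of p "[v, q]" "last ds" "ds @ ds"] pq(1,2)
      unfolding cyc_def by (meson sublist_order.order.trans)
  qed
qed

section \<open>From good corner lists to threadings\<close>

locale corners =
  fixes w h :: nat and ds :: "point list"
  assumes good: "good_corners w h ds" and w2: "w \<ge> 2" and h2: "h \<ge> 2"
begin

abbreviation "vs \<equiv> corner_walk ds"

abbreviation "n \<equiv> length vs"

lemma set_ds: "set ds = grid_verts w h"
  using good by (simp add: good_corners_def)

lemma ds_nonempty: "ds \<noteq> []"
proof -
  have "(0, 0) \<in> set ds"
    unfolding set_ds using w2 h2 by (simp add: grid_verts_def)
  then show ?thesis
    by auto
qed

lemma alternating_cyc:
  obtains b where "alternating b (last ds) (ds @ ds)" "alternating b (last ds) (ds @ ds @ ds)"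
proof -
  obtain b where "alternating b (last ds) ds" "even (length ds)"
    using good by (auto simp: good_corners_def)
  then show thesis
    using ds_nonempty by (intro that[of b]) (simp_all add: alternating_append)
qed

lemma tour_unroll:
  "tour (last ds) (ds @ ds) = vs @ vs @ [last ds]"
  "tour (last ds) (ds @ ds @ ds) = vs @ vs @ vs @ [last ds]"
  using ds_nonempty by (simp_all add: tour_def corner_walk_def trail_append)

lemma walk_nonempty: "vs \<noteq> []"
proof -
  obtain b where "alternating b (last ds) (ds @ ds)"
    using alternating_cyc by blast
  then obtain d ds' where d: "ds = d # ds'" "move b (last ds) d"
    using ds_nonempty by (cases ds) auto
  have "seg (last ds) d \<noteq> []"
    using move_neq[OF d(2)] by (subst seg.simps) simp
  moreover have "vs = seg (last ds) d @ trail d ds'"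
    using d(1) by (simp only: corner_walk_def trail.simps)
  ultimately show ?thesis
    by simp
qed

lemma walk_hd: "vs ! 0 = last ds"
  using tour_hd[of "last ds" "ds @ ds"] walk_nonempty
  by (cases vs) (auto simp: tour_unroll)

lemma unrolled_nth:
  assumes "k \<le> 2 * n"
  shows "(vs @ vs @ [last ds]) ! k = vs ! (k mod n)"
  using assms walk_nonempty walk_hd by (auto simp: nth_append mod_if)

lemma unrolled3_nth:
  assumes "k \<le> 3 * n"
  shows "(vs @ vs @ vs @ [last ds]) ! k = vs ! (k mod n)"
  using assms walk_nonempty walk_hd by (auto simp: nth_append mod_if)

lemma walk_proper:
  assumes "k < n"
  shows "grid_adj (vs ! (k mod n)) (vs ! (Suc k mod n))"
    and "vs ! (k mod n) \<noteq> vs ! (Suc (Suc k) mod n)"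
proof -
  obtain b where "alternating b (last ds) (ds @ ds)"
    using alternating_cyc by blast
  then have "proper_path (vs @ vs @ [last ds])"
    using tour_proper by (metis tour_unroll(1))
  from proper_path_nth[OF this, of k]
  show "grid_adj (vs ! (k mod n)) (vs ! (Suc k mod n))"
    and "vs ! (k mod n) \<noteq> vs ! (Suc (Suc k) mod n)"
    using unrolled_nth[of k] unrolled_nth[of "Suc k"] unrolled_nth[of "Suc (Suc k)"] assms
    by simp_all
qed

lemma walk_in_grid: "set vs \<subseteq> grid_verts w h"
proof -
  have "set (vs @ vs @ [last ds]) \<subseteq> grid_verts w h"
    unfolding tour_unroll(1) [symmetric]
    using set_ds ds_nonempty last_in_set by (intro set_tour_subset) auto
  then show ?thesis
    by simp
qed

lemma walk_nth_in_grid: "vs ! (k mod n) \<in> grid_verts w h"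
  using walk_in_grid walk_nonempty by (metis length_greater_0_conv mod_less_divisor nth_mem subsetD)

lemma walk_edge_in_grid: "walk_edge vs k \<in> grid_edges w h"
proof -
  have "grid_adj (vs ! (k mod n)) (vs ! (Suc k mod n))"
    using walk_proper(1)[of "k mod n"] walk_nonempty by (simp add: mod_Suc_eq)
  then show ?thesis
    using walk_nth_in_grid[of k] walk_nth_in_grid[of "Suc k"]
    by (auto simp: walk_edge_def grid_edges_def grid_adj_def)
qed

lemma closed_walk: "closed_walk (grid_verts w h) (grid_edges w h) vs"
  using walk_nonempty walk_in_grid walk_edge_in_grid by (simp add: closed_walk_def)

lemma no_U_turns: "no_U_turns vs"
  unfolding no_U_turns_def walk_edge_def
  using walk_proper(2) by (auto simp: doubleton_eq_iff)

text \<open>The count along a path misses the corner at which the path ends. The walks unrolled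
  twice and three times both miss exactly one, so their difference is the count over one full
  period.\<close>

lemma num_turns: "num_turns vs = length ds"
proof -
  define f where "f k = (if perp (vs ! (k mod n)) (vs ! (Suc k mod n)) (vs ! (Suc (Suc k) mod n))
    then 1 else 0 :: nat)" for k
  obtain b where b: "alternating b (last ds) (ds @ ds)" "alternating b (last ds) (ds @ ds @ ds)"
    using alternating_cyc by blast
  \<comment> \<open>A list of \<open>2 * n + 1\<close> vertices has \<open>2 * n - 1\<close> windows
    of three.\<close>
  have "path_turns (vs @ vs @ [last ds]) = (\<Sum>k<2 * n - 1. f k)"
    unfolding path_turns_sum f_def
    by (rule sum.cong) (auto simp: unrolled_nth simp del: append_assoc)
  moreover have "path_turns (vs @ vs @ [last ds]) = 2 * length ds - 1"
    using tour_proper[OF b(1)] by (simp add: tour_unroll)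
  moreover have "path_turns (vs @ vs @ vs @ [last ds]) = (\<Sum>k<3 * n - 1. f k)"
    unfolding path_turns_sum f_def
    by (rule sum.cong) (auto simp: unrolled3_nth simp del: append_assoc)
  moreover have "path_turns (vs @ vs @ vs @ [last ds]) = 3 * length ds - 1"
    using tour_proper[OF b(2)] by (simp add: tour_unroll)
  moreover have "(\<Sum>k<3 * n - 1. f k) = (\<Sum>k<2 * n - 1. f k) + (\<Sum>k<n. f k)"
  proof -
    have "f (k + n) = f k" for k
      by (simp add: f_def flip: add_Suc)
    from sum_cyclic_window[of f n "2 * n - 1", OF this] show ?thesis
      using walk_nonempty by (cases n) (auto simp: algebra_simps numeral_3_eq_3)
  qed
  moreover have "num_turns vs = (\<Sum>k<n. f k)"
    unfolding num_turns_def
  proof (rule sum.cong[OF refl])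
    fix k
    show "turn_cost (walk_turn vs k) = f k"
      using turn_cost_doubleton[OF walk_edge_in_grid walk_edge_in_grid]
      unfolding walk_turn_def by (simp add: f_def perp_def) (simp add: walk_edge_def)
  qed
  moreover have "length ds > 0"
    using ds_nonempty by simp
  ultimately show ?thesis
    by linarith
qed

abbreviation "J v \<equiv> snd (junction_graph (grid_edges w h) vs v)"

definition conn :: "point \<Rightarrow> (point set \<times> point set) set" where
  "conn v = {(x, y). {x, y} \<in># J v}\<^sup>*"

lemma conn_sym: "(x, y) \<in> conn v \<Longrightarrow> (y, x) \<in> conn v"
proof -
  have "sym {(x, y). {x, y} \<in># J v}"
    by (auto simp: sym_def insert_commute)
  then show "(x, y) \<in> conn v \<Longrightarrow> (y, x) \<in> conn v"
    unfolding conn_def using sym_rtrancl by (metis symD)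
qed

lemma conn_trans: "(x, y) \<in> conn v \<Longrightarrow> (y, z) \<in> conn v \<Longrightarrow> (x, z) \<in> conn v"
  unfolding conn_def by (rule rtrancl_trans)

lemma corner_link_conn:
  assumes "(a, b) \<in> corner_link ds v"
  shows "({v, a}, {v, b}) \<in> conn v"
proof -
  obtain c where "alternating c (last ds) (ds @ ds)"
    using alternating_cyc by blast
  from corner_link_infix[OF assms this] obtain xs ys
    where e: "vs @ vs @ [last ds] = xs @ [a, v, b] @ ys"
    by (auto simp: tour_unroll sublist_def)
  define k where "k = length xs"
  have len: "Suc (Suc k) \<le> 2 * n"
    using arg_cong[OF e, of length] by (simp add: k_def)
  have "a = (vs @ vs @ [last ds]) ! k" "v = (vs @ vs @ [last ds]) ! Suc k"
    "b = (vs @ vs @ [last ds]) ! Suc (Suc k)"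
    unfolding e k_def by (simp_all add: nth_append)
  then have abv: "a = vs ! (k mod n)" "v = vs ! (Suc k mod n)" "b = vs ! (Suc (Suc k) mod n)"
    using len by (simp_all add: unrolled_nth)
  have "walk_turn vs (k mod n) = {{v, a}, {v, b}}"
    using walk_edge_mod[of vs "k"] walk_edge_mod[of vs "Suc k"] walk_edge_mod[of vs "Suc (k mod n)"]
    unfolding walk_turn_def abv by (simp add: walk_edge_def mod_Suc_eq insert_commute)
  moreover have "vs ! (Suc (k mod n) mod n) = v"
    by (simp add: abv mod_Suc_eq)
  ultimately have "{{v, a}, {v, b}} \<in># J v"
    unfolding junction_edge_iff using walk_nonempty by (intro exI[of _ "k mod n"]) simp
  then show ?thesis
    unfolding conn_def by (intro r_into_rtrancl) simp
qed

lemma linked_conn: "linked ds v a b \<Longrightarrow> ({v, a}, {v, b}) \<in> conn v"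
  unfolding linked_def
proof (induction rule: rtrancl_induct)
  case base
  then show ?case by (simp add: conn_def)
next
  case (step b c)
  then show ?case
    using corner_link_conn conn_sym conn_trans by blast
qed

text \<open>Every vertex is a corner, and its predecessor and successor in the cyclic list lie in
  perpendicular directions from it.\<close>

lemma turn_at:
  assumes "v \<in> grid_verts w h"
  obtains a b where "({v, a}, {v, b}) \<in> conn v"
    "{v, a} \<in> grid_edges w h" "{v, b} \<in> grid_edges w h"
    "horizontal_edge {v, a}" "vertical_edge {v, b}"
proof -
  obtain xs ys where ds: "ds = xs @ v # ys"
    using assms set_ds by (metis split_list)
  \<comment> \<open>If \<open>v\<close> is the first corner, its predecessor is the leading
    \<open>last ds\<close> of the unrolled list; if it is the last one, its successor comes from the
    second copy.\<close>
  obtain us p where us: "last ds # xs = us @ [p]"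
    by (metis list.discI rev_exhaust)
  obtain q zs where q: "ys @ ds = q # zs"
    using ds_nonempty by (metis append_is_Nil_conv neq_Nil_conv)
  have "cyc ds = (last ds # xs) @ v # ys @ ds"
    unfolding cyc_def by (subst ds) simp
  then have cyc: "cyc ds = us @ [p, v, q] @ zs"
    by (simp add: us q)
  then have sub: "sublist [p, v, q] (cyc ds)"
    by (metis sublist_appendI)
  have "set (cyc ds) = grid_verts w h"
    using last_in_set[OF ds_nonempty] by (simp add: cyc_def insert_absorb flip: set_ds)
  then have in_grid: "p \<in> grid_verts w h" "q \<in> grid_verts w h"
    unfolding cyc by auto
  obtain c where "alternating c (last ds) (ds @ ds)"
    using alternating_cyc by blast
  then obtain c where c: "move c v p" "move (\<not> c) v q"
    using alternating_window cyc move_sym unfolding cyc_def by blast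
  have link: "({v, toward v p}, {v, toward v q}) \<in> conn v"
    using sub by (intro corner_link_conn) (unfold corner_link_def, blast)
  have E: "{v, toward v p} \<in> grid_edges w h" "{v, toward v q} \<in> grid_edges w h"
    using toward_cases(3)[OF c(1)] toward_cases(3)[OF c(2)] move_neq[OF c(1)] move_neq[OF c(2)]
      toward_in_grid[OF assms] in_grid assms
    by (auto simp: grid_edges_def grid_adj_def)
  have hv: "horizontal_edge e \<longleftrightarrow> \<not> vertical_edge e" if "e \<in> grid_edges w h" for e
    using that horizontal_not_vertical by (auto simp: grid_edges_def)
  show thesis
  proof (cases c)
    case True
    show ?thesis
      using toward_cases(4)[OF c(1)] toward_cases(4)[OF c(2)] True E hv
      by (intro that[OF link]) auto
  next
    case False
    show ?thesis
      using toward_cases(4)[OF c(1)] toward_cases(4)[OF c(2)] False E hv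
      by (intro that[OF conn_sym[OF link]]) auto
  qed
qed

text \<open>A vertex has at most two edges of each direction. If there are two, they are opposite
  and \<open>good_corners\<close> links them.\<close>

lemma parallel_conn:
  assumes "e \<in> grid_edges w h" "e' \<in> grid_edges w h" "v \<in> e" "v \<in> e'"
    "horizontal_edge e \<and> horizontal_edge e' \<or> vertical_edge e \<and> vertical_edge e'"
  shows "(e, e') \<in> conn v"
proof -
  obtain i j where v: "v = (i, j)"
    by fastforce
  have ij: "i < w" "j < h"
    using assms by (auto simp: v grid_edges_def grid_verts_def)
  have refl: "(x, x) \<in> conn v" for x
    by (simp add: conn_def)
  have hor: "f = {v, (i, j - 1)} \<and> 0 < j \<or> f = {v, (i, Suc j)} \<and> Suc j < h"
    if F: "f \<in> grid_edges w h" "v \<in> f" "horizontal_edge f" for f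
  proof -
    obtain i' j' where f: "f = {(i', j'), (i', Suc j')}"
      using F(3) by (auto simp: horizontal_edge_def)
    then have "i' = i \<and> (j' = j \<or> Suc j' = j)" "Suc j' < h \<and> i' < w"
      using F(1,2) by (auto simp: v grid_edges_def grid_verts_def)
    then show ?thesis
      by (auto simp: v f insert_commute)
  qed
  have ver: "f = {v, (i - 1, j)} \<and> 0 < i \<or> f = {v, (Suc i, j)} \<and> Suc i < w"
    if F: "f \<in> grid_edges w h" "v \<in> f" "vertical_edge f" for f
  proof -
    obtain i' j' where f: "f = {(i', j'), (Suc i', j')}"
      using F(3) by (auto simp: vertical_edge_def)
    then have "j' = j \<and> (i' = i \<or> Suc i' = i)" "Suc i' < w \<and> j' < h"
      using F(1,2) by (auto simp: v grid_edges_def grid_verts_def)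
    then show ?thesis
      by (auto simp: v f insert_commute)
  qed
  have "({v, (i, j - 1)}, {v, (i, Suc j)}) \<in> conn v" if "0 < j" "Suc j < h"
    using that ij good by (intro linked_conn) (simp add: v good_corners_def)
  moreover have "({v, (i - 1, j)}, {v, (Suc i, j)}) \<in> conn v" if "0 < i" "Suc i < w"
    using that ij good by (intro linked_conn) (simp add: v good_corners_def)
  ultimately show ?thesis
    using assms(5) hor[OF assms(1,3)] hor[OF assms(2,4)] ver[OF assms(1,3)] ver[OF assms(2,4)]
      refl conn_sym by metis
qed

lemma all_conn:
  assumes "v \<in> grid_verts w h" "e \<in> grid_edges w h" "e' \<in> grid_edges w h" "v \<in> e" "v \<in> e'"
  shows "(e, e') \<in> conn v"
proof -
  obtain a b where ab: "({v, a}, {v, b}) \<in> conn v"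
    "{v, a} \<in> grid_edges w h" "{v, b} \<in> grid_edges w h"
    "horizontal_edge {v, a}" "vertical_edge {v, b}"
    using turn_at[OF assms(1)] .
  have base: "(f, {v, a}) \<in> conn v" if "f \<in> grid_edges w h" "v \<in> f" for f
  proof (cases "horizontal_edge f")
    case True
    then show ?thesis
      using parallel_conn ab that by blast
  next
    case False
    then have "(f, {v, b}) \<in> conn v"
      using parallel_conn[of f "{v, b}" v] ab that by (auto simp: grid_edges_def)
    then show ?thesis
      using ab conn_sym conn_trans by blast
  qed
  then show ?thesis
    using assms conn_sym conn_trans by meson
qed

text \<open>At an end point of \<open>e\<close> there is another edge, so connectivity puts
  \<open>e\<close> on a junction edge, and the ends of junction edges are edges that the walk
  traverses.\<close>

lemma edges_covered:
  assumes "e \<in> grid_edges w h"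
  shows "\<exists>k < n. walk_edge vs k = e"
proof -
  obtain v where v: "v \<in> e" "v \<in> grid_verts w h"
    using assms by (auto simp: grid_edges_def horizontal_edge_def vertical_edge_def)
  obtain f where f: "f \<in> grid_edges w h" "v \<in> f" "f \<noteq> e"
    using horizontal_edge_at[OF v(2) h2] vertical_edge_at[OF v(2) w2] horizontal_not_vertical
    by metis
  from all_conn[OF v(2) assms f(1) v(1) f(2)] f(3)
  obtain y where "{e, y} \<in># J v"
    unfolding conn_def by (auto elim: converse_rtranclE)
  then obtain k where k: "k < n" "walk_turn vs k = {e, y}"
    unfolding junction_edge_iff by blast
  then have "walk_edge vs k = e \<or> walk_edge vs (Suc k mod n) = e"
    by (auto simp: walk_turn_def doubleton_eq_iff walk_edge_mod)
  then show ?thesis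
    using k(1) by (metis mod_less_divisor not_gr_zero not_less_zero)
qed

lemma threading: "threading (grid_verts w h) (grid_edges w h) vs"
  using closed_walk no_U_turns edges_covered all_conn
  by (simp add: threading_def junction_graph_def conn_def)

end

section \<open>The turning points of the threadings\<close>

lemma sublist_eqI: "ys = us @ xs @ vs \<Longrightarrow> sublist xs ys"
  by simp

lemma sublist_suffI: "ys = us @ xs \<Longrightarrow> sublist xs ys"
  by simp

lemma sublist_contextI: "sublist xs ys \<Longrightarrow> zs = us @ ys @ vs \<Longrightarrow> sublist xs zs"
  using sublist_appendI sublist_order.order.trans by metis

lemma sublist_infixD: "sublist ys zs \<Longrightarrow> ys = us @ xs @ vs \<Longrightarrow> sublist xs zs"
  using sublist_appendI sublist_order.order.trans by metis

text \<open>Corner lists are built from indexed blocks. A window that crosses the end of a block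
  needs the first corner of the next block or, after the last block, of the rest of the
  list.\<close>

lemma sublist_block_next:
  assumes "k < n" "f k \<noteq> []" "Suc k < n \<Longrightarrow> f (Suc k) \<noteq> []"
  shows "sublist (f k @ [if Suc k < n then hd (f (Suc k)) else y])
    (concat (map f [0..<n]) @ y # ys)"
proof -
  have split: "[0..<n] = [0..<k] @ k # [Suc k..<n]"
    using assms(1) by (metis upt_conv_Cons upt_add_eq_append le0 less_imp_le_nat add_0 le_add_diff_inverse)
  show ?thesis
  proof (cases "Suc k < n")
    case True
    then have "[Suc k..<n] = Suc k # [Suc (Suc k)..<n]"
      by (simp add: upt_conv_Cons)
    moreover obtain z zs where "f (Suc k) = z # zs"
      using assms(3)[OF True] by (meson neq_Nil_conv)
    ultimately have "concat (map f [0..<n]) @ y # ys = concat (map f [0..<k]) @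
      (f k @ [z]) @ zs @ concat (map f [Suc (Suc k)..<n]) @ y # ys"
      by (simp add: split)
    from sublist_eqI[OF this] show ?thesis
      using True \<open>f (Suc k) = z # zs\<close> by simp
  next
    case False
    then have "concat (map f [0..<n]) @ y # ys = concat (map f [0..<k]) @ (f k @ [y]) @ ys"
      by (simp add: split)
    from sublist_eqI[OF this] show ?thesis
      using False by simp
  qed
qed

lemma sublist_block_prev:
  assumes "k < n" "0 < k \<Longrightarrow> f (k - 1) \<noteq> []"
  shows "sublist ((if k = 0 then x else last (f (k - 1))) # f k) (x # concat (map f [0..<n]) @ ys)"
proof -
  have split: "[0..<n] = [0..<k] @ k # [Suc k..<n]"
    using assms(1) by (metis upt_conv_Cons upt_add_eq_append le0 less_imp_le_nat add_0 le_add_diff_inverse)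
  show ?thesis
  proof (cases k)
    case 0
    then have "x # concat (map f [0..<n]) @ ys =
        [] @ (x # f k) @ concat (map f [Suc k..<n]) @ ys"
      by (simp add: split)
    from sublist_eqI[OF this] show ?thesis
      using 0 by simp
  next
    case (Suc l)
    then have "f l = butlast (f l) @ [last (f l)]"
      using assms(2) by simp
    then have "x # concat (map f [0..<n]) @ ys = (x # concat (map f [0..<l]) @ butlast (f l)) @
        (last (f l) # f k) @ concat (map f [Suc k..<n]) @ ys"
      using Suc by (simp add: split)
    from sublist_eqI[OF this] show ?thesis
      using Suc by simp
  qed
qed

lemma sublist_block:
  assumes "k < n"
  shows "sublist (f k) (concat (map f [0..<n]))"
proof -
  have "[0..<n] = [0..<k] @ k # [Suc k..<n]"
    using assms by (metis upt_conv_Cons upt_add_eq_append le0 less_imp_le_nat add_0 le_add_diff_inverse)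
  then show ?thesis
    by simp
qed

lemma length_concat_blocks:
  assumes "\<And>k. k < n \<Longrightarrow> length (f k) = m"
  shows "length (concat (map f [0..<n])) = n * m"
  using assms by (induction n) auto

text \<open>\<open>P k\<close> is the vertex from which block \<open>k\<close> is entered, so it is
  also where block \<open>k - 1\<close> ends. Blocks of even length restore the direction.\<close>

lemma alternating_concat:
  assumes "\<And>k. k < n \<Longrightarrow> even (length (f k)) \<and> alternating b (P k) (f k) \<and>
    last (P k # f k) = P (Suc k)"
  shows "alternating b (P 0) (concat (map f [0..<n])) \<and>
    last (P 0 # concat (map f [0..<n])) = P n \<and> even (length (concat (map f [0..<n])))"
  using assms
proof (induction n)
  case (Suc n)
  then have "alternating b (P 0) (concat (map f [0..<n])) \<and>
    last (P 0 # concat (map f [0..<n])) = P n \<and> even (length (concat (map f [0..<n])))"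
    by simp
  with Suc(2)[of n] show ?case
    by (simp add: alternating_append split: if_splits del: concat_eq_Nil_conv)
qed simp

text \<open>A detour: entered along row \<open>s\<close>, it crosses to row \<open>r\<close>, goes
  back one column and returns to row \<open>s\<close>. The piece of row \<open>s\<close> after it
  therefore overlaps the one before it.\<close>

definition zig :: "nat \<Rightarrow> nat \<Rightarrow> nat \<Rightarrow> point list" where
  "zig s r c = [(s, c), (r, c), (r, c - 1), (s, c - 1)]"

text \<open>For odd \<open>h\<close> this is the strand for \<open>h + 1\<close> columns with all
  column numbers lowered by one; truncated subtraction identifies the columns 0 and 1.\<close>

definition strand :: "nat \<Rightarrow> nat \<Rightarrow> nat \<Rightarrow> point list" where
  "strand h s r =
     (s, 0) # concat (map (\<lambda>k. zig s r (2 * k + 2 - h mod 2)) [0..<(h - 1) div 2]) @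
     [(s, h - 1), (r, h - 1), (r, 0)]"

definition even_corners :: "nat \<Rightarrow> nat \<Rightarrow> point list" where
  "even_corners w h =
     concat (map (\<lambda>k. strand h (2 * k + 2) (2 * k + 1)) [0..<w div 2 - 1]) @ strand h (w - 1) 0"

text \<open>A sweep to the right runs through every column but the first in full height; the way
  back follows row 0 with detours to row 1; the strands of the middle rows follow; the last row and
  row 1, each in full width, close the walk. Each column thus gets four corners in the rows 0, 1 and
  \<open>w - 1\<close>.\<close>

definition odd_corners :: "nat \<Rightarrow> nat \<Rightarrow> point list" where
  "odd_corners w h =
     concat (map (\<lambda>k. [(0, 2 * k + 1), (w - 1, 2 * k + 1), (w - 1, 2 * k + 2), (0, 2 * k + 2)])
       [0..<(h - 1) div 2]) @
     concat (map (\<lambda>k. zig 0 1 (h - 2 - 2 * k)) [0..<(h - 3) div 2]) @ [(0, 1), (1, 1), (1, 0)] @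
     concat (map (\<lambda>k. strand h (2 * k + 2) (2 * k + 3)) [0..<(w - 3) div 2]) @
     [(w - 1, 0), (w - 1, h - 1), (1, h - 1), (1, 0), (0, 0)]"

definition joined :: "point list \<Rightarrow> point \<Rightarrow> point \<Rightarrow> bool" where
  "joined xs p q \<longleftrightarrow> sublist [p, q] xs \<or> sublist [q, p] xs"

lemma joined_sublist: "sublist xs ys \<Longrightarrow> joined xs p q \<Longrightarrow> joined ys p q"
  unfolding joined_def using sublist_order.order.trans by blast

section \<open>Strands that visit two rows\<close>

context
  fixes h :: nat
  assumes h2: "h \<ge> 2"
begin

lemma columns_cases:
  obtains (even) n where "h = 2 * n + 2" "(h - 1) div 2 = n" "h mod 2 = 0"
  | (odd) n where "h = 2 * n + 1" "n \<ge> 1" "(h - 1) div 2 = n" "h mod 2 = 1"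
proof (cases "even h")
  case True
  then obtain m where "h = 2 * m"
    by (elim evenE)
  then show thesis
    using h2 by (intro even[of "m - 1"]) auto
next
  case False
  then obtain m where "h = 2 * m + 1"
    by (elim oddE)
  then show thesis
    using h2 by (intro odd[of m]) auto
qed

lemma length_strand: "length (strand h s r) = 4 * ((h - 1) div 2) + 4"
  by (simp add: strand_def length_concat_blocks[where m = 4] zig_def)

lemma strand_Cons: "\<exists>ys. strand h s r = (s, 0) # ys"
  by (simp add: strand_def)

lemma strand_snoc: "\<exists>ys. strand h s r = ys @ [(r, h - 1), (r, 0)]"
  by (simp add: strand_def)

lemma strand_Cons2:
  assumes "odd h"
  shows "\<exists>ys. strand h s r = (s, 0) # (s, 1) # ys"
proof -
  have "(h - 1) div 2 > 0" "h mod 2 = 1"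
    using assms h2 by presburger+
  then have "[0..<(h - 1) div 2] = 0 # [1..<(h - 1) div 2]"
    by (simp add: upt_conv_Cons)
  then show ?thesis
    using \<open>h mod 2 = 1\<close> by (simp add: strand_def zig_def)
qed

lemma hd_strand: "hd (strand h s r) = (s, 0)"
  by (simp add: strand_def)

lemma alternating_strand:
  assumes "x \<noteq> s" "s \<noteq> r"
  shows "alternating False (x, 0) (strand h s r)"
proof -
  let ?n = "(h - 1) div 2"
  let ?f = "\<lambda>k. zig s r (2 * k + 2 - h mod 2)"
  define A where "A = concat (map ?f [0..<?n])"
  \<comment> \<open>For \<open>k = 0\<close> truncated subtraction gives column 0, where the strand
    enters row \<open>s\<close>, so one formula describes the start of every detour.\<close>
  have "alternating True (s, 2 * 0 - 1 - h mod 2) A \<and>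
    last ((s, 2 * 0 - 1 - h mod 2) # A) = (s, 2 * ?n - 1 - h mod 2) \<and> even (length A)"
    unfolding A_def
    by (rule alternating_concat[where P = "\<lambda>k. (s, 2 * k - 1 - h mod 2)"])
      (use assms mod2_eq_if[of h] in \<open>auto simp: zig_def split: if_splits\<close>)
  then have A: "alternating True (s, 0) A" "last ((s, 0) # A) = (s, 2 * ?n - 1 - h mod 2)"
    "even (length A)"
    by simp_all
  have "2 * ?n - 1 - h mod 2 \<noteq> h - 1" "0 \<noteq> h - 1"
    by (cases rule: columns_cases; simp)+
  with A assms show ?thesis
    unfolding strand_def A_def [symmetric]
    by (simp only: alternating.simps alternating_append if_True move.simps fst_conv snd_conv
        last_ConsL simp_thms)
qed

lemma strand_joined_row: "joined (strand h s r) (r, h - 1) (r, 0)"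
proof -
  have "sublist [(r, h - 1), (r, 0)]
    (((s, 0) # concat (map (\<lambda>k. zig s r (2 * k + 2 - h mod 2)) [0..<(h - 1) div 2]) @
     [(s, h - 1)]) @ [(r, h - 1), (r, 0)] @ [])"
    by (rule sublist_appendI)
  then show ?thesis
    by (simp add: joined_def strand_def)
qed

text \<open>With \<open>c = 2 * k + 2 - h mod 2\<close>, the piece of row \<open>s\<close> after the
  detour runs from \<open>c - 1\<close> to \<open>x\<close>. It reaches beyond \<open>c + 1\<close>
  or, if \<open>c = h - 2\<close>, at least to the last column; either way it passes the inner
  columns among \<open>c\<close> and \<open>c + 1\<close>.\<close>

lemma strand_block:
  assumes "k < (h - 1) div 2"
  obtains x where "x > 2 * k + 3 - h mod 2 \<or> x = h - 1 \<and> 2 * k + 2 - h mod 2 = h - 2"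
    "sublist (zig s r (2 * k + 2 - h mod 2) @ [(s, x)]) (strand h s r)"
proof -
  let ?n = "(h - 1) div 2"
  let ?f = "\<lambda>k. zig s r (2 * k + 2 - h mod 2)"
  let ?x = "if Suc k < ?n then 2 * Suc k + 2 - h mod 2 else h - 1"
  have "sublist (?f k @ [if Suc k < ?n then hd (?f (Suc k)) else (s, h - 1)])
      (concat (map ?f [0..<?n]) @ (s, h - 1) # [(r, h - 1), (r, 0)])"
    by (rule sublist_block_next) (use assms in \<open>auto simp: zig_def\<close>)
  moreover have "(if Suc k < ?n then hd (?f (Suc k)) else (s, h - 1)) = (s, ?x)"
    by (simp add: zig_def)
  ultimately have "sublist (?f k @ [(s, ?x)]) (strand h s r)"
    unfolding strand_def by (simp add: sublist_Cons_right)
  moreover have "?x > 2 * k + 3 - h mod 2 \<or> ?x = h - 1 \<and> 2 * k + 2 - h mod 2 = h - 2"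
    using assms by (cases rule: columns_cases) (auto split: if_splits)
  ultimately show thesis
    using that by blast
qed

lemma strand_joined_col:
  assumes "0 < j" "j < h"
  shows "joined (strand h s r) (s, j) (r, j)"
proof (cases "j = h - 1")
  case True
  have "sublist [(s, h - 1), (r, h - 1)]
    (((s, 0) # concat (map (\<lambda>k. zig s r (2 * k + 2 - h mod 2)) [0..<(h - 1) div 2])) @
     [(s, h - 1), (r, h - 1)] @ [(r, 0)])"
    by (rule sublist_appendI)
  then show ?thesis
    by (simp add: True joined_def strand_def)
next
  case False
  \<comment> \<open>The detour that uses column \<open>j\<close>; it joins the two rows in the
    columns \<open>c\<close> and \<open>c - 1\<close>.\<close>
  define k where "k = (j + h mod 2 - 1) div 2"
  define c where "c = 2 * k + 2 - h mod 2"
  have k: "k < (h - 1) div 2" and j: "j = c \<or> j = c - 1"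
  proof (atomize (full), cases rule: columns_cases)
    case (even n)
    then have "2 * k + 1 = j \<or> 2 * k + 2 = j" "j < 2 * n + 1" "c = 2 * k + 2"
      using assms False unfolding k_def c_def by auto
    then show "k < (h - 1) div 2 \<and> (j = c \<or> j = c - 1)"
      using even by auto
  next
    case (odd n)
    then have "2 * k = j \<or> 2 * k + 1 = j" "j < 2 * n" "c = 2 * k + 1"
      using assms False unfolding k_def c_def by auto
    then show "k < (h - 1) div 2 \<and> (j = c \<or> j = c - 1)"
      using odd by auto
  qed
  from strand_block[OF k, of s r] obtain x
    where x: "sublist (zig s r c @ [(s, x)]) (strand h s r)"
    unfolding c_def by blast
  have "zig s r c @ [(s, x)] = [] @ [(s, c), (r, c)] @ [(r, c - 1), (s, c - 1), (s, x)]"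
    "zig s r c @ [(s, x)] = [(s, c), (r, c)] @ [(r, c - 1), (s, c - 1)] @ [(s, x)]"
    by (simp_all add: zig_def)
  from this[THEN sublist_eqI] have "joined (zig s r c @ [(s, x)]) (s, j) (r, j)"
    using j unfolding joined_def by blast
  with x show ?thesis
    by (rule joined_sublist)
qed

lemma strand_joined_inner:
  assumes "0 < j" "Suc j < h"
  obtains a b where "a < j" "j < b" "joined (strand h s r) (s, a) (s, b)"
proof (cases "j = 1 \<and> even h")
  case True
  \<comment> \<open>For even \<open>h\<close>, column 1 lies before the first detour and is passed
    by the piece from 0 to 2.\<close>
  then have "(h - 1) div 2 > 0"
    using assms by presburger
  then have "[0..<(h - 1) div 2] = 0 # [1..<(h - 1) div 2]"
    by (simp add: upt_conv_Cons)
  then have "prefix [(s, 0), (s, 2)] (strand h s r)"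
    using True by (simp add: strand_def zig_def even_iff_mod_2_eq_zero)
  then show ?thesis
    using True that[of 0 2] by (auto simp: joined_def)
next
  case False
  \<comment> \<open>The last detour with \<open>c \<le> j\<close>. The piece of row \<open>s\<close>
    that follows it starts in \<open>c - 1\<close> and passes \<open>j\<close>.\<close>
  define k where "k = (j + h mod 2 - 2) div 2"
  define c where "c = 2 * k + 2 - h mod 2"
  have k: "k < (h - 1) div 2" and j: "c - 1 < j" "j \<le> c + 1" "j < h - 1"
  proof (atomize (full), cases rule: columns_cases)
    case (even n)
    then have "2 * k + 2 = j \<or> 2 * k + 3 = j" "j < 2 * n + 1" "c = 2 * k + 2"
      using assms False unfolding k_def c_def by auto
    then show "k < (h - 1) div 2 \<and> c - 1 < j \<and> j \<le> c + 1 \<and> j < h - 1"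
      using even by auto
  next
    case (odd n)
    then have "2 * k + 1 = j \<or> 2 * k + 2 = j" "j < 2 * n" "c = 2 * k + 1"
      using assms False unfolding k_def c_def by auto
    then show "k < (h - 1) div 2 \<and> c - 1 < j \<and> j \<le> c + 1 \<and> j < h - 1"
      using odd by auto
  qed
  from strand_block[OF k, of s r] obtain x
    where x: "x > 2 * k + 3 - h mod 2 \<or> x = h - 1 \<and> c = h - 2"
      "sublist (zig s r c @ [(s, x)]) (strand h s r)"
    unfolding c_def by blast
  have "zig s r c @ [(s, x)] = [(s, c), (r, c), (r, c - 1)] @ [(s, c - 1), (s, x)] @ []"
    by (simp add: zig_def)
  from sublist_eqI[OF this] have "joined (zig s r c @ [(s, x)]) (s, c - 1) (s, x)"
    unfolding joined_def by blast
  with x(2) have "joined (strand h s r) (s, c - 1) (s, x)"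
    by (rule joined_sublist)
  moreover have "j < x"
    using x(1) j k by (cases rule: columns_cases) (auto simp: c_def)
  ultimately show ?thesis
    using that j(1) by blast
qed

lemma set_strand: "set (strand h s r) = {s, r} \<times> {..<h}"
proof
  show "set (strand h s r) \<subseteq> {s, r} \<times> {..<h}"
    using h2 by (auto simp: strand_def zig_def)
  show "{s, r} \<times> {..<h} \<subseteq> set (strand h s r)"
  proof
    fix p assume "p \<in> {s, r} \<times> {..<h}"
    then obtain j where j: "j < h" "p = (s, j) \<or> p = (r, j)"
      by auto
    show "p \<in> set (strand h s r)"
    proof (cases "j = 0")
      case True
      with j show ?thesis
        by (auto simp: strand_def)
    next
      case False
      then have "joined (strand h s r) (s, j) (r, j)"
        using j strand_joined_col by simp
      then have "{(s, j), (r, j)} \<subseteq> set (strand h s r)"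
        unfolding joined_def using set_mono_sublist by fastforce
      with j show ?thesis
        by auto
    qed
  qed
qed

text \<open>For odd \<open>h\<close> the first detour ends in column 0, which makes
  \<open>(s, 0)\<close> a corner for the second time. When both dimensions are odd, these turns
  replace the missing straight passes in the first column.\<close>

lemma strand_corners_col0:
  assumes "odd h"
  shows "sublist [(r, 1), (r, 0), (s, 0)] (strand h s r)"
    and "\<exists>x > 0. sublist [(r, 0), (s, 0), (s, x)] (strand h s r)"
proof -
  have k: "0 < (h - 1) div 2"
    using assms h2 by presburger
  have c: "2 * 0 + 2 - h mod 2 = 1"
    using assms by presburger
  obtain x where "x > 2 * 0 + 3 - h mod 2 \<or> x = h - 1 \<and> 2 * 0 + 2 - h mod 2 = h - 2"
    "sublist (zig s r (2 * 0 + 2 - h mod 2) @ [(s, x)]) (strand h s r)"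
    by (rule strand_block[OF k])
  then have x: "x > 0" "sublist (zig s r 1 @ [(s, x)]) (strand h s r)"
    unfolding c using h2 by linarith+
  have "zig s r 1 @ [(s, x)] = [(s, 1)] @ [(r, 1), (r, 0), (s, 0)] @ [(s, x)]"
    "zig s r 1 @ [(s, x)] = [(s, 1), (r, 1)] @ [(r, 0), (s, 0), (s, x)] @ []"
    by (simp_all add: zig_def)
  from this[THEN sublist_eqI] x
  show "sublist [(r, 1), (r, 0), (s, 0)] (strand h s r)"
    and "\<exists>x > 0. sublist [(r, 0), (s, 0), (s, x)] (strand h s r)"
    using sublist_order.order.trans by blast+
qed

end

section \<open>Links between opposite edges\<close>

lemma linked_sym: "linked ds v a b \<Longrightarrow> linked ds v b a"
proof -
  have "sym (corner_link ds v \<union> (corner_link ds v)\<inverse>)"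
    by (auto simp: sym_def)
  then show "linked ds v a b \<Longrightarrow> linked ds v b a"
    unfolding linked_def using sym_rtrancl by (metis symD)
qed

lemma linked_trans: "linked ds v a b \<Longrightarrow> linked ds v b c \<Longrightarrow> linked ds v a c"
  unfolding linked_def by (rule rtrancl_trans)

lemma corner_link_linked: "(a, b) \<in> corner_link ds v \<Longrightarrow> linked ds v a b"
  unfolding linked_def by auto

lemma linked_between:
  assumes "between p v q" "joined (cyc ds) p q"
  shows "linked ds v (toward v p) (toward v q)"
proof -
  have "between q v p"
    using assms(1) by (cases p; cases v; cases q) auto
  then have "(toward v p, toward v q) \<in> corner_link ds v \<or> (toward v q, toward v p) \<in> corner_link ds v"
    using assms unfolding corner_link_def joined_def by blast
  then show ?thesis
    using corner_link_linked linked_sym by blast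
qed

lemma linked_turn: "sublist [p, v, q] (cyc ds) \<Longrightarrow> linked ds v (toward v p) (toward v q)"
  by (rule corner_link_linked) (unfold corner_link_def, blast)

lemma linked_row:
  assumes "joined (cyc ds) (i, a) (i, b)" "a < j" "j < b"
  shows "linked ds (i, j) (i, j - 1) (i, Suc j)"
  using linked_between[OF _ assms(1), of "(i, j)"] assms(2,3) by simp

lemma linked_col:
  assumes "joined (cyc ds) (a, j) (b, j)" "a < i" "i < b"
  shows "linked ds (i, j) (i - 1, j) (Suc i, j)"
  using linked_between[OF _ assms(1), of "(i, j)"] assms(2,3) by simp

lemma joined_commute: "joined xs p q \<longleftrightarrow> joined xs q p"
  by (auto simp: joined_def)

lemma sublist_cyc: "sublist xs ds \<Longrightarrow> sublist xs (cyc ds)"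
  unfolding cyc_def by (metis append_Cons append_Nil sublist_append_leftI sublist_append_rightI sublist_order.order.trans)

text \<open>Row \<open>s\<close> is covered by overlapping pieces, row \<open>r\<close> by its final
  piece, which spans the full width.\<close>

lemma strand_links:
  assumes "sublist (strand h s r) ds" "0 < j" "Suc j < h"
  shows "linked ds (s, j) (s, j - 1) (s, Suc j)" "linked ds (r, j) (r, j - 1) (r, Suc j)"
proof -
  have h2: "h \<ge> 2"
    using assms by simp
  have sub: "sublist (strand h s r) (cyc ds)"
    using assms(1) by (rule sublist_cyc)
  obtain a b where "a < j" "j < b" "joined (strand h s r) (s, a) (s, b)"
    using strand_joined_inner[OF h2 assms(2,3)] .
  then show "linked ds (s, j) (s, j - 1) (s, Suc j)"
    using joined_sublist[OF sub] by (intro linked_row)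
  have "joined (cyc ds) (r, 0) (r, h - 1)"
    using joined_sublist[OF sub strand_joined_row[OF h2]] by (simp add: joined_commute)
  then show "linked ds (r, j) (r, j - 1) (r, Suc j)"
    using assms by (intro linked_row) auto
qed

section \<open>Corners for an even number of rows\<close>

context
  fixes N h :: nat and ds :: "point list"
  assumes h2: "h \<ge> 2"
  defines "ds \<equiv> even_corners (2 * N + 2) h"
begin

lemma even_corners_eq:
  "ds = concat (map (\<lambda>k. strand h (2 * k + 2) (2 * k + 1)) [0..<N]) @ strand h (2 * N + 1) 0"
  by (simp add: ds_def even_corners_def)

lemma even_corners_last: "last ds = (0, 0)"
  unfolding even_corners_eq using strand_snoc[OF h2, of "2 * N + 1" 0] by auto

lemma even_corners_strand:
  "k < N \<Longrightarrow> sublist (strand h (2 * k + 2) (2 * k + 1)) ds"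
  "sublist (strand h (2 * N + 1) 0) ds"
proof -
  show "sublist (strand h (2 * k + 2) (2 * k + 1)) ds" if "k < N"
    using sublist_block[OF that, of "\<lambda>k. strand h (2 * k + 2) (2 * k + 1)"] unfolding even_corners_eq
    by (rule sublist_order.order.trans) simp
qed (simp add: even_corners_eq)

text \<open>The passage from one strand to the next is a vertical piece of the first column. The one
  into the closing strand is a row shorter because that strand starts in the last row.\<close>

lemma even_corners_chain:
  assumes "k < N"
  shows "joined ds (2 * k + 1, 0) (if Suc k < N then 2 * k + 4 else 2 * k + 3, 0)"
proof -
  let ?f = "\<lambda>k. strand h (2 * k + 2) (2 * k + 1)"
  obtain ys where ys: "strand h (2 * N + 1) 0 = (2 * N + 1, 0) # ys"
    using strand_Cons[OF h2] by blast
  obtain zs where zs: "?f k = zs @ [(2 * k + 1, h - 1), (2 * k + 1, 0)]"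
    using strand_snoc[OF h2] by blast
  have "sublist (?f k @ [if Suc k < N then hd (?f (Suc k)) else (2 * N + 1, 0)]) ds"
    unfolding even_corners_eq ys
    by (rule sublist_block_next) (use assms in \<open>auto simp: strand_def\<close>)
  moreover have "(if Suc k < N then hd (?f (Suc k)) else (2 * N + 1, 0)) =
      (if Suc k < N then 2 * k + 4 else 2 * k + 3, 0)"
    using assms by (auto simp: hd_strand[OF h2])
  ultimately have "sublist ((zs @ [(2 * k + 1, h - 1)]) @
      [(2 * k + 1, 0), (if Suc k < N then 2 * k + 4 else 2 * k + 3, 0)]) ds"
    unfolding zs by simp
  from sublist_order.order.trans[OF sublist_append_leftI this] show ?thesis
    unfolding joined_def ..
qed

lemma even_corners_good: "good_corners (2 * N + 2) h ds"
proof -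
  let ?f = "\<lambda>k. strand h (2 * k + 2) (2 * k + 1)"
  let ?C = "concat (map ?f [0..<N])"
  \<comment> \<open>The truncated \<open>2 * k - 1\<close> is 0 for \<open>k = 0\<close>, the row in
    which the cyclic list ends and begins.\<close>
  have ac: "alternating False (2 * 0 - 1, 0) ?C \<and>
    last ((2 * 0 - 1, 0) # ?C) = (2 * N - 1, 0) \<and> even (length ?C)"
  proof (rule alternating_concat[where P = "\<lambda>k. (2 * k - 1, 0)"])
    fix k
    have "alternating False (2 * k - 1, 0) (?f k)"
      by (rule alternating_strand[OF h2]) auto
    moreover have "last ((2 * k - 1, 0) # ?f k) = (2 * k + 1, 0)"
      by (simp add: strand_def)
    ultimately show "even (length (?f k)) \<and> alternating False (2 * k - 1, 0) (?f k) \<and>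
        last ((2 * k - 1, 0) # ?f k) = (2 * Suc k - 1, 0)"
      by (simp add: length_strand[OF h2])
  qed
  have "alternating False (2 * N - 1, 0) (strand h (2 * N + 1) 0)"
    by (rule alternating_strand[OF h2]) auto
  with ac have alt: "alternating False (last ds) ds"
    unfolding even_corners_last unfolding even_corners_eq alternating_append by simp
  have len: "even (length ds)"
    using ac by (simp add: even_corners_eq length_strand[OF h2])
  have setf: "set ds = grid_verts (2 * N + 2) h"
  proof -
    have "set ds = (\<Union>k<N. {2 * k + 2, 2 * k + 1} \<times> {..<h}) \<union> {2 * N + 1, 0} \<times> {..<h}"
      by (simp add: even_corners_eq set_strand[OF h2] atLeast0LessThan)
    also have "\<dots> = ((\<Union>k<N. {2 * k + 2, 2 * k + 1}) \<union> {2 * N + 1, 0}) \<times> {..<h}"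
      by auto
    also have "(\<Union>k<N. {2 * k + 2, 2 * k + 1}) \<union> {2 * N + 1, 0} = {..<2 * N + 2}"
    proof
      show "{..<2 * N + 2} \<subseteq> (\<Union>k<N. {2 * k + 2, 2 * k + 1}) \<union> {2 * N + 1, 0}"
      proof
        fix i assume i: "i \<in> {..<2 * N + 2}"
        then consider "i = 0" | "i = 2 * N + 1" | "0 < i" "(i - 1) div 2 < N"
          by (auto, linarith)
        then show "i \<in> (\<Union>k<N. {2 * k + 2, 2 * k + 1}) \<union> {2 * N + 1, 0}"
        proof cases
          case 3
          moreover from \<open>0 < i\<close> have "i = 2 * ((i - 1) div 2) + 2 \<or> i = 2 * ((i - 1) div 2) + 1"
            by presburger
          ultimately show ?thesis
            by blast
        qed auto
      qed
    qed auto
    finally show ?thesis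
      by (simp add: grid_verts_def)
  qed
  have row: "linked ds (i, j) (i, j - 1) (i, Suc j)" if ij: "i < 2 * N + 2" "0 < j" "Suc j < h" for i j
  proof -
    consider "i = 0" | "i = 2 * N + 1" | "0 < i" "(i - 1) div 2 < N"
      using ij(1) by linarith
    then show ?thesis
    proof cases
      case 3
      moreover from \<open>0 < i\<close> have "i = 2 * ((i - 1) div 2) + 2 \<or> i = 2 * ((i - 1) div 2) + 1"
        by presburger
      ultimately show ?thesis
        using strand_links[OF even_corners_strand(1)[OF 3(2)] ij(2,3)] by metis
    qed (use strand_links[OF even_corners_strand(2) ij(2,3)] in simp_all)
  qed
  have col: "linked ds (i, j) (i - 1, j) (Suc i, j)"
    if "j < h" "0 < i" "Suc i < 2 * N + 2" for i j
  proof (cases "j = 0")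
    case False
    \<comment> \<open>The closing strand pairs the last row with row 0, so it has a piece of full
      height in every column but the first.\<close>
    then have "joined (cyc ds) (2 * N + 1, j) (0, j)"
      using joined_sublist[OF sublist_cyc[OF even_corners_strand(2)] strand_joined_col[OF h2]] that
      by simp
    then have "joined (cyc ds) (0, j) (2 * N + 1, j)"
      by (simp add: joined_commute)
    then show ?thesis
      using that by (intro linked_col) auto
  next
    case True
    have "joined (cyc ds) (0, 0) (2, 0)" if "N > 0"
    proof -
      obtain ys where ys: "?f 0 = (2 * 0 + 2, 0) # ys"
        using strand_Cons[OF h2] by blast
      have "[0..<N] = 0 # [1..<N]"
        using that by (simp add: upt_conv_Cons)
      then have "cyc ds = [] @ [(0, 0), (2, 0)] @ ys @ concat (map ?f [1..<N]) @
          strand h (2 * N + 1) 0 @ ds"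
        unfolding cyc_def even_corners_last by (subst even_corners_eq) (use ys in \<open>simp add: numeral_2_eq_2\<close>)
      from sublist_eqI[OF this] show ?thesis
        by (simp add: joined_def)
    qed
    moreover have "joined (cyc ds) (2 * k + 1, 0) (if Suc k < N then 2 * k + 4 else 2 * k + 3, 0)"
      if "k < N" for k
      using even_corners_chain[OF that] sublist_cyc joined_sublist by blast
    \<comment> \<open>In the first column row 1 lies inside the piece from 0 to 2. Any other inner
      row lies strictly inside the piece from \<open>2 * k + 1\<close> with
      \<open>k = (i - 2) div 2\<close>, since consecutive pieces overlap.\<close>
    moreover have "i = 1 \<and> N > 0 \<or> (i - 2) div 2 < N \<and> 2 * ((i - 2) div 2) + 1 < i \<and>
        i < (if Suc ((i - 2) div 2) < N then 2 * ((i - 2) div 2) + 4 else 2 * ((i - 2) div 2) + 3)"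
    proof (cases "i = 1")
      case False
      then have "i = 2 * ((i - 2) div 2) + 2 \<or> i = 2 * ((i - 2) div 2) + 3"
        using that(2) by presburger
      then show ?thesis
        using that(3) by auto
    qed (use that in simp)
    ultimately show ?thesis
      unfolding True using linked_col[of ds 0 0 2 i]
        linked_col[of ds "2 * ((i - 2) div 2) + 1" 0 _ i] by fastforce
  qed
  show ?thesis
    unfolding good_corners_def using alt len setf row col by blast
qed

lemma even_corners_length: "length ds = (2 * N + 2) * (2 * ((h + 1) div 2))"
proof -
  have "length ds = N * (4 * ((h - 1) div 2) + 4) + (4 * ((h - 1) div 2) + 4)"
    unfolding even_corners_eq length_append
    by (subst length_concat_blocks[where m = "4 * ((h - 1) div 2) + 4"]) (simp_all add: length_strand[OF h2])
  moreover have "(h + 1) div 2 = (h - 1) div 2 + 1"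
    using h2 by presburger
  ultimately show ?thesis
    by (simp add: algebra_simps)
qed

end

section \<open>Corners for odd numbers of rows and columns\<close>

lemma odd_corners_eq:
  "odd_corners (2 * W + 3) (2 * H + 3) =
     concat (map (\<lambda>k. [(0, 2 * k + 1), (2 * W + 2, 2 * k + 1), (2 * W + 2, 2 * k + 2), (0, 2 * k + 2)])
       [0..<Suc H]) @
     concat (map (\<lambda>k. zig 0 1 (2 * H + 1 - 2 * k)) [0..<H]) @ [(0, 1), (1, 1), (1, 0)] @
     concat (map (\<lambda>k. strand (2 * H + 3) (2 * k + 2) (2 * k + 3)) [0..<W]) @
     [(2 * W + 2, 0), (2 * W + 2, 2 * H + 2), (1, 2 * H + 2), (1, 0), (0, 0)]"
proof -
  have "(2 * H + 3 - 1) div 2 = Suc H" "(2 * H + 3 - 3) div 2 = H" "(2 * W + 3 - 3) div 2 = W"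
    "2 * W + 3 - 1 = 2 * W + 2" "2 * H + 3 - 1 = 2 * H + 2"
    "\<And>k. 2 * H + 3 - 2 - 2 * k = 2 * H + 1 - 2 * k"
    by simp_all
  then show ?thesis
    unfolding odd_corners_def by (simp only:)
qed

context
  fixes W H w h :: nat and ds :: "point list"
  defines "w \<equiv> 2 * W + 3" and "h \<equiv> 2 * H + 3"
  defines "ds \<equiv> odd_corners w h"
begin

private definition fwd :: "nat \<Rightarrow> point list" where
  "fwd k = [(0, 2 * k + 1), (2 * W + 2, 2 * k + 1), (2 * W + 2, 2 * k + 2), (0, 2 * k + 2)]"

private definition bwd :: "nat \<Rightarrow> point list" where
  "bwd k = zig 0 1 (2 * H + 1 - 2 * k)"

private definition mid :: "nat \<Rightarrow> point list" where
  "mid k = strand h (2 * k + 2) (2 * k + 3)"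

private definition tail :: "point list" where
  "tail = [(2 * W + 2, 0), (2 * W + 2, 2 * H + 2), (1, 2 * H + 2), (1, 0), (0, 0)]"

private lemma h2: "h \<ge> 2" and odd_h: "odd h" and h_pred: "h - 1 = 2 * H + 2"
  by (simp_all add: h_def)

private lemma ds_eq:
  "ds = concat (map fwd [0..<Suc H]) @ concat (map bwd [0..<H]) @ [(0, 1), (1, 1), (1, 0)] @
     concat (map mid [0..<W]) @ tail"
  unfolding ds_def w_def h_def odd_corners_eq fwd_def [abs_def] bwd_def [abs_def] mid_def [abs_def]
    tail_def ..

private lemma last_ds: "last ds = (0, 0)"
  by (simp add: ds_eq tail_def)

private lemma fwd_alternating:
  "alternating True (0, 0) (concat (map fwd [0..<Suc H])) \<and>
   last ((0, 0) # concat (map fwd [0..<Suc H])) = (0, 2 * H + 2) \<and>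
   even (length (concat (map fwd [0..<Suc H])))"
  using alternating_concat[of "Suc H" fwd True "\<lambda>k. (0, 2 * k)"]
  by (simp add: fwd_def del: upt_Suc)

private lemma bwd_alternating:
  "alternating True (0, 2 * H + 2) (concat (map bwd [0..<H])) \<and>
   last ((0, 2 * H + 2) # concat (map bwd [0..<H])) = (0, 2) \<and>
   even (length (concat (map bwd [0..<H])))"
proof -
  have "even (length (bwd k)) \<and> alternating True (0, 2 * H + 2 - 2 * k) (bwd k) \<and>
      last ((0, 2 * H + 2 - 2 * k) # bwd k) = (0, 2 * H + 2 - 2 * Suc k)" if "k < H" for k
    using that by (auto simp: bwd_def zig_def)
  from alternating_concat[where P = "\<lambda>k. (0, 2 * H + 2 - 2 * k)" and f = bwd and n = H, OF this]
  show ?thesis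
    by simp
qed

private lemma mid_alternating:
  "alternating False (1, 0) (concat (map mid [0..<W])) \<and>
   last ((1, 0) # concat (map mid [0..<W])) = (2 * W + 1, 0) \<and>
   even (length (concat (map mid [0..<W])))"
proof -
  have "even (length (mid k)) \<and> alternating False (2 * k + 1, 0) (mid k) \<and>
      last ((2 * k + 1, 0) # mid k) = (2 * Suc k + 1, 0)" for k
    unfolding mid_def using alternating_strand[OF h2, of "2 * k + 1" "2 * k + 2" "2 * k + 3"]
    by (simp add: length_strand[OF h2]) (simp add: strand_def)
  then show ?thesis
    using alternating_concat[of W mid False "\<lambda>k. (2 * k + 1, 0)"] by simp
qed

private lemma alternating_ds: "alternating True (last ds) ds \<and> even (length ds)"
  unfolding last_ds unfolding ds_eq alternating_append
  using fwd_alternating bwd_alternating mid_alternating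
  by (simp add: tail_def del: upt_Suc)

private lemma length_ds: "length ds + 4 = (w + 1) * (h + 1)"
proof -
  have "length (mid k) = 4 * Suc H + 4" for k
    using length_strand[OF h2] by (simp add: mid_def h_def)
  then have "length ds = Suc H * 4 + (H * 4 + (3 + (W * (4 * Suc H + 4) + 5)))"
    unfolding ds_eq length_append
    by (subst length_concat_blocks[where m = 4], simp add: fwd_def)
      (subst length_concat_blocks[where m = 4], simp add: bwd_def zig_def,
       subst length_concat_blocks[where m = "4 * Suc H + 4"], simp_all add: tail_def)
  then show ?thesis
    by (simp add: w_def h_def algebra_simps)
qed

private lemma sub_fwd: "k \<le> H \<Longrightarrow> sublist (fwd k) ds"
  by (rule sublist_contextI[OF sublist_block[of k "Suc H"], where us = "[]"])
    (simp_all add: ds_eq del: upt_Suc)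

private lemma sub_bwd: "k < H \<Longrightarrow> sublist (bwd k) ds"
  by (rule sublist_contextI[OF sublist_block[of k H], where us = "concat (map fwd [0..<Suc H])"])
    (simp_all add: ds_eq del: upt_Suc)

private lemma sub_one: "sublist [(0, 1), (1, 1), (1, 0)] ds"
  by (rule sublist_eqI[where us = "concat (map fwd [0..<Suc H]) @ concat (map bwd [0..<H])"])
    (simp add: ds_eq del: upt_Suc)

private lemma sub_mids: "sublist (concat (map mid [0..<W]) @ tail) ds"
  by (rule sublist_eqI[where us = "concat (map fwd [0..<Suc H]) @ concat (map bwd [0..<H]) @
      [(0, 1), (1, 1), (1, 0)]" and vs = "[]"])
    (simp add: ds_eq del: upt_Suc)

private lemma sub_mid: "k < W \<Longrightarrow> sublist (mid k) ds"
  by (rule sublist_order.order.trans[OF _ sub_mids], rule sublist_contextI[OF sublist_block, where us = "[]"])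
    simp_all

private lemma sub_tail: "sublist tail ds"
  by (rule sublist_infixD[OF sub_mids, where vs = "[]"]) simp

private lemma set_ds: "set ds = grid_verts w h"
proof
  have mid: "set (mid k) = {2 * k + 2, 2 * k + 3} \<times> {..<h}" for k
    by (simp add: mid_def set_strand[OF h2])
  show "set ds \<subseteq> grid_verts w h"
    by (auto simp: ds_eq mid fwd_def bwd_def zig_def tail_def grid_verts_def w_def h_def
        simp del: upt_Suc)
  show "grid_verts w h \<subseteq> set ds"
  proof
    fix p assume "p \<in> grid_verts w h"
    then obtain i j where p: "p = (i, j)" and ij: "i < w" "j < h"
      by (auto simp: grid_verts_def)
    have fwd: "set (fwd k) \<subseteq> set ds" if "k \<le> H" for k
      using sub_fwd[OF that] by (rule set_mono_sublist)
    have bwd: "set (bwd k) \<subseteq> set ds" if "k < H" for k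
      using sub_bwd[OF that] by (rule set_mono_sublist)
    have tail: "set tail \<subseteq> set ds"
      using sub_tail by (rule set_mono_sublist)
    consider "i = 0 \<or> i = 2 * W + 2" "j = 0" | "i = 0 \<or> i = 2 * W + 2" "j > 0"
      | "i = 1" "j = 0 \<or> j = 1 \<or> j = 2 * H + 2" | "i = 1" "1 < j" "j < 2 * H + 2"
      | "1 < i" "i < 2 * W + 2"
      using ij unfolding w_def h_def by (cases "i = 1"; cases "i = 0 \<or> i = 2 * W + 2"; auto; linarith)
    then have "(i, j) \<in> set ds"
    proof cases
      case 1
      then show ?thesis
        using tail by (auto simp: tail_def)
    next
      case 2
      then have "(j - 1) div 2 \<le> H" "j = 2 * ((j - 1) div 2) + 1 \<or> j = 2 * ((j - 1) div 2) + 2"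
        using ij unfolding h_def by linarith+
      with 2(1) have "(i, j) \<in> set (fwd ((j - 1) div 2))"
        unfolding fwd_def by auto
      then show ?thesis
        using fwd[OF \<open>(j - 1) div 2 \<le> H\<close>] by blast
    next
      case 3
      then show ?thesis
        using tail set_mono_sublist[OF sub_one] by (auto simp: tail_def)
    next
      case 4
      define k where "k = H - j div 2"
      have "k < H" "j = 2 * H + 1 - 2 * k \<or> j = 2 * H + 1 - 2 * k - 1"
        using 4 unfolding k_def by linarith+
      with 4(1) have "(i, j) \<in> set (bwd k)"
        unfolding bwd_def zig_def by auto
      then show ?thesis
        using bwd[OF \<open>k < H\<close>] by blast
    next
      case 5
      define k where "k = (i - 2) div 2"
      have "k < W" "i = 2 * k + 2 \<or> i = 2 * k + 3"
        using 5 unfolding k_def by linarith+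
      then have "(i, j) \<in> set (mid k)"
        using ij mid by auto
      then show ?thesis
        using set_mono_sublist[OF sub_mid[OF \<open>k < W\<close>]] by blast
    qed
    then show "p \<in> set ds"
      by (simp add: p)
  qed
qed

private lemma mid_row:
  assumes "1 < i" "i < 2 * W + 2"
  obtains k where "k < W" "i = 2 * k + 2 \<or> i = 2 * k + 3"
  using assms by (intro that[of "(i - 2) div 2"]) linarith+

text \<open>The sweep to the right and the way back both turn at \<open>(0, j)\<close>, one between
  the left edge and the edge down, the other between the right edge and the edge down. The parity of
  \<open>j\<close> decides which is which; in both cases the edge to \<open>(1, j)\<close>
  mediates.\<close>

private lemma linked_first_row:
  assumes "0 < j" "Suc j < h"
  shows "linked ds (0, j) (0, j - 1) (0, Suc j)"
proof -
  have pre: "sublist ((0, 0) # ds) (cyc ds)"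
    unfolding cyc_def last_ds by simp
  have down: "linked ds (0, j) (0, j - 1) (1, j) \<and> linked ds (0, j) (1, j) (0, Suc j)"
  proof (cases "odd j")
    case True
    then obtain k where j: "j = 2 * k + 1"
      by (elim oddE)
    have k: "k \<le> H"
      using assms j by (simp add: h_def)
    have "sublist ((if k = 0 then (0, 0) else last (fwd (k - 1))) # fwd k)
        ((0, 0) # concat (map fwd [0..<Suc H]) @ concat (map bwd [0..<H]) @ [(0, 1), (1, 1), (1, 0)] @
         concat (map mid [0..<W]) @ tail)"
      by (rule sublist_block_prev) (use k in \<open>auto simp: fwd_def\<close>)
    moreover have "(if k = 0 then (0, 0) else last (fwd (k - 1))) # fwd k =
        [(0, 2 * k), (0, j), (2 * W + 2, j)] @ [(2 * W + 2, 2 * k + 2), (0, 2 * k + 2)]"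
      by (auto simp: fwd_def j)
    ultimately have "sublist ([(0, 2 * k), (0, j), (2 * W + 2, j)] @
        [(2 * W + 2, 2 * k + 2), (0, 2 * k + 2)]) ((0, 0) # ds)"
      unfolding ds_eq by simp
    then have "sublist [(0, 2 * k), (0, j), (2 * W + 2, j)] (cyc ds)"
      by (rule sublist_order.order.trans[OF sublist_append_rightI sublist_order.order.trans[OF _ pre]])
    from linked_turn[OF this] have "linked ds (0, j) (0, j - 1) (1, j)"
      by (simp add: j)
    moreover have "sublist [(0, Suc j), (0, j), (1, j)] ds"
    proof (cases "k = 0")
      case True
      \<comment> \<open>In column 1 the way back makes no complete detour: it moves to row 1 and on
        to the first column.\<close>
      obtain us where us: "(0, 2 * H + 2) # concat (map bwd [0..<H]) = us @ [(0, 2)]"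
        using bwd_alternating by (metis append_butlast_last_id list.discI)
      have "concat (map fwd [0..<Suc H]) = (concat (map fwd [0..<H]) @
          [(0, 2 * H + 1), (2 * W + 2, 2 * H + 1), (2 * W + 2, 2 * H + 2)]) @ [(0, 2 * H + 2)]"
        by (simp add: fwd_def)
      then have "ds = (concat (map fwd [0..<H]) @
          [(0, 2 * H + 1), (2 * W + 2, 2 * H + 1), (2 * W + 2, 2 * H + 2)]) @
          ((0, 2 * H + 2) # concat (map bwd [0..<H])) @ [(0, 1), (1, 1), (1, 0)] @
          concat (map mid [0..<W]) @ tail"
        by (simp add: ds_eq del: upt_Suc)
      then have "ds = (concat (map fwd [0..<H]) @
          [(0, 2 * H + 1), (2 * W + 2, 2 * H + 1), (2 * W + 2, 2 * H + 2)] @ us) @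
          [(0, 2), (0, 1), (1, 1)] @ [(1, 0)] @ concat (map mid [0..<W]) @ tail"
        unfolding us by simp
      from sublist_eqI[OF this] show ?thesis
        by (simp add: j True numeral_2_eq_2)
    next
      case False
      \<comment> \<open>The detours of the way back are numbered from the right; number
        \<open>l\<close> crosses to row 1 in column \<open>j\<close>.\<close>
      define l where "l = H - k"
      have l: "l < H" "2 * H + 1 - 2 * l = j" "2 * H + 2 - 2 * l = Suc j"
        using k False by (auto simp: l_def j)
      have a: "sublist ((if l = 0 then (0, 2 * H + 2) else last (bwd (l - 1))) # bwd l)
        ((0, 2 * H + 2) # concat (map bwd [0..<H]) @ [(0, 1), (1, 1), (1, 0)] @
         concat (map mid [0..<W]) @ tail)"
        by (rule sublist_block_prev) (use l in \<open>auto simp: bwd_def zig_def\<close>)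
      have b: "(if l = 0 then (0, 2 * H + 2) else last (bwd (l - 1))) # bwd l =
        [(0, Suc j), (0, j), (1, j)] @ [(1, j - 1), (0, j - 1)]"
        using l by (cases l) (auto simp: bwd_def zig_def)
      have "concat (map fwd [0..<Suc H]) = (concat (map fwd [0..<H]) @
          [(0, 2 * H + 1), (2 * W + 2, 2 * H + 1), (2 * W + 2, 2 * H + 2)]) @ [(0, 2 * H + 2)]"
        by (simp add: fwd_def)
      then have "ds = (concat (map fwd [0..<H]) @
          [(0, 2 * H + 1), (2 * W + 2, 2 * H + 1), (2 * W + 2, 2 * H + 2)]) @
          ((0, 2 * H + 2) # concat (map bwd [0..<H]) @ [(0, 1), (1, 1), (1, 0)] @
          concat (map mid [0..<W]) @ tail)"
        by (simp add: ds_eq del: upt_Suc)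
      then have c: "sublist ((0, 2 * H + 2) # concat (map bwd [0..<H]) @ [(0, 1), (1, 1), (1, 0)] @
          concat (map mid [0..<W]) @ tail) ds"
        by (rule sublist_suffI)
      from sublist_order.order.trans[OF a[unfolded b] c] show ?thesis
        by (rule sublist_order.order.trans[OF sublist_append_rightI])
    qed
    from linked_sym[OF linked_turn[OF sublist_cyc[OF this]]]
    have "linked ds (0, j) (1, j) (0, Suc j)"
      by simp
    ultimately show ?thesis ..
  next
    case False
    then obtain k where j: "j = 2 * k + 2"
      using assms(1) by (metis evenE mult_Suc_right not0_implies_Suc add.commute mult_0_right not_gr_zero)
    have k: "k < H"
      using assms j by (simp add: h_def)
    obtain y ys where y: "concat (map bwd [0..<H]) @ [(0, 1), (1, 1), (1, 0)] @
        concat (map mid [0..<W]) @ tail = y # ys"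
      by (cases "concat (map bwd [0..<H])") auto
    have "sublist (fwd k @ [if Suc k < Suc H then hd (fwd (Suc k)) else y]) ds"
      unfolding ds_eq y by (rule sublist_block_next) (use k in \<open>auto simp: fwd_def\<close>)
    moreover have "fwd k @ [if Suc k < Suc H then hd (fwd (Suc k)) else y] =
        [(0, 2 * k + 1), (2 * W + 2, 2 * k + 1)] @ [(2 * W + 2, j), (0, j), (0, Suc j)]"
      using k by (auto simp: fwd_def j)
    ultimately have "sublist ([(0, 2 * k + 1), (2 * W + 2, 2 * k + 1)] @
        [(2 * W + 2, j), (0, j), (0, Suc j)]) ds"
      by simp
    then have "sublist [(2 * W + 2, j), (0, j), (0, Suc j)] (cyc ds)"
      by (intro sublist_cyc) (rule sublist_order.order.trans[OF sublist_append_leftI])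
    from linked_turn[OF this] have "linked ds (0, j) (1, j) (0, Suc j)"
      by simp
    moreover
    \<comment> \<open>The detour that crosses in column \<open>Suc j\<close> and returns to row 0 in
      column \<open>j\<close>.\<close>
    define l where "l = H - Suc k"
    have l: "l < H" "2 * H + 1 - 2 * l = Suc j" "Suc l < H \<Longrightarrow> 2 * H + 1 - 2 * Suc l = j - 1"
        "\<not> Suc l < H \<Longrightarrow> j = 2"
      using k by (auto simp: l_def j)
    have a: "sublist (bwd l @ [if Suc l < H then hd (bwd (Suc l)) else (0, 1)])
        (concat (map bwd [0..<H]) @ (0, 1) # [(1, 1), (1, 0)] @ concat (map mid [0..<W]) @ tail)"
      by (rule sublist_block_next) (use l in \<open>auto simp: bwd_def zig_def\<close>)
    have b: "bwd l @ [if Suc l < H then hd (bwd (Suc l)) else (0, 1)] =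
        [(0, Suc j), (1, Suc j)] @ [(1, j), (0, j), (0, j - 1)]"
      using l by (auto simp: bwd_def zig_def)
    have "ds = concat (map fwd [0..<Suc H]) @
        (concat (map bwd [0..<H]) @ (0, 1) # [(1, 1), (1, 0)] @ concat (map mid [0..<W]) @ tail)"
      by (simp add: ds_eq del: upt_Suc)
    then have c: "sublist (concat (map bwd [0..<H]) @ (0, 1) # [(1, 1), (1, 0)] @
        concat (map mid [0..<W]) @ tail) ds"
      by (rule sublist_suffI)
    from sublist_order.order.trans[OF a[unfolded b] c] have "sublist [(1, j), (0, j), (0, j - 1)] (cyc ds)"
      by (intro sublist_cyc) (rule sublist_order.order.trans[OF sublist_append_leftI])
    from linked_sym[OF linked_turn[OF this]] have "linked ds (0, j) (0, j - 1) (1, j)"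
      using assms(1) by (cases j) simp_all
    ultimately show ?thesis
      by simp
  qed
  then show ?thesis
    using linked_trans by blast
qed

private lemma linked_rows:
  assumes "i < w" "0 < j" "Suc j < h"
  shows "linked ds (i, j) (i, j - 1) (i, Suc j)"
proof -
  have tail: "joined (cyc ds) p q" if "sublist [p, q] tail" for p q
    using that sub_tail sublist_cyc sublist_order.order.trans unfolding joined_def by blast
  have "tail = [] @ [(2 * W + 2, 0), (2 * W + 2, 2 * H + 2)] @ [(1, 2 * H + 2), (1, 0), (0, 0)]"
    "tail = [(2 * W + 2, 0), (2 * W + 2, 2 * H + 2)] @ [(1, 2 * H + 2), (1, 0)] @ [(0, 0)]"
    by (simp_all add: tail_def)
  note tl = this[THEN sublist_eqI, THEN tail]
  consider "i = 0" | "i = 1" | "i = 2 * W + 2" | "1 < i" "i < 2 * W + 2"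
    using assms(1) unfolding w_def by linarith
  then show ?thesis
  proof cases
    case 1
    then show ?thesis
      using linked_first_row assms by simp
  next
    case 2
    then show ?thesis
      using tl(2) assms by (intro linked_row[of _ _ 0 "2 * H + 2"]) (auto simp: joined_commute h_def)
  next
    case 3
    then show ?thesis
      using tl(1) assms by (intro linked_row[of _ _ 0 "2 * H + 2"]) (auto simp: h_def)
  next
    case 4
    then obtain k where k: "k < W" "i = 2 * k + 2 \<or> i = 2 * k + 3"
      using mid_row by blast
    then show ?thesis
      using strand_links[OF sub_mid[OF k(1), unfolded mid_def] assms(2,3)] by blast
  qed
qed

text \<open>All pieces in the first column have length one. Each inner vertex of it has a turn to
  the edge above and a turn to the edge below, and both use the edge to column 1.\<close>

private lemma linked_first_col:
  assumes "0 < i" "Suc i < w"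
  shows "linked ds (i, 0) (i - 1, 0) (Suc i, 0)"
proof -
  have turn: "linked ds v (toward v p) (toward v q)" if "sublist [p, v, q] xs" "sublist xs ds"
    for p v q xs
    using that linked_turn sublist_cyc sublist_order.order.trans by metis
  obtain ts where tail: "tail = (2 * W + 2, 0) # ts"
    by (simp add: tail_def)
  consider "i = 1" | "1 < i" "i < 2 * W + 2"
    using assms unfolding w_def by linarith
  then show ?thesis
  proof cases
    case 1
    \<comment> \<open>Without middle strands the closing part itself begins in row 2.\<close>
    have "\<exists>zs. concat (map mid [0..<W]) @ tail = (2, 0) # zs"
    proof (cases "W = 0")
      case False
      then have "[0..<W] = 0 # [1..<W]"
        by (simp add: upt_conv_Cons)
      moreover obtain ys where "mid 0 = (2 * 0 + 2, 0) # ys"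
        unfolding mid_def using strand_Cons[OF h2] by blast
      ultimately show ?thesis
        by simp
    next
      case True
      then show ?thesis
        unfolding tail_def by simp
    qed
    then obtain zs where zs: "concat (map mid [0..<W]) @ tail = (2, 0) # zs"
      by blast
    have "ds = (concat (map fwd [0..<Suc H]) @ concat (map bwd [0..<H]) @ [(0, 1)]) @
        [(1, 1), (1, 0), (2, 0)] @ zs"
      unfolding ds_eq zs by simp
    from turn[OF _ sublist_eqI[OF this], of "(1, 1)" "(1, 0)" "(2, 0)"]
    have A: "linked ds (1, 0) (1, 1) (2, 0)"
      by (simp add: numeral_2_eq_2)
    have "tail = [(2 * W + 2, 0), (2 * W + 2, 2 * H + 2)] @
        [(1, 2 * H + 2), (1, 0), (0, 0)] @ []"
      by (simp add: tail_def)
    from turn[OF sublist_eqI[OF this] sub_tail] have B: "linked ds (1, 0) (1, 1) (0, 0)"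
      by simp
    from linked_trans[OF linked_sym[OF B] A] show ?thesis
      by (simp add: 1 numeral_2_eq_2)
  next
    case 2
    then obtain k where k: "k < W" "i = 2 * k + 2 \<or> i = 2 * k + 3"
      using mid_row by blast
    note sub = sub_mid[OF k(1)]
    obtain ys where ys: "mid k = (2 * k + 2, 0) # (2 * k + 2, 1) # ys"
      unfolding mid_def using strand_Cons2[OF h2 odd_h] by blast
    obtain zs where zs: "mid k = zs @ [(2 * k + 3, h - 1), (2 * k + 3, 0)]"
      unfolding mid_def using strand_snoc[OF h2] by blast
    have mid_ne: "mid l \<noteq> []" "last (mid l) = (2 * l + 3, 0)" "hd (mid l) = (2 * l + 2, 0)" for l
      by (simp_all add: mid_def strand_def)
    from k(2) show ?thesis
    proof
      assume i: "i = 2 * k + 2"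
      have a: "sublist ((if k = 0 then (1, 0) else last (mid (k - 1))) # mid k)
          ((1, 0) # concat (map mid [0..<W]) @ tail)"
        by (rule sublist_block_prev) (use k mid_ne in auto)
      have b: "(if k = 0 then (1, 0) else last (mid (k - 1))) # mid k =
          [(2 * k + 1, 0), (2 * k + 2, 0), (2 * k + 2, 1)] @ ys"
      proof -
        have "(if k = 0 then (1, 0) else last (mid (k - 1))) = (2 * k + 1, 0)"
          using mid_ne by (cases k) auto
        then show ?thesis
          unfolding ys by simp
      qed
      have c: "sublist ((1, 0) # concat (map mid [0..<W]) @ tail) ds"
        by (rule sublist_eqI[where us = "concat (map fwd [0..<Suc H]) @ concat (map bwd [0..<H]) @
          [(0, 1), (1, 1)]" and vs = "[]"]) (simp add: ds_eq del: upt_Suc)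
      from turn[OF sublist_append_rightI sublist_order.order.trans[OF a[unfolded b] c]] have
        A: "linked ds (2 * k + 2, 0) (2 * k + 1, 0) (2 * k + 2, 1)"
        by simp
      obtain x where "x > 0" "sublist [(2 * k + 3, 0), (2 * k + 2, 0), (2 * k + 2, x)] (mid k)"
        unfolding mid_def using strand_corners_col0(2)[OF h2 odd_h] by blast
      from turn[OF this(2) sub] this(1) have B: "linked ds (2 * k + 2, 0) (2 * k + 3, 0) (2 * k + 2, 1)"
        by (simp add: eval_nat_numeral)
      from linked_trans[OF A linked_sym[OF B]] show ?thesis
        by (simp add: i eval_nat_numeral)
    next
      assume i: "i = 2 * k + 3"
      have "sublist [(2 * k + 3, 1), (2 * k + 3, 0), (2 * k + 2, 0)] (mid k)"
        unfolding mid_def by (rule strand_corners_col0(1)[OF h2 odd_h])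
      from turn[OF this sub] have A: "linked ds (2 * k + 3, 0) (2 * k + 3, 1) (2 * k + 2, 0)"
        by (simp add: eval_nat_numeral)
      have a: "sublist (mid k @ [if Suc k < W then hd (mid (Suc k)) else (2 * W + 2, 0)])
          (concat (map mid [0..<W]) @ tail)"
        unfolding tail by (rule sublist_block_next) (use k mid_ne in auto)
      have b: "mid k @ [if Suc k < W then hd (mid (Suc k)) else (2 * W + 2, 0)] =
          zs @ [(2 * k + 3, 2 * H + 2), (2 * k + 3, 0), (2 * k + 4, 0)]"
      proof -
        have "(if Suc k < W then hd (mid (Suc k)) else (2 * W + 2, 0)) = (2 * k + 4, 0)"
          using k mid_ne by auto
        then show ?thesis
          unfolding zs h_pred by simp
      qed
      from turn[OF sublist_append_leftI sublist_order.order.trans[OF a[unfolded b] sub_mids]] have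
        B: "linked ds (2 * k + 3, 0) (2 * k + 3, 1) (2 * k + 4, 0)"
        by (simp add: add.commute)
      from linked_trans[OF linked_sym[OF A] B] show ?thesis
        by (simp add: i eval_nat_numeral)
    qed
  qed
qed

text \<open>The sweep provides a straight piece between row 0 and the last row in every column but
  the first, which is treated separately.\<close>

private lemma linked_cols:
  assumes "j < h" "0 < i" "Suc i < w"
  shows "linked ds (i, j) (i - 1, j) (Suc i, j)"
proof (cases "j = 0")
  case True
  then show ?thesis
    using linked_first_col assms by simp
next
  case False
  define k where "k = (j - 1) div 2"
  have k: "k \<le> H" "j = 2 * k + 1 \<or> j = 2 * k + 2"
    using assms False unfolding k_def h_def by linarith+
  have "fwd k = [] @ [(0, 2 * k + 1), (2 * W + 2, 2 * k + 1)] @ [(2 * W + 2, 2 * k + 2), (0, 2 * k + 2)]"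
    "fwd k = [(0, 2 * k + 1), (2 * W + 2, 2 * k + 1)] @ [(2 * W + 2, 2 * k + 2), (0, 2 * k + 2)] @ []"
    by (simp_all add: fwd_def)
  from this[THEN sublist_eqI] have "joined (fwd k) (0, j) (2 * W + 2, j)"
    using k(2) unfolding joined_def by blast
  then have "joined (cyc ds) (0, j) (2 * W + 2, j)"
    using joined_sublist[OF sublist_cyc[OF sub_fwd[OF k(1)]]] by blast
  then show ?thesis
    using assms by (intro linked_col) (auto simp: w_def)
qed

lemma odd_corners_good: "good_corners w h ds"
  unfolding good_corners_def using alternating_ds set_ds linked_rows linked_cols by blast

lemma odd_corners_length: "length ds + 4 = (w + 1) * (h + 1)"
  by (rule length_ds)

lemma odd_corners_last: "last ds = (0, 0)"
  by (rule last_ds)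

end

section \<open>Transposed corner lists\<close>

lemma toward_swap: "move b p q \<Longrightarrow> toward (prod.swap p) (prod.swap q) = prod.swap (toward p q)"
  by (cases p; cases q; cases b) auto

lemma between_swap: "between (prod.swap p) (prod.swap v) (prod.swap q) \<longleftrightarrow> between p v q"
  by (cases p; cases v; cases q) auto

lemma seg_swap: "move b p q \<Longrightarrow> seg (prod.swap p) (prod.swap q) = map prod.swap (seg p q)"
proof (induction p rule: seg_induct)
  case (last p)
  have "prod.swap p \<noteq> prod.swap q"
    using move_neq[OF last(1)] by (metis swap_swap)
  from seg_unfold[OF this] show ?case
    unfolding toward_swap[OF last(1)] last(2,3) by simp
next
  case (step p)
  have "prod.swap p \<noteq> prod.swap q"
    using move_neq[OF step(1)] by (metis swap_swap)
  from seg_unfold[OF this] show ?case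
    unfolding toward_swap[OF step(1)] step(3,4) by simp
qed

lemma trail_swap:
  "alternating b p qs \<Longrightarrow> trail (prod.swap p) (map prod.swap qs) = map prod.swap (trail p qs)"
proof (induction qs arbitrary: b p)
  case (Cons q qs)
  then have "move b p q" "alternating (\<not> b) q qs"
    by simp_all
  from seg_swap[OF this(1)] Cons.IH[OF this(2)] show ?case
    by (simp del: swap_simp)
qed simp

lemma alternating_swap:
  "alternating (\<not> b) (prod.swap p) (map prod.swap qs) \<longleftrightarrow> alternating b p qs"
proof (induction qs arbitrary: b p)
  case (Cons q qs)
  from move_swap[of b p q] Cons.IH[of "\<not> b" q] show ?case
    by (simp del: swap_simp)
qed simp

lemma corner_walk_swap:
  assumes "good_corners w h ds" "ds \<noteq> []"
  shows "corner_walk (map prod.swap ds) = map prod.swap (corner_walk ds)"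
proof -
  obtain b where "alternating b (last ds) ds"
    using assms(1) by (auto simp: good_corners_def)
  from trail_swap[OF this] show ?thesis
    using assms(2) by (simp add: corner_walk_def last_map)
qed

text \<open>Only for aligned points does \<open>toward\<close> commute with transposition. For a
  straight pass the alignment comes from \<open>between\<close>, for a turn from the alternation of
  the corner list.\<close>

lemma corner_link_swap:
  assumes "alternating c (last ds) (ds @ ds)" "ds \<noteq> []" "(a, b) \<in> corner_link ds v"
  shows "(prod.swap a, prod.swap b) \<in> corner_link (map prod.swap ds) (prod.swap v)"
proof -
  let ?s = "prod.swap :: point \<Rightarrow> point"
  obtain p q where pq: "a = toward v p" "b = toward v q"
    "between p v q \<and> sublist [p, q] (cyc ds) \<or> sublist [p, v, q] (cyc ds)"
    using assms(3) unfolding corner_link_def by blast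
  have cyc: "cyc (map ?s ds) = map ?s (cyc ds)"
    using assms(2) by (simp add: cyc_def last_map)
  have mv: "\<exists>c d. move c v p \<and> move d v q"
    using pq(3)
  proof
    assume "between p v q \<and> sublist [p, q] (cyc ds)"
    then show ?thesis
      using between_move move_sym by blast
  next
    assume "sublist [p, v, q] (cyc ds)"
    then obtain xs ys where "last ds # ds @ ds = xs @ [p, v, q] @ ys"
      by (auto simp: sublist_def cyc_def)
    from alternating_window[OF assms(1) this] show ?thesis
      using move_sym by blast
  qed
  then have ab: "?s a = toward (?s v) (?s p)" "?s b = toward (?s v) (?s q)"
    using toward_swap pq(1,2) by metis+
  have "sublist [p, q] (cyc ds) \<Longrightarrow> sublist [?s p, ?s q] (cyc (map ?s ds))"
    "sublist [p, v, q] (cyc ds) \<Longrightarrow> sublist [?s p, ?s v, ?s q] (cyc (map ?s ds))"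
    unfolding cyc using map_mono_sublist[of "[p, q]" "cyc ds" ?s]
      map_mono_sublist[of "[p, v, q]" "cyc ds" ?s] by simp_all
  then show ?thesis
    using pq(3) between_swap unfolding corner_link_def ab by blast
qed

lemma linked_swap:
  assumes "alternating c (last ds) (ds @ ds)" "ds \<noteq> []" "linked ds v a b"
  shows "linked (map prod.swap ds) (prod.swap v) (prod.swap a) (prod.swap b)"
  using assms(3) unfolding linked_def
proof (induction rule: rtrancl_induct)
  case (step x y)
  then have "(prod.swap x, prod.swap y) \<in> corner_link (map prod.swap ds) (prod.swap v) \<union>
      (corner_link (map prod.swap ds) (prod.swap v))\<inverse>"
    using corner_link_swap[OF assms(1,2)] by blast
  with step(3) show ?case
    by (rule rtrancl_into_rtrancl)
qed simp

lemma good_corners_swap: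
  assumes "good_corners w h ds" "ds \<noteq> []"
  shows "good_corners h w (map prod.swap ds)"
proof -
  let ?s = "prod.swap :: point \<Rightarrow> point"
  obtain c where c: "alternating c (last ds) ds" "even (length ds)"
    using assms(1) by (auto simp: good_corners_def)
  then have cc: "alternating c (last ds) (ds @ ds)"
    using assms(2) by (simp add: alternating_append)
  note swap = linked_swap[OF cc assms(2)]
  have "alternating (\<not> c) (last (map ?s ds)) (map ?s ds)"
    using alternating_swap[of c "last ds" ds] c(1) assms(2) by (simp add: last_map)
  moreover have "set (map ?s ds) = grid_verts h w"
    using assms(1) by (auto simp: good_corners_def grid_verts_def image_iff)
  moreover have "linked (map ?s ds) (i, j) (i, j - 1) (i, Suc j)"
    if "i < h" "0 < j" "Suc j < w" for i j
    using assms(1) that swap[of "(j, i)" "(j - 1, i)" "(Suc j, i)"] by (auto simp: good_corners_def)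
  moreover have "linked (map ?s ds) (i, j) (i - 1, j) (Suc i, j)"
    if "j < w" "0 < i" "Suc i < h" for i j
    using assms(1) that swap[of "(j, i)" "(j, i - 1)" "(j, Suc i)"] by (auto simp: good_corners_def)
  ultimately show ?thesis
    unfolding good_corners_def using c(2) length_map by metis
qed

section \<open>Structured programs for the random access machine\<close>

datatype com =
    Ops "instr list"
  | Seq com com (infixr \<open>;;\<close> 60)
  | While nat com
  | If nat com com

text \<open>Register \<open>0\<close> is reserved: it is set to \<open>1\<close> to make jumps unconditional.\<close>

fun csize :: "com \<Rightarrow> nat" where
  "csize (Ops is) = length is"
| "csize (c ;; d) = csize c + csize d"
| "csize (While r c) = csize c + 3"
| "csize (If r c d) = csize c + csize d + 3"

text \<open>Jump targets are absolute, so the address \<open>l\<close> of the code is a parameter. A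
  loop has its test behind the body and is entered there; in a branching the code of the alternative
  comes first.\<close>

fun compile :: "nat \<Rightarrow> com \<Rightarrow> instr list" where
  "compile l (Ops is) = is"
| "compile l (c ;; d) = compile l c @ compile (l + csize c) d"
| "compile l (While r c) =
     [SET 0 1, JPOS (l + 2 + csize c) 0] @ compile (l + 2) c @ [JPOS (l + 2) r]"
| "compile l (If r c d) =
     [JPOS (l + 3 + csize d) r] @ compile (l + 1) d @
     [SET 0 1, JPOS (l + 3 + csize d + csize c) 0] @ compile (l + 3 + csize d) c"

lemma length_compile [simp]: "length (compile l c) = csize c"
  by (induction c arbitrary: l) auto

type_synonym mem = "(nat \<Rightarrow> nat) \<times> nat list \<times> nat list"

fun conf :: "nat \<Rightarrow> mem \<Rightarrow> config" where
  "conf l (r, i, out) = \<lparr>pc = l, regs = r, in_tape = i, out_tape = out\<rparr>"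

fun jump :: "instr \<Rightarrow> bool" where
  "jump (JPOS l j) \<longleftrightarrow> True"
| "jump _ \<longleftrightarrow> False"

fun op :: "instr \<Rightarrow> mem \<Rightarrow> mem" where
  "op (SET i c) (r, t, out) = (r(i := c), t, out)"
| "op (ADD i j k) (r, t, out) = (r(i := r j + r k), t, out)"
| "op (SUB i j k) (r, t, out) = (r(i := r j - r k), t, out)"
| "op (LOAD i j) (r, t, out) = (r(i := r (r j)), t, out)"
| "op (STORE i j) (r, t, out) = (r(r i := r j), t, out)"
| "op (JPOS l j) m = m"
| "op (READ i) (r, t, out) = (r(i := (case t of [] \<Rightarrow> 0 | x # _ \<Rightarrow> x)), tl t, out)"
| "op (PRINT i) (r, t, out) = (r, t, out @ [r i])"

lemma exec_conf: "\<not> jump i \<Longrightarrow> exec i (conf l m) = conf (Suc l) (op i m)"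
  by (cases m; cases i) auto

abbreviation reg :: "mem \<Rightarrow> nat \<Rightarrow> nat" where
  "reg m \<equiv> fst m"

text \<open>The time is the exact number of machine steps, with jumps included. \<open>loops\<close>
  describes executions that begin at the test behind the loop body. Assignments to register 0 appear
  where an unconditional jump is compiled.\<close>

inductive runs :: "com \<Rightarrow> mem \<Rightarrow> nat \<Rightarrow> mem \<Rightarrow> bool"
  and loops :: "nat \<Rightarrow> com \<Rightarrow> mem \<Rightarrow> nat \<Rightarrow> mem \<Rightarrow> bool" where
  Ops: "\<forall>i \<in> set is. \<not> jump i \<Longrightarrow> runs (Ops is) m (length is) (fold op is m)"
| Seq: "runs c m t m' \<Longrightarrow> runs d m' u m'' \<Longrightarrow> runs (c ;; d) m (t + u) m''"
| While: "loops r c (op (SET 0 1) m) t m' \<Longrightarrow> runs (While r c) m (t + 2) m'"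
| IfT: "reg m r > 0 \<Longrightarrow> runs c m t m' \<Longrightarrow> runs (If r c d) m (t + 1) m'"
| IfF: "reg m r = 0 \<Longrightarrow> runs d m t m' \<Longrightarrow> runs (If r c d) m (t + 3) (op (SET 0 1) m')"
| Done: "reg m r = 0 \<Longrightarrow> loops r c m 1 m"
| Step: "reg m r > 0 \<Longrightarrow> runs c m t m' \<Longrightarrow> loops r c m' u m'' \<Longrightarrow> loops r c m (1 + t + u) m''"

definition code_at :: "instr list \<Rightarrow> nat \<Rightarrow> instr list \<Rightarrow> bool" where
  "code_at P l is \<longleftrightarrow> (\<exists>xs ys. P = xs @ is @ ys \<and> length xs = l)"

lemma code_at_append:
  "code_at P l (is @ js) \<longleftrightarrow> code_at P l is \<and> code_at P (l + length is) js"
proof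
  assume "code_at P l (is @ js)"
  then obtain xs ys where P: "P = xs @ (is @ js) @ ys" "length xs = l"
    by (auto simp: code_at_def)
  then have "P = xs @ is @ (js @ ys)" "P = (xs @ is) @ js @ ys" "length (xs @ is) = l + length is"
    by simp_all
  with P(2) show "code_at P l is \<and> code_at P (l + length is) js"
    unfolding code_at_def by blast
next
  assume "code_at P l is \<and> code_at P (l + length is) js"
  then obtain xs ys xs' ys' where "P = xs @ is @ ys" "length xs = l"
    "P = xs' @ js @ ys'" "length xs' = l + length is"
    unfolding code_at_def by blast
  moreover from this have "xs' = xs @ is"
    by (metis append.assoc append_eq_append_conv length_append)
  ultimately show "code_at P l (is @ js)"
    unfolding code_at_def by auto
qed

lemma code_at_Cons:
  "code_at P l (i # is) \<longleftrightarrow> l < length P \<and> P ! l = i \<and> code_at P (Suc l) is"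
proof -
  have "code_at P l [i] \<longleftrightarrow> l < length P \<and> P ! l = i"
    unfolding code_at_def
    by (auto simp: nth_append) (metis id_take_nth_drop length_take min.absorb4 append_Cons append_Nil)
  then show ?thesis
    using code_at_append[of P l "[i]" "is"] by simp
qed

abbreviation reaches :: "instr list \<Rightarrow> config \<Rightarrow> nat \<Rightarrow> config \<Rightarrow> bool" where
  "reaches P s t s' \<equiv> (ram_step P ^^ t) s = s'"

lemma reaches_trans: "reaches P s t s' \<Longrightarrow> reaches P s' u s'' \<Longrightarrow> reaches P s (t + u) s''"
  by (subst add.commute) (simp add: funpow_add)

lemma reaches_step: "l < length P \<Longrightarrow> reaches P (conf l m) 1 (exec (P ! l) (conf l m))"
  by (cases m) (simp add: ram_step_def halted_def)

lemma reaches_set: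
  "l < length P \<Longrightarrow> P ! l = SET 0 1 \<Longrightarrow> reaches P (conf l m) 1 (conf (Suc l) (op (SET 0 1) m))"
  using reaches_step[of l P m] exec_conf[of "SET 0 1"] by simp

lemma reaches_jump:
  "l < length P \<Longrightarrow> P ! l = JPOS k r \<Longrightarrow>
   reaches P (conf l m) 1 (conf (if reg m r > 0 then k else Suc l) m)"
  using reaches_step[of l P m] by (cases m) simp

lemma runs_compile:
  "runs c m t m' \<Longrightarrow> code_at P l (compile l c) \<Longrightarrow> reaches P (conf l m) t (conf (l + csize c) m')"
  "loops r c m t m' \<Longrightarrow> code_at P l (compile l c @ [JPOS l r]) \<Longrightarrow>
   reaches P (conf (l + csize c) m) t (conf (l + csize c + 1) m')"
proof (induction arbitrary: l and l rule: runs_loops.inducts)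
  case (Ops "is" m)
  then show ?case
  proof (induction "is" arbitrary: l m)
    case (Cons i "is")
    from Cons.prems have i: "l < length P" "P ! l = i" "code_at P (Suc l) is" "\<not> jump i"
      by (auto simp: code_at_Cons)
    have "reaches P (conf l m) 1 (conf (Suc l) (op i m))"
      using reaches_step[OF i(1), of m] exec_conf[OF i(4)] i(2) by simp
    moreover have "reaches P (conf (Suc l) (op i m)) (length is) (conf (Suc l + csize (Ops is)) (fold op is (op i m)))"
      using Cons i(3) by simp
    ultimately show ?case
      using reaches_trans by fastforce
  qed simp
next
  case (Seq c m t m' d u m'')
  from Seq.prems have "code_at P l (compile l c)" "code_at P (l + csize c) (compile (l + csize c) d)"
    by (simp_all add: code_at_append)
  from reaches_trans[OF Seq.IH(1)[OF this(1)] Seq.IH(2)[OF this(2)]] show ?case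
    by (simp add: add.assoc)
next
  case (While r c m t m')
  have a: "reaches P (conf l m) 1 (conf (Suc l) (op (SET 0 1) m))"
    using While.prems by (intro reaches_set) (simp_all add: code_at_Cons)
  have b: "reaches P (conf (Suc l) (op (SET 0 1) m)) 1 (conf (l + 2 + csize c) (op (SET 0 1) m))"
    using reaches_jump[of "Suc l" P "l + 2 + csize c" 0 "op (SET 0 1) m"] While.prems
    by (cases m) (simp add: code_at_Cons)
  have c: "reaches P (conf (l + 2 + csize c) (op (SET 0 1) m)) t (conf (l + 2 + csize c + 1) m')"
    using While.prems by (intro While.IH) (simp add: code_at_Cons)
  from reaches_trans[OF reaches_trans[OF a b] c] show ?case
    by (simp add: add.commute add.left_commute numeral_3_eq_3)
next
  case (IfT m r c t m' d)
  have a: "reaches P (conf l m) 1 (conf (l + 3 + csize d) m)"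
    using reaches_jump[of l P "l + 3 + csize d" r m] IfT by (simp add: code_at_Cons)
  have b: "reaches P (conf (l + 3 + csize d) m) t (conf (l + 3 + csize d + csize c) m')"
    using IfT.prems by (intro IfT.IH) (simp add: code_at_Cons code_at_append numeral_3_eq_3)
  from reaches_trans[OF a b] show ?case
    by (simp add: add.commute add.left_commute)
next
  case (IfF m r d t m' c)
  have a: "reaches P (conf l m) 1 (conf (l + 1) m)"
    using reaches_jump[of l P "l + 3 + csize d" r m] IfF by (simp add: code_at_Cons)
  have b: "reaches P (conf (l + 1) m) t (conf (l + 1 + csize d) m')"
    using IfF.prems by (intro IfF.IH) (simp add: code_at_Cons code_at_append)
  have c: "reaches P (conf (l + 1 + csize d) m') 1 (conf (l + 2 + csize d) (op (SET 0 1) m'))"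
    using reaches_set[of "l + 1 + csize d" P m'] IfF.prems
    by (simp add: code_at_Cons code_at_append)
  have d: "reaches P (conf (l + 2 + csize d) (op (SET 0 1) m')) 1
      (conf (l + 3 + csize d + csize c) (op (SET 0 1) m'))"
    using reaches_jump[of "l + 2 + csize d" P "l + 3 + csize d + csize c" 0 "op (SET 0 1) m'"] IfF.prems
    by (cases m') (simp add: code_at_Cons code_at_append)
  from reaches_trans[OF reaches_trans[OF reaches_trans[OF a b] c] d] show ?case
    by (simp add: add.commute add.left_commute numeral_3_eq_3)
next
  case (Done m r c)
  then show ?case
    using reaches_jump[of "l + csize c" P l r m] by (simp add: code_at_append code_at_Cons)
next
  case (Step m r c t m' u m'')
  have a: "reaches P (conf (l + csize c) m) 1 (conf l m)"
    using reaches_jump[of "l + csize c" P l r m] Step by (simp add: code_at_append code_at_Cons)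
  have b: "reaches P (conf l m) t (conf (l + csize c) m')"
    using Step.prems by (intro Step.IH) (simp add: code_at_append)
  from reaches_trans[OF reaches_trans[OF a b] Step.IH(2)[OF Step.prems]] show ?case .
qed

section \<open>Total correctness with time bounds\<close>

definition achieves :: "(mem \<Rightarrow> bool) \<Rightarrow> com \<Rightarrow> nat \<Rightarrow> (mem \<Rightarrow> bool) \<Rightarrow> bool" where
  "achieves P c B Q \<longleftrightarrow> (\<forall>m. P m \<longrightarrow> (\<exists>t \<le> B. \<exists>m'. runs c m t m' \<and> Q m'))"

lemma achieves_Ops:
  assumes "\<forall>i \<in> set is. \<not> jump i" "length is = B" "\<And>m. P m \<Longrightarrow> Q (fold op is m)"
  shows "achieves P (Ops is) B Q"
  using assms runs_loops.Ops unfolding achieves_def by blast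

lemma achieves_Seq:
  assumes "achieves P c B Q" "achieves Q d C R"
  shows "achieves P (c ;; d) (B + C) R"
  using assms runs_loops.Seq unfolding achieves_def by (meson add_mono)

lemma achieves_weaken:
  assumes "achieves P c B Q" "B \<le> C" "\<And>m. P' m \<Longrightarrow> P m" "\<And>m. Q m \<Longrightarrow> Q' m"
  shows "achieves P' c C Q'"
  using assms unfolding achieves_def by (meson le_trans)

text \<open>The alternative pays three instructions: the failed test, and the two that jump over the
  other branch. These overwrite register 0, which its postcondition anticipates.\<close>

lemma achieves_If:
  assumes "achieves (\<lambda>m. P m \<and> reg m r > 0) c B Q"
    and "achieves (\<lambda>m. P m \<and> reg m r = 0) d B (\<lambda>m. Q (op (SET 0 1) m))"
  shows "achieves P (If r c d) (B + 3) Q"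
  unfolding achieves_def
proof (intro allI impI)
  fix m assume m: "P m"
  show "\<exists>t\<le>B + 3. \<exists>m'. runs (If r c d) m t m' \<and> Q m'"
  proof (cases "reg m r > 0")
    case True
    then obtain t m' where "t \<le> B" "runs c m t m'" "Q m'"
      using assms(1) m unfolding achieves_def by blast
    then show ?thesis
      using IfT[OF True, of c t m' d] by (intro exI[of _ "t + 1"] conjI exI[of _ m']) simp_all
  next
    case False
    then have 0: "reg m r = 0"
      by simp
    then obtain t m' where "t \<le> B" "runs d m t m'" "Q (op (SET 0 1) m')"
      using assms(2) m unfolding achieves_def by blast
    then show ?thesis
      using IfF[OF 0, of d t m' c]
      by (intro exI[of _ "t + 3"] conjI exI[of _ "op (SET 0 1) m'"]) simp_all
  qed
qed

text \<open>The number of iterations is known beforehand, so an invariant indexed by the iteration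
  gives termination and time at once. The 3 counts the two instructions on entry and the final
  test.\<close>

lemma achieves_While:
  assumes "\<And>m. P m \<Longrightarrow> I 0 (op (SET 0 1) m)"
    and cond: "\<And>k m. k \<le> n \<Longrightarrow> I k m \<Longrightarrow> reg m r > 0 \<longleftrightarrow> k < n"
    and body: "\<And>k. k < n \<Longrightarrow> achieves (I k) c (B k) (I (Suc k))"
  shows "achieves P (While r c) ((\<Sum>k<n. B k + 1) + 3) (I n)"
proof -
  \<comment> \<open>Here \<open>l\<close> is the number of iterations still to come.\<close>
  have loop: "\<exists>t \<le> (\<Sum>k=n-l..<n. B k + 1) + 1. \<exists>m'. loops r c m t m' \<and> I n m'"
    if "l \<le> n" "I (n - l) m" for l m
    using that
  proof (induction l arbitrary: m)
    case 0
    then show ?case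
      using cond[of n m] Done[of m r c] by (intro exI[of _ 1] conjI exI[of _ m]) simp_all
  next
    case (Suc l)
    let ?k = "n - Suc l"
    have k: "?k < n" "Suc ?k = n - l"
      using Suc.prems by auto
    obtain t m' where t: "t \<le> B ?k" "runs c m t m'" "I (n - l) m'"
      using body[OF k(1)] Suc.prems(2) k(2) unfolding achieves_def by metis
    obtain u m'' where u: "u \<le> (\<Sum>k=n-l..<n. B k + 1) + 1" "loops r c m' u m''" "I n m''"
      using Suc.IH[OF _ t(3)] Suc.prems(1) by auto
    have "reg m r > 0"
      using cond[OF _ Suc.prems(2)] k(1) by simp
    from Step[OF this t(2) u(2)] have "loops r c m (1 + t + u) m''" .
    moreover have "(\<Sum>k=?k..<n. B k + 1) = B ?k + 1 + (\<Sum>k=n-l..<n. B k + 1)"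
      using k by (simp add: sum.atLeast_Suc_lessThan)
    ultimately show ?case
      using t(1) u(1,3) by (intro exI[of _ "1 + t + u"] conjI exI[of _ m'']) simp_all
  qed
  show ?thesis
    unfolding achieves_def
  proof (intro allI impI)
    fix m assume "P m"
    then have "I (n - n) (op (SET 0 1) m)"
      using assms(1) by simp
    from loop[OF order_refl this] obtain t m'
      where "t \<le> (\<Sum>k=0..<n. B k + 1) + 1" "loops r c (op (SET 0 1) m) t m'" "I n m'"
      unfolding diff_self_eq_0 by blast
    then show "\<exists>t\<le>(\<Sum>k<n. B k + 1) + 3. \<exists>m'. runs (While r c) m t m' \<and> I n m'"
      using While[of r c m t m']
      by (intro exI[of _ "t + 2"] conjI exI[of _ m']) (simp_all add: atLeast0LessThan)
  qed
qed

lemma achieves_computes: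
  assumes "achieves (\<lambda>m. m = ((\<lambda>_. 0), xs, [])) c T (\<lambda>m. snd (snd m) = ys)"
  shows "computes_within (compile 0 c) xs ys T"
proof -
  obtain t m where t: "t \<le> T" "runs c ((\<lambda>_. 0), xs, []) t m" "snd (snd m) = ys"
    using assms unfolding achieves_def by auto
  let ?P = "compile 0 c"
  have "code_at ?P 0 ?P"
    by (auto simp: code_at_def)
  from runs_compile(1)[OF t(2) this]
  have r: "(ram_step ?P ^^ t) (initial xs) = conf (csize c) m"
    by (simp add: initial_def)
  have h: "halted ?P (conf (csize c) m)"
    by (cases m) (simp add: halted_def)
  \<comment> \<open>A halted machine keeps its configuration, so halting before step
    \<open>T\<close> is enough.\<close>
  have "(ram_step ?P ^^ k) (conf (csize c) m) = conf (csize c) m" for k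
    by (induction k) (use h in \<open>simp_all add: ram_step_def\<close>)
  then have "(ram_step ?P ^^ T) (initial xs) = conf (csize c) m"
    using t(1) r by (metis funpow_add le_add_diff_inverse2 comp_apply)
  then show ?thesis
    using h t(3) by (cases m) (simp add: computes_within_def)
qed

section \<open>The program\<close>

fun enc :: "bool \<Rightarrow> point \<Rightarrow> nat list" where
  "enc e (i, j) = (if e then [j, i] else [i, j])"

definition printed :: "bool \<Rightarrow> point list \<Rightarrow> nat list" where
  "printed e vs = concat (map (enc e) vs)"

lemma printed_simps [simp]:
  "printed e [] = []" "printed e (v # vs) = enc e v @ printed e vs" "printed e (vs @ us) = printed e vs @ printed e us"
  by (simp_all add: printed_def)

lemma encode_walk_printed:
  "encode_walk vs = printed False vs" "encode_walk (map prod.swap vs) = printed True vs"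
  unfolding encode_walk_def printed_def by (induction vs) auto

lemma seg_row:
  "seg (i, j) (i, j + n) = map (\<lambda>k. (i, j + k)) [0..<n]"
  "seg (i, j + n) (i, j) = map (\<lambda>k. (i, j + n - k)) [0..<n]"
proof -
  show "seg (i, j) (i, j + n) = map (\<lambda>k. (i, j + k)) [0..<n]"
  proof (induction n arbitrary: j)
    case (Suc n)
    from Suc[of "Suc j"] show ?case
      by (subst seg_unfold) (simp_all add: upt_conv_Cons map_Suc_upt [symmetric] del: upt_Suc)
  qed simp
  show "seg (i, j + n) (i, j) = map (\<lambda>k. (i, j + n - k)) [0..<n]"
  proof (induction n)
    case (Suc n)
    then show ?case
      by (subst seg_unfold) (simp_all add: upt_conv_Cons map_Suc_upt [symmetric] del: upt_Suc)
  qed simp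
qed

lemma seg_col:
  "seg (i, j) (i + n, j) = map (\<lambda>k. (i + k, j)) [0..<n]"
  "seg (i + n, j) (i, j) = map (\<lambda>k. (i + n - k, j)) [0..<n]"
proof -
  show "seg (i, j) (i + n, j) = map (\<lambda>k. (i + k, j)) [0..<n]"
  proof (induction n arbitrary: i)
    case (Suc n)
    from Suc[of "Suc i"] show ?case
      by (subst seg_unfold) (simp_all add: upt_conv_Cons map_Suc_upt [symmetric] del: upt_Suc)
  qed simp
  show "seg (i + n, j) (i, j) = map (\<lambda>k. (i + n - k, j)) [0..<n]"
  proof (induction n)
    case (Suc n)
    then show ?case
      by (subst seg_unfold) (simp_all add: upt_conv_Cons map_Suc_upt [symmetric] del: upt_Suc)
  qed simp
qed

text \<open>
  Registers \<open>3\<close> and \<open>4\<close> hold the current row and column, \<open>5\<close> the remaining distance of a straight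
  piece, \<open>6\<close> to \<open>8\<close> the constants \<open>1\<close>, \<open>2\<close> and \<open>0\<close>, \<open>9\<close> and \<open>10\<close> the last row and column, \<open>11\<close> and \<open>12\<close>
  the rows of the current strand, \<open>13\<close> and \<open>14\<close> columns to turn at, \<open>15\<close> and \<open>16\<close> the numbers
  \<open>2 - h mod 2\<close> and \<open>2 - w mod 2\<close>, and \<open>17\<close> the condition of the current loop or branch. The flag
  \<open>e\<close> exchanges the coordinates of the printed vertices.
\<close>

definition emit :: "bool \<Rightarrow> instr list" where
  "emit e = (if e then [PRINT 4, PRINT 3] else [PRINT 3, PRINT 4])"

definition mov :: "bool \<Rightarrow> nat \<Rightarrow> nat \<Rightarrow> com" where
  "mov e x t =
     Ops [SUB 5 t x] ;;
     While 5 (Ops (emit e @ [ADD x x 6, SUB 5 t x])) ;;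
     Ops [SUB 5 x t] ;;
     While 5 (Ops (emit e @ [SUB x x 6, SUB 5 x t]))"

lemma emit_simps:
  "length (emit e) = 2" "i \<in> set (emit e) \<Longrightarrow> \<not> jump i"
  "fold op (emit e) (f, t, o') = (f, t, o' @ enc e (f 3, f 4))"
  by (auto simp: emit_def split: if_splits)

abbreviation pos :: "(nat \<Rightarrow> nat) \<Rightarrow> nat \<Rightarrow> nat \<Rightarrow> point" where
  "pos f x a \<equiv> ((f(x := a)) 3, (f(x := a)) 4)"

text \<open>Truncated subtraction lets at most one of the two loops run, the one in the direction of
  the move. An iteration costs four instructions and a test; the 8 consists of two instructions and
  two loop overheads of 3.\<close>

lemma mov_achieves:
  fixes f :: "nat \<Rightarrow> nat"
  assumes f: "f 0 = 1" "f 5 = 0" "f 6 = 1" and x: "x = 3 \<or> x = 4" and t: "t \<notin> {0, 3, 4, 5}"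
  shows "achieves (\<lambda>m. m = (f, inp, o')) (mov e x t) (5 * length (seg (f 3, f 4) (pos f x (f t))) + 8)
    (\<lambda>m. m = (f(x := f t), inp, o' @ printed e (seg (f 3, f 4) (pos f x (f t)))))"
proof -
  let ?a = "f x" and ?b = "f t"
  define n where "n = ?b - ?a"
  define l where "l = ?a - ?b"
  define up where "up k = o' @ printed e (map (\<lambda>k. pos f x (?a + k)) [0..<k])" for k
  define dn where "dn k = up n @ printed e (map (\<lambda>k. pos f x (?a - k)) [0..<k])" for k
  have ne: "x \<noteq> 0" "x \<noteq> 5" "x \<noteq> 6" "t \<noteq> x" "t \<noteq> 5" "t \<noteq> 0"
    using x t by auto
  have up_Suc: "up (Suc k) = up k @ enc e (pos f x (?a + k))" for k
    by (simp add: up_def)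
  have dn_Suc: "dn (Suc k) = dn k @ enc e (pos f x (?a - k))" for k
    by (simp add: dn_def)
  have s1: "achieves (\<lambda>m. m = (f, inp, o')) (Ops [SUB 5 t x]) 1 (\<lambda>m. m = (f(5 := n), inp, o'))"
    by (rule achieves_Ops) (simp_all add: n_def)
  have s2: "achieves (\<lambda>m. m = (f(5 := n), inp, o'))
      (While 5 (Ops (emit e @ [ADD x x 6, SUB 5 t x])))
      ((\<Sum>k<n. 4 + 1) + 3) (\<lambda>m. m = (f(x := ?a + n, 5 := n - n), inp, up n))"
  proof (rule achieves_While[where I = "\<lambda>k m. m = (f(x := ?a + k, 5 := n - k), inp, up k)"])
    fix k assume "k < n"
    show "achieves (\<lambda>m. m = (f(x := ?a + k, 5 := n - k), inp, up k))
      (Ops (emit e @ [ADD x x 6, SUB 5 t x])) 4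
      (\<lambda>m. m = (f(x := ?a + Suc k, 5 := n - Suc k), inp, up (Suc k)))"
    proof (rule achieves_Ops)
      fix m assume "m = (f(x := ?a + k, 5 := n - k), inp, up k)"
      then show "fold op (emit e @ [ADD x x 6, SUB 5 t x]) m =
          (f(x := ?a + Suc k, 5 := n - Suc k), inp, up (Suc k))"
        using ne f x by (auto simp: emit_simps(3) up_Suc n_def fun_eq_iff)
    qed (use emit_simps(1,2) in auto)
  qed (use ne f in \<open>auto simp: up_def fun_eq_iff\<close>)
  have s3: "achieves (\<lambda>m. m = (f(x := ?a + n, 5 := n - n), inp, up n)) (Ops [SUB 5 x t]) 1
      (\<lambda>m. m = (f(x := ?a + n, 5 := l), inp, up n))"
    by (rule achieves_Ops) (use ne in \<open>auto simp: l_def n_def fun_eq_iff\<close>)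
  have s4: "achieves (\<lambda>m. m = (f(x := ?a + n, 5 := l), inp, up n))
      (While 5 (Ops (emit e @ [SUB x x 6, SUB 5 x t])))
      ((\<Sum>k<l. 4 + 1) + 3) (\<lambda>m. m = (f(x := ?a + n - l, 5 := l - l), inp, dn l))"
  proof (rule achieves_While[where I = "\<lambda>k m. m = (f(x := ?a + n - k, 5 := l - k), inp, dn k)"])
    fix k assume "k < l"
    then have k: "n = 0" "k < ?a - ?b"
      by (auto simp: l_def n_def)
    show "achieves (\<lambda>m. m = (f(x := ?a + n - k, 5 := l - k), inp, dn k))
      (Ops (emit e @ [SUB x x 6, SUB 5 x t])) 4
      (\<lambda>m. m = (f(x := ?a + n - Suc k, 5 := l - Suc k), inp, dn (Suc k)))"
    proof (rule achieves_Ops)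
      fix m assume "m = (f(x := ?a + n - k, 5 := l - k), inp, dn k)"
      then show "fold op (emit e @ [SUB x x 6, SUB 5 x t]) m =
          (f(x := ?a + n - Suc k, 5 := l - Suc k), inp, dn (Suc k))"
        using ne f x k by (auto simp: emit_simps(3) dn_Suc l_def fun_eq_iff)
    qed (use emit_simps(1,2) in auto)
  qed (use ne f in \<open>auto simp: dn_def fun_eq_iff\<close>)
  \<comment> \<open>One of \<open>n\<close> and \<open>l\<close> is 0, so the truncated expression
    equals the target, and register 5 is back to 0 as \<open>f\<close> requires.\<close>
  have fin: "f(x := ?a + n - l, 5 := l - l) = f(x := ?b)"
    using f ne by (auto simp: fun_eq_iff l_def n_def)
  have sg: "seg (f 3, f 4) (pos f x ?b) =
      map (\<lambda>k. pos f x (?a + k)) [0..<n] @ map (\<lambda>k. pos f x (?a - k)) [0..<l]"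
  proof (cases "?a \<le> ?b")
    case True
    then have "l = 0" "?b = ?a + n"
      by (simp_all add: l_def n_def)
    then show ?thesis
      using x seg_row(1)[of "f 3" "f 4" n] seg_col(1)[of "f 3" "f 4" n] by auto
  next
    case False
    then have "n = 0" "?a = ?b + l"
      by (simp_all add: l_def n_def)
    then show ?thesis
      using x seg_row(2)[of "f 3" ?b l] seg_col(2)[of ?b l "f 4"] by auto
  qed
  have "dn l = o' @ printed e (seg (f 3, f 4) (pos f x ?b))"
    unfolding sg by (simp add: dn_def up_def)
  moreover have "length (seg (f 3, f 4) (pos f x ?b)) = n + l"
    unfolding sg by simp
  ultimately show ?thesis
    using achieves_Seq[OF s1 achieves_Seq[OF s2 achieves_Seq[OF s3 s4]]]
    unfolding mov_def fin by (simp add: algebra_simps)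
qed

section \<open>Symbolic execution on an explicit list of registers\<close>

definition list_mem :: "nat list \<Rightarrow> nat list \<Rightarrow> mem" where
  "list_mem L o' = (\<lambda>k. if k < length L then L ! k else 0, [], o')"

lemma list_mem_upd:
  "i < length L \<Longrightarrow> (\<lambda>k. if k < length L then L ! k else 0)(i := v) =
     (\<lambda>k. if k < length (L[i := v]) then L[i := v] ! k else 0)"
  by (auto simp: fun_eq_iff)

lemma op_list_mem:
  "i < length L \<Longrightarrow> op (SET i c) (list_mem L o') = list_mem (L[i := c]) o'"
  "i < length L \<Longrightarrow> j < length L \<Longrightarrow> k < length L \<Longrightarrow>
    op (ADD i j k) (list_mem L o') = list_mem (L[i := L ! j + L ! k]) o'"
  "i < length L \<Longrightarrow> j < length L \<Longrightarrow> k < length L \<Longrightarrow>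
    op (SUB i j k) (list_mem L o') = list_mem (L[i := L ! j - L ! k]) o'"
  unfolding list_mem_def by (simp_all add: list_mem_upd del: length_list_update)

lemma reg_list_mem: "k < length L \<Longrightarrow> reg (list_mem L o') k = L ! k"
  by (simp add: list_mem_def)

lemma list_update_numeral: "(x # xs)[numeral k := v] = x # xs[pred_numeral k := v]"
  by (simp add: numeral_eq_Suc)

lemma mov_list_mem:
  assumes "length L = 18" "L ! 0 = 1" "L ! 5 = 0" "L ! 6 = 1" "t < 18" "t \<notin> {0, 3, 4, 5}"
  shows "achieves (\<lambda>m. m = list_mem L o') (mov e 3 t) (5 * length (seg (L ! 3, L ! 4) (L ! t, L ! 4)) + 8)
      (\<lambda>m. m = list_mem (L[3 := L ! t]) (o' @ printed e (seg (L ! 3, L ! 4) (L ! t, L ! 4))))"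
    and "achieves (\<lambda>m. m = list_mem L o') (mov e 4 t) (5 * length (seg (L ! 3, L ! 4) (L ! 3, L ! t)) + 8)
      (\<lambda>m. m = list_mem (L[4 := L ! t]) (o' @ printed e (seg (L ! 3, L ! 4) (L ! 3, L ! t))))"
proof -
  let ?f = "\<lambda>k. if k < length L then L ! k else 0"
  have f: "?f 0 = 1" "?f 5 = 0" "?f 6 = 1"
    using assms by simp_all
  note mv = mov_achieves[where f = ?f, OF f _ assms(6)]
  have u: "?f(3 := ?f t) = (\<lambda>k. if k < length (L[3 := L ! t]) then L[3 := L ! t] ! k else 0)"
    "?f(4 := ?f t) = (\<lambda>k. if k < length (L[4 := L ! t]) then L[4 := L ! t] ! k else 0)"
    using assms(1,5) by (auto simp: fun_eq_iff)
  show "achieves (\<lambda>m. m = list_mem L o') (mov e 3 t) (5 * length (seg (L ! 3, L ! 4) (L ! t, L ! 4)) + 8)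
      (\<lambda>m. m = list_mem (L[3 := L ! t]) (o' @ printed e (seg (L ! 3, L ! 4) (L ! t, L ! 4))))"
    using mv[of 3 "[]" o' e] assms(1,5) unfolding list_mem_def u by simp
  show "achieves (\<lambda>m. m = list_mem L o') (mov e 4 t) (5 * length (seg (L ! 3, L ! 4) (L ! 3, L ! t)) + 8)
      (\<lambda>m. m = list_mem (L[4 := L ! t]) (o' @ printed e (seg (L ! 3, L ! 4) (L ! 3, L ! t))))"
    using mv[of 4 "[]" o' e] assms(1,5) unfolding list_mem_def u by simp
qed

lemma trail_concat:
  assumes "\<And>k. k < n \<Longrightarrow> last (P k # f k) = P (Suc k)"
  shows "trail (P 0) (concat (map f [0..<n])) = concat (map (\<lambda>k. trail (P k) (f k)) [0..<n]) \<and>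
    last (P 0 # concat (map f [0..<n])) = P n"
  using assms
proof (induction n)
  case (Suc n)
  then have IH: "trail (P 0) (concat (map f [0..<n])) = concat (map (\<lambda>k. trail (P k) (f k)) [0..<n])"
    "last (P 0 # concat (map f [0..<n])) = P n"
    by simp_all
  have "concat (map f [0..<Suc n]) = concat (map f [0..<n]) @ f n"
    by simp
  moreover have "last (P 0 # concat (map f [0..<n]) @ f n) = last (last (P 0 # concat (map f [0..<n])) # f n)"
    by simp
  ultimately show ?case
    using IH Suc.prems[of n] by (simp only: trail_append) simp
qed simp

lemma trail_odd_corners:
  "trail (0, 0) (odd_corners (2 * W + 3) (2 * H + 3)) =
     trail (0, 0) (concat (map (\<lambda>k. [(0, 2 * k + 1), (2 * W + 2, 2 * k + 1),
       (2 * W + 2, 2 * k + 2), (0, 2 * k + 2)]) [0..<Suc H])) @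
     trail (0, 2 * H + 2) (concat (map (\<lambda>k. zig 0 1 (2 * H + 1 - 2 * k)) [0..<H])) @
     trail (0, 2) [(0, 1), (1, 1), (1, 0)] @
     trail (1, 0) (concat (map (\<lambda>k. strand (2 * H + 3) (2 * k + 2) (2 * k + 3)) [0..<W])) @
     trail (2 * W + 1, 0) [(2 * W + 2, 0), (2 * W + 2, 2 * H + 2), (1, 2 * H + 2), (1, 0), (0, 0)]"
  (is "_ = trail _ ?F @ trail _ ?G @ _ @ trail _ ?M @ _")
proof -
  have "last ((0, 0) # ?F) = (0, 2 * H + 2)"
    using trail_concat[of "Suc H" "\<lambda>k. (0, 2 * k)"
      "\<lambda>k. [(0, 2 * k + 1), (2 * W + 2, 2 * k + 1), (2 * W + 2, 2 * k + 2), (0, 2 * k + 2)]"]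
    by (simp del: upt_Suc)
  moreover have "last ((0, 2 * H + 2) # ?G) = (0, 2)"
    using trail_concat[of H "\<lambda>k. (0, 2 * H + 2 - 2 * k)" "\<lambda>k. zig 0 1 (2 * H + 1 - 2 * k)"]
    by (simp add: zig_def)
  moreover have "last ((1, 0) # ?M) = (2 * W + 1, 0)"
    using trail_concat[of W "\<lambda>k. (2 * k + 1, 0)" "\<lambda>k. strand (2 * H + 3) (2 * k + 2) (2 * k + 3)"]
    by (simp add: strand_def)
  moreover have "last ((0, 2) # [(0, 1), (1, 1), (1, 0)]) = ((1, 0) :: point)"
    by simp
  ultimately show ?thesis
    unfolding odd_corners_eq trail_append by (simp only: append_assoc)
qed

text \<open>\<open>M k o'\<close> describes the memory before iteration \<open>k\<close> with output
  \<open>o'\<close>. An iteration prints the walk along one block of corners at 5 steps per vertex;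
  \<open>K\<close> collects the overhead of its moves and its bookkeeping.\<close>

lemma achieves_corner_loop:
  assumes "\<And>k o' m. M k o' m \<Longrightarrow> M k o' (op (SET 0 1) m)"
    and "\<And>k o' m. k \<le> n \<Longrightarrow> M k o' m \<Longrightarrow> reg m r > 0 \<longleftrightarrow> k < n"
    and "\<And>k o'. k < n \<Longrightarrow> achieves (M k o') c (5 * length (trail (P k) (f k)) + K)
      (M (Suc k) (o' @ printed e (trail (P k) (f k))))"
    and last: "\<And>k. k < n \<Longrightarrow> last (P k # f k) = P (Suc k)"
  shows "achieves (M 0 o') (While r c)
    (5 * length (trail (P 0) (concat (map f [0..<n]))) + (K + 1) * n + 3)
    (M n (o' @ printed e (trail (P 0) (concat (map f [0..<n])))))"
proof -
  let ?t = "\<lambda>k. concat (map (\<lambda>k. trail (P k) (f k)) [0..<k])"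
  have "achieves (M 0 o') (While r c) ((\<Sum>k<n. 5 * length (trail (P k) (f k)) + K + 1) + 3)
      (M n (o' @ printed e (?t n)))"
  proof (rule achieves_While[where I = "\<lambda>k. M k (o' @ printed e (?t k))"])
    fix k assume "k < n"
    from assms(3)[OF this, of "o' @ printed e (?t k)"]
    show "achieves (M k (o' @ printed e (?t k))) c (5 * length (trail (P k) (f k)) + K)
        (M (Suc k) (o' @ printed e (?t (Suc k))))"
      by simp
  qed (use assms(1,2) in auto)
  moreover have "(\<Sum>k<n. 5 * length (trail (P k) (f k)) + K + 1) = 5 * length (?t n) + (K + 1) * n"
    by (induction n) auto
  ultimately show ?thesis
    using trail_concat[of n P f, OF last] by simp
qed

section \<open>Programs for the pieces of the walk\<close>

definition zig_com :: "bool \<Rightarrow> com" where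
  "zig_com e = mov e 4 13 ;; Ops [SUB 14 13 6] ;; mov e 3 12 ;; mov e 4 14 ;; mov e 3 11"

text \<open>Register 8 holds 0, so adding it copies a register, and moving to it leads to column 0.
  The loop runs as long as the detour column lies before the last column.\<close>

definition strand_com :: "bool \<Rightarrow> com" where
  "strand_com e =
     mov e 3 11 ;; Ops [ADD 13 15 8, SUB 17 10 13] ;;
     While 17 (zig_com e ;; Ops [ADD 13 13 7, SUB 17 10 13]) ;;
     mov e 4 10 ;; mov e 3 12 ;; mov e 4 8"

definition strands_com :: "bool \<Rightarrow> com" where
  "strands_com e = While 17 (strand_com e ;; Ops [ADD 11 11 7, ADD 12 12 7, SUB 17 9 11])"

definition even_com :: "bool \<Rightarrow> com" where
  "even_com e =
     Ops [SET 11 2, SET 12 1, SUB 17 9 11] ;; strands_com e ;;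
     Ops [ADD 11 9 8, SET 12 0] ;; strand_com e"

definition odd_com :: "bool \<Rightarrow> com" where
  "odd_com e =
     Ops [SET 13 1, SUB 17 10 13] ;;
     While 17 (mov e 4 13 ;; mov e 3 9 ;; Ops [ADD 13 13 6] ;; mov e 4 13 ;; mov e 3 8 ;;
       Ops [ADD 13 13 6, SUB 17 10 13]) ;;
     Ops [SET 11 0, SET 12 1, SUB 13 10 6, SUB 17 13 6] ;;
     While 17 (zig_com e ;; Ops [SUB 13 13 7, SUB 17 13 6]) ;;
     (mov e 4 13 ;; mov e 3 6 ;; mov e 4 8 ;; Ops [SET 11 2, SET 12 3, SUB 17 9 11]) ;;
     strands_com e ;;
     mov e 3 9 ;; mov e 4 10 ;; mov e 3 6 ;; mov e 4 8 ;; mov e 3 8"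

section \<open>Correctness and running time of these programs\<close>

context
  fixes e :: bool and u v q w1 h1 p :: nat
begin

text \<open>The fixed variables are registers that these programs leave unchanged. Register 0 is
  listed with the value 1 that jumps leave there, and register 5 with 0, its value after every
  completed move.\<close>

definition state :: "nat \<Rightarrow> nat \<Rightarrow> nat \<Rightarrow> nat \<Rightarrow> nat \<Rightarrow> nat \<Rightarrow> nat \<Rightarrow> nat list \<Rightarrow> mem" where
  "state i j s r c c1 x = list_mem [1, u, v, i, j, 0, 1, 2, 0, w1, h1, s, r, c, c1, p, q, x]"

lemma mov_state:
  "achieves (\<lambda>m. m = state i j s r c c1 x o') (mov e 3 11) (5 * length (seg (i, j) (s, j)) + 8)
     (\<lambda>m. m = state s j s r c c1 x (o' @ printed e (seg (i, j) (s, j))))"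
  "achieves (\<lambda>m. m = state i j s r c c1 x o') (mov e 3 12) (5 * length (seg (i, j) (r, j)) + 8)
     (\<lambda>m. m = state r j s r c c1 x (o' @ printed e (seg (i, j) (r, j))))"
  "achieves (\<lambda>m. m = state i j s r c c1 x o') (mov e 3 9) (5 * length (seg (i, j) (w1, j)) + 8)
     (\<lambda>m. m = state w1 j s r c c1 x (o' @ printed e (seg (i, j) (w1, j))))"
  "achieves (\<lambda>m. m = state i j s r c c1 x o') (mov e 3 6) (5 * length (seg (i, j) (1, j)) + 8)
     (\<lambda>m. m = state 1 j s r c c1 x (o' @ printed e (seg (i, j) (1, j))))"
  "achieves (\<lambda>m. m = state i j s r c c1 x o') (mov e 3 8) (5 * length (seg (i, j) (0, j)) + 8)
     (\<lambda>m. m = state 0 j s r c c1 x (o' @ printed e (seg (i, j) (0, j))))"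
  "achieves (\<lambda>m. m = state i j s r c c1 x o') (mov e 4 13) (5 * length (seg (i, j) (i, c)) + 8)
     (\<lambda>m. m = state i c s r c c1 x (o' @ printed e (seg (i, j) (i, c))))"
  "achieves (\<lambda>m. m = state i j s r c c1 x o') (mov e 4 14) (5 * length (seg (i, j) (i, c1)) + 8)
     (\<lambda>m. m = state i c1 s r c c1 x (o' @ printed e (seg (i, j) (i, c1))))"
  "achieves (\<lambda>m. m = state i j s r c c1 x o') (mov e 4 10) (5 * length (seg (i, j) (i, h1)) + 8)
     (\<lambda>m. m = state i h1 s r c c1 x (o' @ printed e (seg (i, j) (i, h1))))"
  "achieves (\<lambda>m. m = state i j s r c c1 x o') (mov e 4 8) (5 * length (seg (i, j) (i, 0)) + 8)
     (\<lambda>m. m = state i 0 s r c c1 x (o' @ printed e (seg (i, j) (i, 0))))"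
  unfolding state_def
  using mov_list_mem[of "[1, u, v, i, j, 0, 1, 2, 0, w1, h1, s, r, c, c1, p, q, x]" 11 o' e]
    mov_list_mem[of "[1, u, v, i, j, 0, 1, 2, 0, w1, h1, s, r, c, c1, p, q, x]" 12 o' e]
    mov_list_mem[of "[1, u, v, i, j, 0, 1, 2, 0, w1, h1, s, r, c, c1, p, q, x]" 9 o' e]
    mov_list_mem[of "[1, u, v, i, j, 0, 1, 2, 0, w1, h1, s, r, c, c1, p, q, x]" 6 o' e]
    mov_list_mem[of "[1, u, v, i, j, 0, 1, 2, 0, w1, h1, s, r, c, c1, p, q, x]" 8 o' e]
    mov_list_mem[of "[1, u, v, i, j, 0, 1, 2, 0, w1, h1, s, r, c, c1, p, q, x]" 13 o' e]
    mov_list_mem[of "[1, u, v, i, j, 0, 1, 2, 0, w1, h1, s, r, c, c1, p, q, x]" 14 o' e]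
    mov_list_mem[of "[1, u, v, i, j, 0, 1, 2, 0, w1, h1, s, r, c, c1, p, q, x]" 10 o' e]
  by (simp_all add: list_update_numeral)

lemma op_state:
  "op (SET 11 d) (state i j s r c c1 x o') = state i j d r c c1 x o'"
  "op (SET 12 d) (state i j s r c c1 x o') = state i j s d c c1 x o'"
  "op (SET 13 d) (state i j s r c c1 x o') = state i j s r d c1 x o'"
  "op (ADD 11 9 8) (state i j s r c c1 x o') = state i j w1 r c c1 x o'"
  "op (ADD 11 11 7) (state i j s r c c1 x o') = state i j (s + 2) r c c1 x o'"
  "op (ADD 12 12 7) (state i j s r c c1 x o') = state i j s (r + 2) c c1 x o'"
  "op (ADD 13 15 8) (state i j s r c c1 x o') = state i j s r p c1 x o'"
  "op (ADD 13 13 7) (state i j s r c c1 x o') = state i j s r (c + 2) c1 x o'"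
  "op (ADD 13 13 6) (state i j s r c c1 x o') = state i j s r (c + 1) c1 x o'"
  "op (SUB 13 13 7) (state i j s r c c1 x o') = state i j s r (c - 2) c1 x o'"
  "op (SUB 13 10 6) (state i j s r c c1 x o') = state i j s r (h1 - 1) c1 x o'"
  "op (SUB 14 13 6) (state i j s r c c1 x o') = state i j s r c (c - 1) x o'"
  "op (SUB 17 9 11) (state i j s r c c1 x o') = state i j s r c c1 (w1 - s) o'"
  "op (SUB 17 10 13) (state i j s r c c1 x o') = state i j s r c c1 (h1 - c) o'"
  "op (SUB 17 13 6) (state i j s r c c1 x o') = state i j s r c c1 (c - 1) o'"
  "op (SET 0 (Suc 0)) (state i j s r c c1 x o') = state i j s r c c1 x o'"
  "reg (state i j s r c c1 x o') 17 = x"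
  by (simp_all add: state_def op_list_mem reg_list_mem list_update_numeral)

text \<open>Forgets the registers 13, 14 and 17, which each strand sets anew.\<close>

definition at_pos :: "nat \<Rightarrow> nat \<Rightarrow> nat \<Rightarrow> nat \<Rightarrow> nat list \<Rightarrow> mem \<Rightarrow> bool" where
  "at_pos i j s r o' m \<longleftrightarrow> (\<exists>c c1 x. m = state i j s r c c1 x o')"

lemma at_posI: "at_pos i j s r o' (state i j s r c c1 x o')"
  unfolding at_pos_def by blast

lemma at_posE:
  assumes "at_pos i j s r o' m"
  obtains c c1 x where "m = state i j s r c c1 x o'"
  using assms unfolding at_pos_def by blast

lemma zig_achieves:
  "achieves (\<lambda>m. m = state s j s r c c1 x o') (zig_com e) (5 * length (trail (s, j) (zig s r c)) + 33)
     (\<lambda>m. m = state s (c - 1) s r c (c - 1) x (o' @ printed e (trail (s, j) (zig s r c))))"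
proof -
  have sub: "achieves (\<lambda>m. m = state s c s r c c1 x o1) (Ops [SUB 14 13 6]) 1
      (\<lambda>m. m = state s c s r c (c - 1) x o1)" for o1
    by (rule achieves_Ops) (simp_all add: op_state)
  show ?thesis
    unfolding zig_com_def
    by (rule achieves_weaken[OF achieves_Seq[OF mov_state(6) achieves_Seq[OF sub
        achieves_Seq[OF mov_state(2) achieves_Seq[OF mov_state(7) mov_state(1)]]]]]) (simp_all add: zig_def)
qed

context
  fixes h :: nat
  assumes h2: "h \<ge> 2" and h1: "h1 = h - 1" and p: "p = 2 - h mod 2"
begin

lemma strand_achieves:
  "achieves (at_pos i 0 s r o') (strand_com e)
     (5 * length (trail (i, 0) (strand h s r)) + 37 * ((h - 1) div 2) + 40)
     (at_pos r 0 s r (o' @ printed e (trail (i, 0) (strand h s r))))"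
proof -
  let ?n = "(h - 1) div 2"
  let ?P = "\<lambda>k. (s, 2 * k - 1 - h mod 2)"
  let ?f = "\<lambda>k. zig s r (2 * k + 2 - h mod 2)"
  let ?C = "concat (map ?f [0..<?n])"
  define M where "M k o' m \<longleftrightarrow> (\<exists>c1. m = state s (2 * k - 1 - h mod 2) s r (2 * k + p) c1 (h1 - (2 * k + p)) o')"
    for k o' m
  have c: "2 * k + 2 - h mod 2 = 2 * k + p" for k
    using p by (simp add: mod2_eq_if)
  have body: "achieves (M k o') (zig_com e ;; Ops [ADD 13 13 7, SUB 17 10 13])
      (5 * length (trail (?P k) (?f k)) + 35) (M (Suc k) (o' @ printed e (trail (?P k) (?f k))))" for k o'
  proof -
    have next_col: "2 * k + p - 1 = 2 * Suc k - 1 - h mod 2"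
      using p by (simp add: mod2_eq_if)
    have o: "achieves (\<lambda>m. m = state s (2 * k + p - 1) s r (2 * k + p) (2 * k + p - 1) x o1)
        (Ops [ADD 13 13 7, SUB 17 10 13]) 2 (M (Suc k) o1)" for x o1
      by (rule achieves_Ops) (use next_col in \<open>auto simp: op_state M_def add.commute add.left_commute\<close>)
    have "achieves (\<lambda>m. m = state s (2 * k - 1 - h mod 2) s r (2 * k + p) c1 (h1 - (2 * k + p)) o')
        (zig_com e ;; Ops [ADD 13 13 7, SUB 17 10 13])
        (5 * length (trail (?P k) (?f k)) + 35) (M (Suc k) (o' @ printed e (trail (?P k) (?f k))))" for c1
      unfolding c by (rule achieves_weaken[OF achieves_Seq[OF zig_achieves o]]) simp_all
    then show ?thesis
      unfolding achieves_def M_def by blast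
  qed
  have last: "last (?P k # ?f k) = ?P (Suc k)" for k
    by (simp add: zig_def mod2_eq_if)
  have loop: "achieves (M 0 o1) (While 17 (zig_com e ;; Ops [ADD 13 13 7, SUB 17 10 13]))
      (5 * length (trail (?P 0) ?C) + (35 + 1) * ?n + 3) (M ?n (o1 @ printed e (trail (?P 0) ?C)))" for o1
  proof (rule achieves_corner_loop[where P = ?P])
    fix k o' m assume "k \<le> ?n" "M k o' m"
    moreover from this have "reg m 17 = h1 - (2 * k + p)"
      by (auto simp: M_def op_state)
    \<comment> \<open>Detour columns start at \<open>p\<close> and grow by 2; exactly
      \<open>(h - 1) div 2\<close> of them lie before the last column, for either parity of
      \<open>h\<close>.\<close>
    ultimately show "reg m 17 > 0 \<longleftrightarrow> k < ?n"
      using p h1 by (cases rule: columns_cases[OF h2]) (simp_all, presburger+)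
  next
    show "\<And>k o' m. M k o' m \<Longrightarrow> M k o' (op (SET 0 1) m)"
      by (auto simp: M_def op_state)
  qed (rule body, rule last)
  have start: "achieves (\<lambda>m. m = state s 0 s r c c1 x o1) (Ops [ADD 13 15 8, SUB 17 10 13]) 2 (M 0 o1)"
    for c c1 x o1
    by (rule achieves_Ops) (auto simp: op_state M_def)
  have fin: "achieves (M ?n o1) (mov e 4 10 ;; mov e 3 12 ;; mov e 4 8)
      (5 * length (trail (?P ?n) [(s, h - 1), (r, h - 1), (r, 0)]) + 24)
      (at_pos r 0 s r (o1 @ printed e (trail (?P ?n) [(s, h - 1), (r, h - 1), (r, 0)])))" for o1
  proof -
    have "achieves (\<lambda>m. m = state s (2 * ?n - 1 - h mod 2) s r c c1 x o1) (mov e 4 10 ;; mov e 3 12 ;; mov e 4 8)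
      (5 * length (trail (?P ?n) [(s, h - 1), (r, h - 1), (r, 0)]) + 24)
      (at_pos r 0 s r (o1 @ printed e (trail (?P ?n) [(s, h - 1), (r, h - 1), (r, 0)])))" for c c1 x
      unfolding h1 [symmetric]
      by (rule achieves_weaken[OF achieves_Seq[OF mov_state(8) achieves_Seq[OF mov_state(2) mov_state(9)]]])
        (auto simp: at_posI)
    then show ?thesis
      unfolding achieves_def M_def by blast
  qed
  have tr: "trail (i, 0) (strand h s r) = seg (i, 0) (s, 0) @ trail (?P 0) ?C @
      trail (?P ?n) [(s, h - 1), (r, h - 1), (r, 0)]"
    using trail_concat[of ?n ?P ?f, OF last]
    unfolding strand_def trail.simps(2) trail_append by simp
  have "achieves (\<lambda>m. m = state i 0 s r c c1 x o') (strand_com e)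
     (5 * length (trail (i, 0) (strand h s r)) + 37 * ((h - 1) div 2) + 40)
     (at_pos r 0 s r (o' @ printed e (trail (i, 0) (strand h s r))))" for c c1 x
    unfolding strand_com_def tr
    by (rule achieves_weaken[OF achieves_Seq[OF mov_state(1) achieves_Seq[OF start
        achieves_Seq[OF loop fin]]]]) (simp_all del: trail.simps)
  then show ?thesis
    unfolding achieves_def at_pos_def by blast
qed

text \<open>The offset \<open>d\<close> of the partner row is 1 in the construction for evenly many
  rows and 3 in the one for two odd dimensions. \<open>P k\<close> is the vertex from which strand
  \<open>k\<close> is entered.\<close>

lemma strands_achieves:
  fixes P :: "nat \<Rightarrow> point"
  assumes "\<And>k. k \<le> n \<Longrightarrow> w1 - (2 * k + 2) > 0 \<longleftrightarrow> k < n"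
    and P: "\<And>k. P (Suc k) = (2 * k + d, 0)" "P 0 = (i0, 0)"
  shows "achieves (\<lambda>m. at_pos i0 0 2 d o' m \<and> reg m 17 = w1 - 2) (strands_com e)
    (5 * length (trail (i0, 0) (concat (map (\<lambda>k. strand h (2 * k + 2) (2 * k + d)) [0..<n]))) +
      (37 * ((h - 1) div 2) + 44) * n + 3)
    (at_pos (fst (P n)) 0 (2 * n + 2) (2 * n + d)
      (o' @ printed e (trail (i0, 0) (concat (map (\<lambda>k. strand h (2 * k + 2) (2 * k + d)) [0..<n])))))"
proof -
  let ?f = "\<lambda>k. strand h (2 * k + 2) (2 * k + d)"
  define M where "M k o' m \<longleftrightarrow> at_pos (fst (P k)) 0 (2 * k + 2) (2 * k + d) o' m \<and> reg m 17 = w1 - (2 * k + 2)"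
    for k o' m
  have P0: "P k = (fst (P k), 0)" for k
    using P by (cases k) simp_all
  have body: "achieves (M k o') (strand_com e ;; Ops [ADD 11 11 7, ADD 12 12 7, SUB 17 9 11])
      (5 * length (trail (P k) (?f k)) + (37 * ((h - 1) div 2) + 43))
      (M (Suc k) (o' @ printed e (trail (P k) (?f k))))" for k o'
  proof -
    have o: "achieves (at_pos (2 * k + d) 0 (2 * k + 2) (2 * k + d) o1)
        (Ops [ADD 11 11 7, ADD 12 12 7, SUB 17 9 11]) 3 (M (Suc k) o1)" for o1
      by (rule achieves_Ops) (auto simp: op_state M_def P add.commute add.left_commute at_posI elim!: at_posE)
    show ?thesis
      by (subst (1 2) P0, rule achieves_weaken[OF achieves_Seq[OF strand_achieves o]])
        (auto simp: M_def)
  qed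
  have last: "last (P k # ?f k) = P (Suc k)" for k
    by (simp add: strand_def P)
  have "achieves (M 0 o') (strands_com e)
    (5 * length (trail (P 0) (concat (map ?f [0..<n]))) + (37 * ((h - 1) div 2) + 43 + 1) * n + 3)
    (M n (o' @ printed e (trail (P 0) (concat (map ?f [0..<n])))))"
    unfolding strands_com_def
  proof (rule achieves_corner_loop[where P = P])
    show "\<And>k o' m. k \<le> n \<Longrightarrow> M k o' m \<Longrightarrow> reg m 17 > 0 \<longleftrightarrow> k < n"
      using assms(1) by (auto simp: M_def)
    show "\<And>k o' m. M k o' m \<Longrightarrow> M k o' (op (SET 0 1) m)"
      by (auto simp: M_def op_state at_posI elim!: at_posE)
  qed (rule body, rule last)
  then show ?thesis
    unfolding M_def P(2) by (rule achieves_weaken) (auto simp: P(2) numeral_2_eq_2)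
qed

lemma even_achieves:
  assumes w1: "w1 = 2 * N + 1"
  shows "achieves (at_pos 0 0 s r o') (even_com e)
    (5 * length (trail (0, 0) (even_corners (2 * N + 2) h)) +
      (37 * ((h - 1) div 2) + 48) * (N + 1))
    (\<lambda>m. snd (snd m) = o' @ printed e (trail (0, 0) (even_corners (2 * N + 2) h)))"
proof -
  let ?C = "concat (map (\<lambda>k. strand h (2 * k + 2) (2 * k + 1)) [0..<N])"
  let ?P = "\<lambda>k. (2 * k - 1, 0 :: nat)"
  have tr: "trail (0, 0) (even_corners (2 * N + 2) h) =
      trail (0, 0) ?C @ trail (2 * N - 1, 0) (strand h w1 0)"
    using trail_concat[of N ?P "\<lambda>k. strand h (2 * k + 2) (2 * k + 1)"]
    unfolding even_corners_eq[OF h2] trail_append w1 by (simp add: strand_def)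
  have 1: "achieves (at_pos 0 0 s r o') (Ops [SET 11 2, SET 12 1, SUB 17 9 11]) 3
      (\<lambda>m. at_pos 0 0 2 1 o' m \<and> reg m 17 = w1 - 2)"
    by (rule achieves_Ops) (auto simp: op_state at_posI elim!: at_posE)
  have 2: "achieves (\<lambda>m. at_pos 0 0 2 1 o' m \<and> reg m 17 = w1 - 2) (strands_com e)
      (5 * length (trail (0, 0) ?C) + (37 * ((h - 1) div 2) + 44) * N + 3)
      (at_pos (fst (?P N)) 0 (2 * N + 2) (2 * N + 1) (o' @ printed e (trail (0, 0) ?C)))"
    by (rule strands_achieves[where P = ?P]) (auto simp: w1)
  have 3: "achieves (at_pos (fst (?P N)) 0 (2 * N + 2) (2 * N + 1) o1) (Ops [ADD 11 9 8, SET 12 0]) 2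
      (at_pos (2 * N - 1) 0 w1 0 o1)" for o1
    by (rule achieves_Ops) (auto simp: op_state at_posI elim!: at_posE)
  show ?thesis
    unfolding even_com_def tr
  proof (rule achieves_weaken[OF achieves_Seq[OF 1 achieves_Seq[OF 2 achieves_Seq[OF 3
          strand_achieves]]]])
    fix m
    assume "at_pos 0 0 w1 0 ((o' @ printed e (trail (0, 0) ?C)) @
        printed e (trail (2 * N - 1, 0) (strand h w1 0))) m"
    then show "snd (snd m) = o' @ printed e (trail (0, 0) ?C @
        trail (2 * N - 1, 0) (strand h w1 0))"
      by (auto elim!: at_posE simp: state_def list_mem_def)
  qed (simp_all add: algebra_simps)
qed

lemma odd_achieves:
  assumes w1: "w1 = 2 * W + 2" and h: "h = 2 * H + 3"
  shows "achieves (at_pos 0 0 s r o') (odd_com e)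
    (5 * length (trail (0, 0) (odd_corners (2 * W + 3) (2 * H + 3))) +
      36 * (H + 1) + 36 * H + (37 * (H + 1) + 44) * W + 90)
    (\<lambda>m. snd (snd m) = o' @ printed e (trail (0, 0) (odd_corners (2 * W + 3) (2 * H + 3))))"
proof -
  have h1': "h1 = 2 * H + 2"
    using h h1 by simp
  let ?f = "\<lambda>k. [(0, 2 * k + 1), (2 * W + 2, 2 * k + 1), (2 * W + 2, 2 * k + 2), (0, 2 * k + 2)]"
  let ?P = "\<lambda>k. (0 :: nat, 2 * k)"
  let ?F = "concat (map ?f [0..<Suc H])"
  let ?g = "\<lambda>k. zig 0 1 (2 * H + 1 - 2 * k)"
  let ?Q = "\<lambda>k. (0 :: nat, 2 * H + 2 - 2 * k)"
  let ?G = "concat (map ?g [0..<H])"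
  let ?m = "\<lambda>k. strand h (2 * k + 2) (2 * k + 3)"
  let ?R = "\<lambda>k. (2 * k + 1, 0 :: nat)"
  let ?M = "concat (map ?m [0..<W])"
  let ?T = "[(2 * W + 2, 0), (2 * W + 2, 2 * H + 2), (1, 2 * H + 2), (1, 0), (0, 0)] :: point list"
  have lastf: "last (?P k # ?f k) = ?P (Suc k)" for k
    by simp
  have lastg: "last (?Q k # ?g k) = ?Q (Suc k)" for k
    by (simp add: zig_def)
  have lastm: "last (?R k # ?m k) = ?R (Suc k)" for k
    by (simp add: strand_def)
  have tr: "trail (0, 0) (odd_corners (2 * W + 3) (2 * H + 3)) =
      trail (0, 0) ?F @ trail (0, 2 * H + 2) ?G @ trail (0, 2) [(0, 1), (1, 1), (1, 0)] @
      trail (1, 0) ?M @ trail (2 * W + 1, 0) ?T"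
    unfolding h by (rule trail_odd_corners)
  \<comment> \<open>\<open>A\<close> is the invariant of the sweep to the right, \<open>B\<close>
    that of the way back along row 0.\<close>
  define A where "A c1 k o' m \<longleftrightarrow> m = state 0 (2 * k) s r (2 * k + 1) c1 (h1 - (2 * k + 1)) o'"
    for c1 k o' m
  define B where "B k o' m \<longleftrightarrow> (\<exists>c1. m = state 0 (2 * H + 2 - 2 * k) 0 1 (2 * H + 1 - 2 * k) c1 (2 * H - 2 * k) o')"
    for k o' m
  have 1: "achieves (\<lambda>m. m = state 0 0 s r c c1 x o') (Ops [SET 13 1, SUB 17 10 13]) 2 (A c1 0 o')"
    for c c1 x
    by (rule achieves_Ops) (auto simp: op_state A_def)
  let ?b = "mov e 4 13 ;; mov e 3 9 ;; Ops [ADD 13 13 6] ;; mov e 4 13 ;; mov e 3 8 ;;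
       Ops [ADD 13 13 6, SUB 17 10 13]"
  have 2: "achieves (A c1 0 o') (While 17 ?b) (5 * length (trail (?P 0) ?F) + (35 + 1) * Suc H + 3)
      (A c1 (Suc H) (o' @ printed e (trail (?P 0) ?F)))" for c1 o'
  proof (rule achieves_corner_loop[where P = ?P])
    fix k o1
    have a: "achieves (\<lambda>m. m = state i j s r c c1 x o1) (Ops [ADD 13 13 6]) 1
        (\<lambda>m. m = state i j s r (c + 1) c1 x o1)" for i j c x o1
      by (rule achieves_Ops) (auto simp: op_state)
    have b: "achieves (\<lambda>m. m = state 0 (2 * k + 1 + 1) s r (2 * k + 1 + 1) c1 x o1)
        (Ops [ADD 13 13 6, SUB 17 10 13]) 2 (A c1 (Suc k) o1)" for x o1
      by (rule achieves_Ops) (auto simp: op_state A_def)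
    show "achieves (A c1 k o1) ?b (5 * length (trail (?P k) (?f k)) + 35)
        (A c1 (Suc k) (o1 @ printed e (trail (?P k) (?f k))))"
      by (rule achieves_weaken[OF achieves_Seq[OF mov_state(6) achieves_Seq[OF mov_state(3) achieves_Seq[OF a
          achieves_Seq[OF mov_state(6) achieves_Seq[OF mov_state(5) b]]]]]])
        (simp_all add: A_def w1)
  next
    fix k o1 m assume "k \<le> Suc H" "A c1 k o1 m"
    moreover from this have "reg m 17 = h1 - (2 * k + 1)"
      by (simp add: A_def op_state)
    ultimately show "reg m 17 > 0 \<longleftrightarrow> k < Suc H"
      unfolding h1' by auto
  qed (auto simp: A_def op_state)
  have 3: "achieves (A c1 (Suc H) o1) (Ops [SET 11 0, SET 12 1, SUB 13 10 6, SUB 17 13 6]) 4 (B 0 o1)"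
    for c1 o1
  proof (rule achieves_Ops)
    have "h1 - Suc 0 = Suc (2 * H)" "h1 - Suc (Suc 0) = 2 * H"
      using h1' by simp_all
    then show "B 0 o1 (fold op [SET 11 0, SET 12 1, SUB 13 10 6, SUB 17 13 6] m)"
      if "A c1 (Suc H) o1 m" for m
      using that by (simp add: op_state A_def B_def numeral_2_eq_2 del: One_nat_def) auto
  qed simp_all
  have 4: "achieves (B 0 o1) (While 17 (zig_com e ;; Ops [SUB 13 13 7, SUB 17 13 6]))
      (5 * length (trail (?Q 0) ?G) + (35 + 1) * H + 3) (B H (o1 @ printed e (trail (?Q 0) ?G)))" for o1
  proof (rule achieves_corner_loop[where P = ?Q])
    fix k o1
    have b: "achieves (\<lambda>m. m = state 0 (2 * H + 1 - 2 * k - 1) 0 1 (2 * H + 1 - 2 * k) (2 * H + 1 - 2 * k - 1) x o1)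
        (Ops [SUB 13 13 7, SUB 17 13 6]) 2 (B (Suc k) o1)" for x o1
      by (rule achieves_Ops) (auto simp: op_state B_def)
    have "achieves (\<lambda>m. m = state 0 (2 * H + 2 - 2 * k) 0 1 (2 * H + 1 - 2 * k) c1 (2 * H - 2 * k) o1)
        (zig_com e ;; Ops [SUB 13 13 7, SUB 17 13 6]) (5 * length (trail (?Q k) (?g k)) + 35)
        (B (Suc k) (o1 @ printed e (trail (?Q k) (?g k))))" for c1
      by (rule achieves_weaken[OF achieves_Seq[OF zig_achieves b]]) simp_all
    then show "achieves (B k o1) (zig_com e ;; Ops [SUB 13 13 7, SUB 17 13 6])
        (5 * length (trail (?Q k) (?g k)) + 35) (B (Suc k) (o1 @ printed e (trail (?Q k) (?g k))))"
      unfolding achieves_def B_def by blast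
  next
    fix k o1 m assume "k \<le> H" "B k o1 m"
    moreover from this have "reg m 17 = 2 * H - 2 * k"
      by (auto simp: B_def op_state)
    ultimately show "reg m 17 > 0 \<longleftrightarrow> k < H"
      by auto
  next
    show "\<And>k o' m. B k o' m \<Longrightarrow> B k o' (op (SET 0 1) m)"
      by (auto simp: B_def op_state)
  qed (rule lastg)
  have 5: "achieves (B H o1) (mov e 4 13 ;; mov e 3 6 ;; mov e 4 8 ;; Ops [SET 11 2, SET 12 3, SUB 17 9 11])
      (5 * length (trail (0, 2) [(0, 1), (1, 1), (1, 0)]) + 27)
      (\<lambda>m. at_pos 1 0 2 3 (o1 @ printed e (trail (0, 2) [(0, 1), (1, 1), (1, 0)])) m \<and> reg m 17 = w1 - 2)"
    for o1
  proof -
    have o: "achieves (\<lambda>m. m = state 1 0 0 1 c c1 x o2) (Ops [SET 11 2, SET 12 3, SUB 17 9 11]) 3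
        (\<lambda>m. at_pos 1 0 2 3 o2 m \<and> reg m 17 = w1 - 2)" for c c1 x o2
      by (rule achieves_Ops) (auto simp: op_state at_posI)
    have "achieves (\<lambda>m. m = state 0 2 0 1 1 c1 0 o1)
        (mov e 4 13 ;; mov e 3 6 ;; mov e 4 8 ;; Ops [SET 11 2, SET 12 3, SUB 17 9 11])
        (5 * length (trail (0, 2) [(0, 1), (1, 1), (1, 0)]) + 27)
        (\<lambda>m. at_pos 1 0 2 3 (o1 @ printed e (trail (0, 2) [(0, 1), (1, 1), (1, 0)])) m \<and> reg m 17 = w1 - 2)"
      for c1
      by (rule achieves_weaken[OF achieves_Seq[OF mov_state(6) achieves_Seq[OF mov_state(4)
          achieves_Seq[OF mov_state(9) o]]]]) simp_all
    moreover have "B H o1 m \<longleftrightarrow> (\<exists>c1. m = state 0 2 0 1 1 c1 0 o1)" for m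
      by (simp add: B_def numeral_2_eq_2)
    ultimately show ?thesis
      unfolding achieves_def by blast
  qed
  have 6: "achieves (\<lambda>m. at_pos 1 0 2 3 o1 m \<and> reg m 17 = w1 - 2) (strands_com e)
      (5 * length (trail (1, 0) ?M) + (37 * ((h - 1) div 2) + 44) * W + 3)
      (at_pos (fst (?R W)) 0 (2 * W + 2) (2 * W + 3) (o1 @ printed e (trail (1, 0) ?M)))" for o1
    by (rule strands_achieves[where P = ?R]) (auto simp: w1)
  have 7: "achieves (at_pos (fst (?R W)) 0 (2 * W + 2) (2 * W + 3) o1)
      (mov e 3 9 ;; mov e 4 10 ;; mov e 3 6 ;; mov e 4 8 ;; mov e 3 8)
      (5 * length (trail (2 * W + 1, 0) ?T) + 40)
      (\<lambda>m. snd (snd m) = o1 @ printed e (trail (2 * W + 1, 0) ?T))" for o1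
  proof -
    have "achieves (\<lambda>m. m = state (2 * W + 1) 0 (2 * W + 2) (2 * W + 3) c c1 x o1)
      (mov e 3 9 ;; mov e 4 10 ;; mov e 3 6 ;; mov e 4 8 ;; mov e 3 8)
      (5 * length (trail (2 * W + 1, 0) ?T) + 40)
      (\<lambda>m. snd (snd m) = o1 @ printed e (trail (2 * W + 1, 0) ?T))" for c c1 x
      unfolding w1 [symmetric] h1' [symmetric]
      by (rule achieves_weaken[OF achieves_Seq[OF mov_state(3) achieves_Seq[OF mov_state(8) achieves_Seq[OF mov_state(4)
          achieves_Seq[OF mov_state(9) mov_state(5)]]]]]) (auto simp: state_def list_mem_def)
    then show ?thesis
      unfolding achieves_def at_pos_def by (simp only: fst_conv) blast
  qed
  have h': "(h - 1) div 2 = H + 1"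
    by (simp add: h)
  have "achieves (\<lambda>m. m = state 0 0 s r c c1 x o') (odd_com e)
    (5 * length (trail (0, 0) (odd_corners (2 * W + 3) (2 * H + 3))) +
      36 * (H + 1) + 36 * H + (37 * (H + 1) + 44) * W + 90)
    (\<lambda>m. snd (snd m) = o' @ printed e (trail (0, 0) (odd_corners (2 * W + 3) (2 * H + 3))))" for c c1 x
    unfolding odd_com_def tr
    by (rule achieves_weaken[OF achieves_Seq[OF 1 achieves_Seq[OF 2 achieves_Seq[OF 3
      achieves_Seq[OF 4 achieves_Seq[OF 5 achieves_Seq[OF 6[unfolded h'] 7]]]]]]])
      (simp_all add: algebra_simps)
  then show ?thesis
    unfolding achieves_def at_pos_def by blast
qed

end

end

section \<open>Running time and main theorem\<close>

lemma length_seg: "length (seg (i, j) (i', j')) = (i - i') + (i' - i) + (j - j') + (j' - j)"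
proof (induction "(i, j)" "(i', j')" arbitrary: i j rule: seg.induct)
  case 1
  then show ?case
    by (subst seg.simps) (auto split: if_splits)
qed

lemma length_trail_concat:
  assumes "\<And>k. k < n \<Longrightarrow> last (P k # f k) = P (Suc k)"
    and "\<And>k. k < n \<Longrightarrow> length (trail (P k) (f k)) \<le> B"
  shows "length (trail (P 0) (concat (map f [0..<n]))) \<le> n * B"
proof -
  have "length (concat (map (\<lambda>k. trail (P k) (f k)) [0..<n])) \<le> n * B"
    using assms(2)
  proof (induction n)
    case (Suc n)
    from Suc.IH Suc.prems have "length (concat (map (\<lambda>k. trail (P k) (f k)) [0..<n])) \<le> n * B"
      by simp
    with Suc.prems[of n] show ?case
      by simp
  qed simp
  then show ?thesis
    using trail_concat[of n P f] assms(1) by simp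
qed

text \<open>\<open>d\<close> bounds the way to the strand and \<open>g\<close> the distance of its
  rows. A detour has at most four horizontal and \<open>2 * g\<close> vertical steps; four more per
  detour are ample for the final return along row \<open>r\<close>.\<close>

lemma length_trail_strand:
  assumes "h \<ge> 2" "(i - s) + (s - i) \<le> d" "(s - r) + (r - s) \<le> g"
  shows "length (trail (i, 0) (strand h s r)) \<le> d + ((h - 1) div 2 + 1) * (8 + 2 * g)"
proof -
  let ?n = "(h - 1) div 2"
  let ?P = "\<lambda>k. (s, 2 * k - 1 - h mod 2)"
  let ?f = "\<lambda>k. zig s r (2 * k + 2 - h mod 2)"
  have last: "last (?P k # ?f k) = ?P (Suc k)" for k
    by (simp add: zig_def mod2_eq_if)
  have "length (trail (?P 0) (concat (map ?f [0..<?n]))) \<le> ?n * (4 + 2 * g)"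
  proof (rule length_trail_concat[where P = ?P, OF last])
    show "length (trail (?P k) (?f k)) \<le> 4 + 2 * g" for k
      using assms(3) by (cases "even h") (auto simp: zig_def length_seg even_iff_mod_2_eq_zero odd_iff_mod_2_eq_one)
  qed
  moreover have "trail (i, 0) (strand h s r) = seg (i, 0) (s, 0) @
      trail (?P 0) (concat (map ?f [0..<?n])) @ trail (?P ?n) [(s, h - 1), (r, h - 1), (r, 0)]"
    using trail_concat[of ?n ?P ?f, OF last]
    unfolding strand_def trail.simps(2) trail_append by simp
  moreover have "length (trail (?P ?n) [(s, h - 1), (r, h - 1), (r, 0)]) \<le> (?n + 1) * 4 + g"
    using assms(3) by (cases rule: columns_cases[OF assms(1)]) (auto simp: length_seg)
  moreover have "length (seg (i, 0) (s, 0)) \<le> d"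
    using assms(2) by (simp add: length_seg)
  ultimately show ?thesis
    by (simp add: algebra_simps)
qed

text \<open>Only the closing strand joins distant rows and pays about \<open>2 * N\<close> per
  vertical piece; all other strands join adjacent rows. This keeps the total proportional to the
  area of the grid.\<close>

lemma length_trail_even:
  assumes "h \<ge> 2"
  shows "length (trail (0, 0) (even_corners (2 * N + 2) h)) \<le> 17 * (((h - 1) div 2 + 1) * (N + 1))"
proof -
  let ?P = "\<lambda>k. (2 * k - 1, 0 :: nat)"
  let ?f = "\<lambda>k. strand h (2 * k + 2) (2 * k + 1)"
  define n where "n = (h - 1) div 2 + 1"
  have last: "last (?P k # ?f k) = ?P (Suc k)" for k
    by (simp add: strand_def)
  have "length (trail (?P 0) (concat (map ?f [0..<N]))) \<le> N * (3 + n * 10)"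
  proof (rule length_trail_concat[where P = ?P, OF last])
    show "length (trail (?P k) (?f k)) \<le> 3 + n * 10" for k
      using length_trail_strand[OF assms, of "2 * k - 1" "2 * k + 2" 3 "2 * k + 1" 1]
      by (simp add: n_def)
  qed
  moreover have "length (trail (2 * N - 1, 0) (strand h (2 * N + 1) 0)) \<le> 2 + n * (8 + 2 * (2 * N + 1))"
    using length_trail_strand[OF assms, of "2 * N - 1" "2 * N + 1" 2 0 "2 * N + 1"]
    by (simp add: n_def)
  moreover have "trail (0, 0) (even_corners (2 * N + 2) h) =
      trail (?P 0) (concat (map ?f [0..<N])) @ trail (2 * N - 1, 0) (strand h (2 * N + 1) 0)"
    using trail_concat[of N ?P ?f, OF last]
    unfolding even_corners_eq[OF assms] trail_append by simp
  ultimately have "length (trail (0, 0) (even_corners (2 * N + 2) h)) \<le>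
      N * (3 + n * 10) + (2 + n * (8 + 2 * (2 * N + 1)))"
    by simp
  also have "\<dots> = 3 * N + 14 * (n * N) + 10 * n + 2"
    by (simp add: algebra_simps)
  also have "\<dots> \<le> 17 * (n * N) + 17 * n"
  proof -
    have n: "n \<ge> 1"
      by (simp add: n_def)
    then have "1 * N \<le> n * N"
      by (rule mult_le_mono1)
    with n show ?thesis
      by linarith
  qed
  finally show ?thesis
    by (simp add: n_def algebra_simps)
qed

text \<open>Runs of full height occur only in the sweep, one per column, so their total length is
  about the area.\<close>

lemma length_trail_odd:
  "length (trail (0, 0) (odd_corners (2 * W + 3) (2 * H + 3))) \<le> 40 * ((W + 1) * (H + 2))"
proof -
  define h where "h = 2 * H + 3"
  have h2: "h \<ge> 2" and hh: "(h - 1) div 2 = H + 1"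
    by (simp_all add: h_def)
  let ?f = "\<lambda>k. [(0, 2 * k + 1), (2 * W + 2, 2 * k + 1), (2 * W + 2, 2 * k + 2), (0, 2 * k + 2)]"
  let ?P = "\<lambda>k. (0 :: nat, 2 * k)"
  let ?F = "concat (map ?f [0..<Suc H])"
  let ?g = "\<lambda>k. zig 0 1 (2 * H + 1 - 2 * k)"
  let ?Q = "\<lambda>k. (0 :: nat, 2 * H + 2 - 2 * k)"
  let ?G = "concat (map ?g [0..<H])"
  let ?m = "\<lambda>k. strand h (2 * k + 2) (2 * k + 3)"
  let ?R = "\<lambda>k. (2 * k + 1, 0 :: nat)"
  let ?M = "concat (map ?m [0..<W])"
  let ?T = "[(2 * W + 2, 0), (2 * W + 2, 2 * H + 2), (1, 2 * H + 2), (1, 0), (0, 0)] :: point list"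
  have lastf: "last (?P k # ?f k) = ?P (Suc k)" for k
    by simp
  have lastg: "last (?Q k # ?g k) = ?Q (Suc k)" for k
    by (simp add: zig_def)
  have lastm: "last (?R k # ?m k) = ?R (Suc k)" for k
    by (simp add: strand_def)
  have tr: "trail (0, 0) (odd_corners (2 * W + 3) (2 * H + 3)) =
      trail (0, 0) ?F @ trail (0, 2 * H + 2) ?G @ trail (0, 2) [(0, 1), (1, 1), (1, 0)] @
      trail (1, 0) ?M @ trail (2 * W + 1, 0) ?T"
    unfolding h_def by (rule trail_odd_corners)
  have "length (trail (?P 0) ?F) \<le> Suc H * (4 * W + 6)"
    by (rule length_trail_concat[where P = ?P, OF lastf]) (simp add: length_seg)
  moreover have "length (trail (?Q 0) ?G) \<le> H * 4"
    by (rule length_trail_concat[where P = ?Q, OF lastg]) (simp add: length_seg zig_def)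
  moreover have "length (trail (0, 2) [(0, 1), (1, 1), (1, 0)]) = 3"
    by (simp add: length_seg)
  moreover have "length (trail (?R 0) ?M) \<le> W * (1 + (H + 2) * 10)"
  proof (rule length_trail_concat[where P = ?R, OF lastm])
    show "length (trail (?R k) (?m k)) \<le> 1 + (H + 2) * 10" for k
      using length_trail_strand[OF h2, of "2 * k + 1" "2 * k + 2" 1 "2 * k + 3" 1] unfolding hh
      by simp
  qed
  moreover have "length (trail (2 * W + 1, 0) ?T) = 4 * H + 2 * W + 7"
    by (simp add: length_seg)
  ultimately show ?thesis
    unfolding tr by (simp add: algebra_simps)
qed

section \<open>The complete program and its three cases\<close>

definition main_com :: com where
  "main_com =
     Ops [READ 1, READ 2, SET 6 1, SET 7 2, ADD 15 2 8, SUB 17 15 7] ;;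
     While 17 (Ops [SUB 15 15 7, SUB 17 15 7]) ;;
     Ops [ADD 16 1 8, SUB 17 16 7] ;;
     While 17 (Ops [SUB 16 16 7, SUB 17 16 7]) ;;
     Ops [SUB 9 1 6, SUB 10 2 6, SUB 17 16 6] ;;
     If 17 (even_com False)
       (Ops [SUB 17 15 6] ;;
        If 17 (Ops [SUB 9 2 6, SUB 10 1 6, ADD 15 16 8] ;; even_com True) (odd_com False))"

lemma achieves_False: "(\<And>m. \<not> P m) \<Longrightarrow> achieves P c B Q"
  by (simp add: achieves_def)

lemma half_loop: "k \<le> (h - 1) div 2 \<Longrightarrow> h - 2 * k - 2 > 0 \<longleftrightarrow> k < (h - 1) div 2" for h k :: nat
  by presburger

lemma half_loop_end: "h \<ge> 1 \<Longrightarrow> h - 2 * ((h - 1) div 2) = 2 - h mod 2" for h :: nat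
  by presburger

text \<open>Repeated subtraction of 2, while the value exceeds 2, turns \<open>n\<close> into
  \<open>2 - n mod 2\<close> in linear time. For the columns this is the first detour column;
  lowered by 1 it tests for evenness.\<close>

lemma main_prelude:
  assumes "w \<ge> 2" "h \<ge> 2"
    and "achieves (\<lambda>m. m = state w h (2 - w mod 2) (w - 1) (h - 1) (2 - h mod 2) 0 0 0 0 0 0 (1 - w mod 2) [])
      d B Q"
  shows "achieves (\<lambda>m. m = ((\<lambda>_. 0), [w, h], []))
    (Ops [READ 1, READ 2, SET 6 1, SET 7 2, ADD 15 2 8, SUB 17 15 7] ;;
     While 17 (Ops [SUB 15 15 7, SUB 17 15 7]) ;;
     Ops [ADD 16 1 8, SUB 17 16 7] ;;
     While 17 (Ops [SUB 16 16 7, SUB 17 16 7]) ;;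
     Ops [SUB 9 1 6, SUB 10 2 6, SUB 17 16 6] ;; d) (3 * w + 3 * h + 17 + B) Q"
proof -
  let ?n = "(h - 1) div 2" and ?l = "(w - 1) div 2"
  let ?L = "\<lambda>z p q x. [z, w, h, 0, 0, 0, 1, 2, 0, 0, 0, 0, 0, 0, 0, p, q, x]"
  have 1: "achieves (\<lambda>m. m = ((\<lambda>_. 0), [w, h], []))
      (Ops [READ 1, READ 2, SET 6 1, SET 7 2, ADD 15 2 8, SUB 17 15 7]) 6
      (\<lambda>m. m = list_mem (?L 0 h 0 (h - 2)) [])"
  proof (rule achieves_Ops)
    have "(\<lambda>_. 0)(1 := w, 2 := h) = (\<lambda>k. if k < length ((replicate 18 0)[1 := w, 2 := h])
        then (replicate 18 0)[1 := w, 2 := h] ! k else 0)"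
      by (auto simp: fun_eq_iff nth_list_update)
    then have "fold op [READ 1, READ 2] ((\<lambda>_. 0), [w, h], []) = list_mem ((replicate 18 0)[1 := w, 2 := h]) []"
      by (simp add: list_mem_def del: One_nat_def)
    also have "(replicate 18 0)[1 := w, 2 := h] = [0, w, h, 0, 0, 0, 0, 0, 0, 0, 0, 0, 0, 0, 0, 0, 0, 0 :: nat]"
      by (simp add: numeral_eq_Suc)
    finally show "fold op [READ 1, READ 2, SET 6 1, SET 7 2, ADD 15 2 8, SUB 17 15 7] m =
        list_mem (?L 0 h 0 (h - 2)) []" if "m = ((\<lambda>_. 0), [w, h], [])" for m
      using that by (simp add: op_list_mem list_update_numeral)
  qed auto
  have 2: "achieves (\<lambda>m. m = list_mem (?L 0 h 0 (h - 2)) []) (While 17 (Ops [SUB 15 15 7, SUB 17 15 7]))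
      ((\<Sum>k<?n. 2 + 1) + 3) (\<lambda>m. m = list_mem (?L 1 (h - 2 * ?n) 0 (h - 2 * ?n - 2)) [])"
  proof (rule achieves_While[where I = "\<lambda>k m. m = list_mem (?L 1 (h - 2 * k) 0 (h - 2 * k - 2)) []"])
    fix k m assume "k \<le> ?n" "m = list_mem (?L 1 (h - 2 * k) 0 (h - 2 * k - 2)) []"
    then show "reg m 17 > 0 \<longleftrightarrow> k < ?n"
      using half_loop[of k h] by (simp add: reg_list_mem)
  next
    fix k
    show "achieves (\<lambda>m. m = list_mem (?L 1 (h - 2 * k) 0 (h - 2 * k - 2)) []) (Ops [SUB 15 15 7, SUB 17 15 7]) 2
        (\<lambda>m. m = list_mem (?L 1 (h - 2 * Suc k) 0 (h - 2 * Suc k - 2)) [])"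
      by (rule achieves_Ops) (auto simp: op_list_mem list_update_numeral)
  qed (auto simp: op_list_mem)
  have 3: "achieves (\<lambda>m. m = list_mem (?L 1 p 0 x) []) (Ops [ADD 16 1 8, SUB 17 16 7]) 2
      (\<lambda>m. m = list_mem (?L 1 p w (w - 2)) [])" for p x
    by (rule achieves_Ops) (auto simp: op_list_mem list_update_numeral)
  have 4: "achieves (\<lambda>m. m = list_mem (?L 1 p w (w - 2)) []) (While 17 (Ops [SUB 16 16 7, SUB 17 16 7]))
      ((\<Sum>k<?l. 2 + 1) + 3) (\<lambda>m. m = list_mem (?L 1 p (w - 2 * ?l) (w - 2 * ?l - 2)) [])" for p
  proof (rule achieves_While[where I = "\<lambda>k m. m = list_mem (?L 1 p (w - 2 * k) (w - 2 * k - 2)) []"])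
    fix k m assume "k \<le> ?l" "m = list_mem (?L 1 p (w - 2 * k) (w - 2 * k - 2)) []"
    then show "reg m 17 > 0 \<longleftrightarrow> k < ?l"
      using half_loop[of k w] by (simp add: reg_list_mem)
  next
    fix k
    show "achieves (\<lambda>m. m = list_mem (?L 1 p (w - 2 * k) (w - 2 * k - 2)) []) (Ops [SUB 16 16 7, SUB 17 16 7]) 2
        (\<lambda>m. m = list_mem (?L 1 p (w - 2 * Suc k) (w - 2 * Suc k - 2)) [])"
      by (rule achieves_Ops) (auto simp: op_list_mem list_update_numeral)
  qed (auto simp: op_list_mem)
  have e: "h - 2 * ?n = 2 - h mod 2" "w - 2 * ?l = 2 - w mod 2" "2 - w mod 2 - 1 = 1 - w mod 2"
    using assms half_loop_end[of h] half_loop_end[of w] by simp_all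
  have 5: "achieves (\<lambda>m. m = list_mem (?L 1 (h - 2 * ?n) (w - 2 * ?l) (w - 2 * ?l - 2)) [])
      (Ops [SUB 9 1 6, SUB 10 2 6, SUB 17 16 6]) 3
      (\<lambda>m. m = state w h (2 - w mod 2) (w - 1) (h - 1) (2 - h mod 2) 0 0 0 0 0 0 (1 - w mod 2) [])"
    unfolding e(1,2)
    by (rule achieves_Ops) (use e(3) in \<open>auto simp: op_list_mem list_update_numeral state_def\<close>)
  show ?thesis
    by (rule achieves_weaken[OF achieves_Seq[OF 1 achieves_Seq[OF 2 achieves_Seq[OF 3
      achieves_Seq[OF 4 achieves_Seq[OF 5 assms(3)]]]]]]) auto
qed

lemma main_even:
  assumes w: "w = 2 * N + 2" and h: "h \<ge> 2"
  shows "computes_within (compile 0 main_com) [w, h] (encode_walk (trail (0, 0) (even_corners w h)))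
    (500 * (w * h))"
proof -
  let ?state = "state w h (2 - w mod 2) (w - 1) (h - 1) (2 - h mod 2) 0 0 0 0 0 0 (1 - w mod 2) []"
  let ?B = "5 * length (trail (0, 0) (even_corners w h)) + (37 * ((h - 1) div 2) + 48) * (N + 1)"
  let ?Q = "\<lambda>m :: mem. snd (snd m) = printed False (trail (0, 0) (even_corners w h))"
  have state: "at_pos w h (2 - w mod 2) (w - 1) (h - 1) (2 - h mod 2) 0 0 0 0 [] ?state"
    by (rule at_posI)
  have even: "achieves (\<lambda>m. m = ?state \<and> reg m 17 > 0) (even_com False) ?B ?Q"
    by (rule achieves_weaken[OF even_achieves[OF h refl refl, of _ N]]) (use w state in auto)
  have r: "reg ?state 17 = 1"
    by (simp add: op_state w)
  \<comment> \<open>For even \<open>w\<close> the tested register is 1, so the precondition of the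
    alternative is contradictory.\<close>
  have "achieves (\<lambda>m. m = ?state) (If 17 (even_com False)
       (Ops [SUB 17 15 6] ;;
        If 17 (Ops [SUB 9 2 6, SUB 10 1 6, ADD 15 16 8] ;; even_com True) (odd_com False))) (?B + 3) ?Q"
    by (rule achieves_If[OF even], rule achieves_False) (use r in auto)
  from main_prelude[OF _ h this]
  have a: "achieves (\<lambda>m. m = ((\<lambda>_. 0), [w, h], [])) main_com (3 * w + 3 * h + 17 + (?B + 3)) ?Q"
    using w by (simp add: main_com_def)
  have "3 * w + 3 * h + 17 + (?B + 3) \<le> 500 * (w * h)"
  proof -
    define n where "n = (h - 1) div 2 + 1"
    have n: "n \<le> h" "N + 1 \<le> w" "n \<ge> 1" "(h - 1) div 2 = n - 1"
      using h w by (auto simp: n_def)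
    \<comment> \<open>The 85 is 5 machine steps per vertex times the factor 17 of the length
      bound.\<close>
    have "5 * length (trail (0, 0) (even_corners w h)) \<le> 85 * (n * (N + 1))"
      using length_trail_even[OF h, of N] by (simp add: w n_def)
    moreover have "(37 * ((h - 1) div 2) + 48) * (N + 1) \<le> 48 * (n * (N + 1))"
      unfolding mult.assoc [symmetric] using n(3,4) by (intro mult_right_mono) auto
    moreover have "n * (N + 1) \<le> w * h"
      using mult_le_mono[OF n(1,2)] by (simp only: mult.commute)
    moreover have "w \<le> w * h" "h \<le> w * h" "1 \<le> w * h"
    proof -
      have "w > 0" "h > 0"
        using w h by simp_all
      then show "w \<le> w * h" "h \<le> w * h" "1 \<le> w * h"
        by simp_all
    qed
    ultimately show ?thesis
      by linarith
  qed
  from achieves_weaken[OF a this] show ?thesis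
    by (intro achieves_computes) (simp add: encode_walk_printed)
qed

text \<open>The program exchanges the roles of the dimensions in the registers 9, 10 and 15 and
  prints each vertex with its coordinates exchanged. It thus walks through the transposed grid,
  whose number of rows is even.\<close>

lemma main_swap:
  assumes w: "odd w" "w \<ge> 2" and h: "h = 2 * N + 2"
  shows "computes_within (compile 0 main_com) [w, h]
    (encode_walk (map prod.swap (trail (0, 0) (even_corners h w)))) (500 * (w * h))"
proof -
  let ?state = "state w h (2 - w mod 2) (w - 1) (h - 1) (2 - h mod 2) 0 0 0 0 0 0 (1 - w mod 2) []"
  let ?B = "5 * length (trail (0, 0) (even_corners h w)) + (37 * ((w - 1) div 2) + 48) * (N + 1)"
  let ?Q = "\<lambda>m :: mem. snd (snd m) = printed True (trail (0, 0) (even_corners h w))"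
  have w1: "w mod 2 = 1" and h0: "h mod 2 = 0"
    using w h by presburger+
  have r: "reg ?state 17 = 0"
    by (simp add: op_state w1)
  have 1: "achieves (\<lambda>m. m = ?state \<and> reg m 17 = 0) (Ops [SUB 17 15 6]) 1
      (\<lambda>m. m = state w h 1 (w - 1) (h - 1) 2 0 0 0 0 0 0 1 [])"
    by (rule achieves_Ops) (auto simp: w1 h0 state_def op_list_mem list_update_numeral)
  have 2: "achieves (\<lambda>m. m = state w h 1 (w - 1) (h - 1) 2 0 0 0 0 0 0 1 [] \<and> reg m 17 > 0)
      (Ops [SUB 9 2 6, SUB 10 1 6, ADD 15 16 8]) 3
      (at_pos w h 1 (h - 1) (w - 1) (2 - w mod 2) 0 0 0 0 [])"
  proof (rule achieves_Ops)
    fix m assume "m = state w h 1 (w - 1) (h - 1) 2 0 0 0 0 0 0 1 [] \<and> reg m 17 > 0"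
    then have "fold op [SUB 9 2 6, SUB 10 1 6, ADD 15 16 8] m =
        state w h 1 (h - 1) (w - 1) (2 - w mod 2) 0 0 0 0 0 0 1 []"
      by (auto simp: w1 state_def op_list_mem list_update_numeral)
    then show "at_pos w h 1 (h - 1) (w - 1) (2 - w mod 2) 0 0 0 0 []
        (fold op [SUB 9 2 6, SUB 10 1 6, ADD 15 16 8] m)"
      by (simp only: at_posI)
  qed auto
  have 3: "achieves (at_pos w h 1 (h - 1) (w - 1) (2 - w mod 2) 0 0 0 0 []) (even_com True) ?B ?Q"
    by (rule achieves_weaken[OF even_achieves[OF w(2) refl refl, of _ N]]) (use h in auto)
  have Q0: "?Q (op (SET 0 1) m) \<longleftrightarrow> ?Q m" for m
    by (cases m) simp
  have 4: "achieves (\<lambda>m. m = state w h 1 (w - 1) (h - 1) 2 0 0 0 0 0 0 1 [])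
      (If 17 (Ops [SUB 9 2 6, SUB 10 1 6, ADD 15 16 8] ;; even_com True) (odd_com False)) (3 + ?B + 3) ?Q"
    by (rule achieves_If[OF achieves_Seq[OF 2 3]], rule achieves_False) (auto simp: op_state)
  have "achieves (\<lambda>m. m = ?state) (If 17 (even_com False)
       (Ops [SUB 17 15 6] ;;
        If 17 (Ops [SUB 9 2 6, SUB 10 1 6, ADD 15 16 8] ;; even_com True) (odd_com False)))
       (1 + (3 + ?B + 3) + 3) ?Q"
    by (rule achieves_If, rule achieves_False) (use r achieves_Seq[OF 1 4] Q0 in auto)
  from main_prelude[OF w(2) _ this]
  have a: "achieves (\<lambda>m. m = ((\<lambda>_. 0), [w, h], [])) main_com
      (3 * w + 3 * h + 17 + (1 + (3 + ?B + 3) + 3)) ?Q"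
    using h by (simp add: main_com_def)
  have "3 * w + 3 * h + 17 + (1 + (3 + ?B + 3) + 3) \<le> 500 * (w * h)"
  proof -
    define n where "n = (w - 1) div 2 + 1"
    have n: "n \<le> w" "N + 1 \<le> h" "n \<ge> 1" "(w - 1) div 2 = n - 1"
      using h w by (auto simp: n_def)
    have "5 * length (trail (0, 0) (even_corners h w)) \<le> 85 * (n * (N + 1))"
      using length_trail_even[OF w(2), of N] by (simp add: h n_def)
    moreover have "(37 * ((w - 1) div 2) + 48) * (N + 1) \<le> 48 * (n * (N + 1))"
      unfolding mult.assoc [symmetric] using n(3,4) by (intro mult_right_mono) auto
    moreover have "n * (N + 1) \<le> w * h"
      using n(1,2) by (rule mult_le_mono)
    moreover have "w \<le> w * h" "h \<le> w * h" "1 \<le> w * h"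
    proof -
      have "w > 0" "h > 0"
        using w h by simp_all
      then show "w \<le> w * h" "h \<le> w * h" "1 \<le> w * h"
        by simp_all
    qed
    ultimately show ?thesis
      by linarith
  qed
  from achieves_weaken[OF a this] show ?thesis
    by (intro achieves_computes) (simp add: encode_walk_printed(2))
qed

lemma main_odd:
  assumes w: "w = 2 * W + 3" and h: "h = 2 * H + 3"
  shows "computes_within (compile 0 main_com) [w, h] (encode_walk (trail (0, 0) (odd_corners w h)))
    (500 * (w * h))"
proof -
  let ?state = "state w h (2 - w mod 2) (w - 1) (h - 1) (2 - h mod 2) 0 0 0 0 0 0 (1 - w mod 2) []"
  let ?B = "5 * length (trail (0, 0) (odd_corners w h)) +
      36 * (H + 1) + 36 * H + (37 * (H + 1) + 44) * W + 90"
  let ?Q = "\<lambda>m :: mem. snd (snd m) = printed False (trail (0, 0) (odd_corners w h))"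
  have w1: "w mod 2 = 1" and h1: "h mod 2 = 1" and h2: "h \<ge> 2"
    using w h by presburger+
  have r: "reg ?state 17 = 0"
    by (simp add: op_state w1)
  have 1: "achieves (\<lambda>m. m = ?state \<and> reg m 17 = 0) (Ops [SUB 17 15 6]) 1
      (\<lambda>m. m = state w h 1 (w - 1) (h - 1) (2 - h mod 2) 0 0 0 0 0 0 0 [])"
    by (rule achieves_Ops) (auto simp: w1 h1 state_def op_list_mem list_update_numeral)
  have "achieves (at_pos w h 1 (w - 1) (h - 1) (2 - h mod 2) 0 0 0 0 []) (odd_com False) ?B ?Q"
    using odd_achieves[OF h2 refl refl _ h, where W = W and u = w and v = h and q = 1 and e = False
        and o' = "[]" and s = 0 and r = 0 and ?w1.0 = "w - 1"] w h by simp
  then have 3: "achieves (\<lambda>m. m = state w h 1 (w - 1) (h - 1) (2 - h mod 2) 0 0 0 0 0 0 0 [] \<and> reg m 17 = 0)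
      (odd_com False) ?B ?Q"
    by (rule achieves_weaken) (auto simp: at_posI)
  have Q0: "?Q (op (SET 0 1) m) \<longleftrightarrow> ?Q m" for m
    by (cases m) simp
  have 4: "achieves (\<lambda>m. m = state w h 1 (w - 1) (h - 1) (2 - h mod 2) 0 0 0 0 0 0 0 [])
      (If 17 (Ops [SUB 9 2 6, SUB 10 1 6, ADD 15 16 8] ;; even_com True) (odd_com False)) (?B + 3) ?Q"
    by (rule achieves_If, rule achieves_False) (use 3 Q0 in \<open>auto simp: op_state\<close>)
  have "achieves (\<lambda>m. m = ?state) (If 17 (even_com False)
       (Ops [SUB 17 15 6] ;;
        If 17 (Ops [SUB 9 2 6, SUB 10 1 6, ADD 15 16 8] ;; even_com True) (odd_com False)))
       (1 + (?B + 3) + 3) ?Q"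
    by (rule achieves_If, rule achieves_False) (use r achieves_Seq[OF 1 4] Q0 in auto)
  from main_prelude[OF _ h2 this]
  have a: "achieves (\<lambda>m. m = ((\<lambda>_. 0), [w, h], [])) main_com
      (3 * w + 3 * h + 17 + (1 + (?B + 3) + 3)) ?Q"
    using w by (simp add: main_com_def)
  have "3 * w + 3 * h + 17 + (1 + (?B + 3) + 3) \<le> 500 * (w * h)"
    using length_trail_odd[of W H] by (simp add: w h algebra_simps)
  from achieves_weaken[OF a this] show ?thesis
    by (intro achieves_computes) (simp add: encode_walk_printed)
qed

text \<open>Already the horizontal edges number \<open>w * (h - 1)\<close>, at least half of
  \<open>w * h\<close>. This turns a time bound in terms of the area into one in terms of the number
  of edges.\<close>

lemma card_grid_edges:
  assumes "w \<ge> 2" "h \<ge> 2"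
  shows "w * h \<le> 2 * card (grid_edges w h)"
proof -
  let ?f = "\<lambda>(i, j). {(i, j), (i, Suc j)} :: point set"
  have "inj_on ?f ({..<w} \<times> {..<h - 1})"
    by (auto simp: inj_on_def doubleton_eq_iff)
  then have "w * (h - 1) = card (?f ` ({..<w} \<times> {..<h - 1}))"
    by (simp add: card_image)
  also have "\<dots> \<le> card (grid_edges w h)"
  proof (rule card_mono)
    have "grid_edges w h \<subseteq> Pow (grid_verts w h)"
      by (auto simp: grid_edges_def)
    then show "finite (grid_edges w h)"
      by (rule finite_subset) (simp add: grid_verts_def)
    show "?f ` ({..<w} \<times> {..<h - 1}) \<subseteq> grid_edges w h"
      by (auto simp: grid_edges_def grid_verts_def horizontal_edge_iff)
  qed
  finally have "w * (h - 1) \<le> card (grid_edges w h)" .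
  moreover have "w * h \<le> 2 * (w * (h - 1))"
  proof -
    have "h \<le> 2 * (h - 1)"
      using assms by simp
    then have "w * h \<le> w * (2 * (h - 1))"
      by (rule mult_le_mono2)
    then show ?thesis
      by (simp add: mult.left_commute)
  qed
  ultimately show ?thesis
    by linarith
qed

lemma computes_within_mono:
  assumes "computes_within P xs ys t" "t \<le> u"
  shows "computes_within P xs ys u"
proof -
  define s where "s = (ram_step P ^^ t) (initial xs)"
  have h: "halted P s" "out_tape s = ys"
    using assms(1) by (auto simp: computes_within_def s_def Let_def)
  have "(ram_step P ^^ k) s = s" for k
    by (induction k) (use h in \<open>simp_all add: ram_step_def\<close>)
  moreover have "(ram_step P ^^ u) (initial xs) = (ram_step P ^^ (u - t)) s"
    using assms(2) unfolding s_def by (metis comp_apply funpow_add le_add_diff_inverse2)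
  ultimately show ?thesis
    using h by (simp add: computes_within_def)
qed

lemma ceiling_half: "\<lceil>real n / 2\<rceil> = int ((n + 1) div 2)"
  by (rule ceiling_unique) (cases "even n"; auto elim!: evenE oddE simp: field_simps)+

theorem theorem22:
  shows "\<exists>(P :: instr list) (T :: nat \<Rightarrow> nat).
    (\<lambda>m. real (T m)) \<in> O(\<lambda>m. real m) \<and>
    (\<forall>w h :: nat. w \<ge> 2 \<longrightarrow> h \<ge> 2 \<longrightarrow>
      (\<exists>vs. threading (grid_verts w h) (grid_edges w h) vs \<and>
        computes_within P [w, h] (encode_walk vs) (T (card (grid_edges w h))) \<and>
        (even w \<or> even h \<longrightarrow>
          int (num_turns vs) = 2 * \<lceil>real w / 2\<rceil> * (2 * \<lceil>real h / 2\<rceil>) \<and>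
          (\<forall>vs'. threading (grid_verts w h) (grid_edges w h) vs' \<longrightarrow>
             num_turns vs \<le> num_turns vs')) \<and>
        (odd w \<and> odd h \<longrightarrow>
          int (num_turns vs) = 2 * \<lceil>real w / 2\<rceil> * (2 * \<lceil>real h / 2\<rceil>) - 4)))"
proof (rule exI[of _ "compile 0 main_com"], rule exI[of _ "\<lambda>m. 1000 * m"], intro conjI allI impI)
  show "(\<lambda>m. real (1000 * m)) \<in> O(\<lambda>m. real m)"
    by simp
next
  fix w h :: nat assume wh: "w \<ge> 2" "h \<ge> 2"
  \<comment> \<open>At most 500 steps per vertex and at most two vertices per edge give the constant
    1000.\<close>
  have time: "500 * (w * h) \<le> 1000 * card (grid_edges w h)"
    using card_grid_edges[OF wh] by linarith
  consider (even) N where "w = 2 * N + 2" | (swap) N where "odd w" "h = 2 * N + 2"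
    | (odd) W H where "w = 2 * W + 3" "h = 2 * H + 3"
  proof -
    have "\<exists>N. n = 2 * N + 2" if "even n" "n \<ge> 2" for n :: nat
      using that by presburger
    moreover have "\<exists>N. n = 2 * N + 3" if "odd n" "n \<ge> 2" for n :: nat
      using that by presburger
    ultimately show thesis
      using wh that by meson
  qed
  then show "\<exists>vs. threading (grid_verts w h) (grid_edges w h) vs \<and>
        computes_within (compile 0 main_com) [w, h] (encode_walk vs) (1000 * card (grid_edges w h)) \<and>
        (even w \<or> even h \<longrightarrow>
          int (num_turns vs) = 2 * \<lceil>real w / 2\<rceil> * (2 * \<lceil>real h / 2\<rceil>) \<and>
          (\<forall>vs'. threading (grid_verts w h) (grid_edges w h) vs' \<longrightarrow>
             num_turns vs \<le> num_turns vs')) \<and>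
        (odd w \<and> odd h \<longrightarrow>
          int (num_turns vs) = 2 * \<lceil>real w / 2\<rceil> * (2 * \<lceil>real h / 2\<rceil>) - 4)"
  proof cases
    case (even N)
    let ?ds = "even_corners w h"
    interpret corners w h ?ds
      using even_corners_good[OF wh(2), of N] even wh by unfold_locales simp_all
    have walk: "corner_walk ?ds = trail (0, 0) ?ds"
      using even_corners_last[OF wh(2), of N] even by (simp add: corner_walk_def)
    have turns: "num_turns (corner_walk ?ds) = w * (2 * ((h + 1) div 2))"
      using num_turns even_corners_length[OF wh(2), of N] even by simp
    have "computes_within (compile 0 main_com) [w, h] (encode_walk (corner_walk ?ds))
        (1000 * card (grid_edges w h))"
      unfolding walk by (rule computes_within_mono[OF main_even[OF even wh(2)] time])
    \<comment> \<open>For even \<open>w\<close> the count by rows is attained exactly.\<close>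
    moreover have "\<forall>vs'. threading (grid_verts w h) (grid_edges w h) vs' \<longrightarrow>
        num_turns (corner_walk ?ds) \<le> num_turns vs'"
      unfolding turns using num_turns_ge(2)[OF _ wh] by blast
    moreover have "int (num_turns (corner_walk ?ds)) = 2 * \<lceil>real w / 2\<rceil> * (2 * \<lceil>real h / 2\<rceil>)"
      unfolding turns ceiling_half using even by (simp add: algebra_simps)
    ultimately show ?thesis
      using threading even by auto
  next
    case (swap N)
    let ?ds = "even_corners h w"
    have good_ds: "good_corners h w ?ds" and last: "last ?ds = (0, 0)"
      and len: "length ?ds = h * (2 * ((w + 1) div 2))"
      using even_corners_good[OF wh(1), of N] even_corners_last[OF wh(1), of N]
        even_corners_length[OF wh(1), of N] swap by simp_all
    then have ne: "?ds \<noteq> []"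
      using wh by auto
    interpret corners w h "map prod.swap ?ds"
      using good_corners_swap[OF good_ds ne] wh by unfold_locales
    have walk: "corner_walk (map prod.swap ?ds) = map prod.swap (trail (0, 0) ?ds)"
      using corner_walk_swap[OF good_ds ne] last by (simp add: corner_walk_def)
    have turns: "num_turns (corner_walk (map prod.swap ?ds)) = h * (2 * ((w + 1) div 2))"
      using num_turns len by simp
    have "computes_within (compile 0 main_com) [w, h] (encode_walk (corner_walk (map prod.swap ?ds)))
        (1000 * card (grid_edges w h))"
      unfolding walk by (rule computes_within_mono[OF main_swap[OF swap(1) wh(1) swap(2)] time])
    \<comment> \<open>For even \<open>h\<close> the count by columns is attained exactly.\<close>
    moreover have "\<forall>vs'. threading (grid_verts w h) (grid_edges w h) vs' \<longrightarrow>
        num_turns (corner_walk (map prod.swap ?ds)) \<le> num_turns vs'"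
      unfolding turns using num_turns_ge(1)[OF _ wh] by blast
    moreover have "int (num_turns (corner_walk (map prod.swap ?ds))) =
        2 * \<lceil>real w / 2\<rceil> * (2 * \<lceil>real h / 2\<rceil>)"
    proof -
      have "2 * int ((h + 1) div 2) = int h"
        using swap(2) by simp
      then show ?thesis
        unfolding turns ceiling_half by (simp only: of_nat_mult of_nat_numeral mult.commute)
    qed
    ultimately show ?thesis
      using threading swap by auto
  next
    case (odd W H)
    let ?ds = "odd_corners w h"
    interpret corners w h ?ds
      using odd_corners_good[of W H] odd wh by unfold_locales simp_all
    have walk: "corner_walk ?ds = trail (0, 0) ?ds"
      using odd_corners_last[of W H] odd by (simp add: corner_walk_def)
    have "num_turns (corner_walk ?ds) + 4 = (w + 1) * (h + 1)"
      using num_turns odd_corners_length[of W H] odd by simp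
    then have "int (num_turns (corner_walk ?ds)) = int (w + 1) * int (h + 1) - 4"
      by (metis add_diff_cancel_right' of_nat_add of_nat_mult of_nat_numeral)
    then have "int (num_turns (corner_walk ?ds)) = 2 * \<lceil>real w / 2\<rceil> * (2 * \<lceil>real h / 2\<rceil>) - 4"
      unfolding ceiling_half using odd by simp
    moreover have "computes_within (compile 0 main_com) [w, h] (encode_walk (corner_walk ?ds))
        (1000 * card (grid_edges w h))"
      unfolding walk by (rule computes_within_mono[OF main_odd[OF odd] time])
    ultimately show ?thesis
      using threading odd by auto
  qed
qed

end
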